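(* For every $\epsilon > 0$ there exist a constant $C_\epsilon > 0$ and an integer $R_0(\epsilon)$ such that for all integers $R \ge R_0(\epsilon)$, \[ \operatorname{FR}(\mu_R) \ge C_\epsilon\, R^{-1/4-\epsilon}. \]
   Context: $\mu$ denotes the classical Möbius function: $\mu(1)=1$, $\mu(n)=0$ if $n$ is not squarefree, and $\mu(n)=(-1)^k$ if $n$ is squarefree with $k$ prime factors. For an integer $R\ge 1$ let $X_R=\{1,2,\dots,R\}$ and $X_R'=\{n\le R:\mu(n)\ne 0\}$ (the squarefree integers in $X_R$). Let $\mu_R:X_R'\to\{-1,1\}$ be the restriction of $\mu$ to $X_R'$, extended to $X_R$ by $\mu_R(n)=0$ for $n\notin X_R'$. Its Fourier transform is $\widehat{\mu_R}(x)=\sum_{n=1}^R \mu_R(n)e^{-2\pi i n x}$ for $x\in[0,1]$, and its Fourier Ratio is \[ \operatorname{FR}(\mu_R)=\frac{\|\widehat{\mu_R}\|_{L^1([0,1])}}{\|\widehat{\mu_R}\|_{L^2([0,1])}}, \] with norms taken with respect to Lebesgue measure on $[0,1]$. *)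

theory Defs
  imports "HOL-Analysis.Analysis" "HOL-Computational_Algebra.Squarefree"
begin

(* moebius 0 = 0, because 0 is not squarefree. *)
definition moebius :: "nat \<Rightarrow> int" where
  "moebius n = (if squarefree n then (-1) ^ card (prime_factors n) else 0)"

definition X :: "nat \<Rightarrow> nat set" where
  "X R = {1..R}"

definition X' :: "nat \<Rightarrow> nat set" where
  "X' R = {n \<in> X R. moebius n \<noteq> 0}"

definition mu_R :: "nat \<Rightarrow> nat \<Rightarrow> int" where
  "mu_R R n = (if n \<in> X' R then moebius n else 0)"

(* The transform of a function f on X R; values of f outside X R are irrelevant. *)
definition fourier_transform :: "nat \<Rightarrow> (nat \<Rightarrow> complex) \<Rightarrow> real \<Rightarrow> complex" where
  "fourier_transform R f x =
     (\<Sum>n\<in>X R. f n * exp (- 2 * complex_of_real pi * \<i> * of_nat n * complex_of_real x))"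

(* The L^p([0,1]) norm for 0 < p < \<infinity>. The Bochner integral returns 0 on non-integrable
   functions, so this is meaningful only when |f|^p is integrable on [0,1], as it is for the
   trigonometric polynomials used here. *)
definition Lp_norm :: "real \<Rightarrow> (real \<Rightarrow> complex) \<Rightarrow> real" where
  "Lp_norm p f = (LINT x:{0..1}|lebesgue. norm (f x) powr p) powr (1 / p)"

definition FR :: "nat \<Rightarrow> (nat \<Rightarrow> complex) \<Rightarrow> real" where
  "FR R f = Lp_norm 1 (fourier_transform R f) / Lp_norm 2 (fourier_transform R f)"

end

theory Submission
  imports Defs "HOL-Complex_Analysis.Complex_Analysis" "HOL-Real_Asymp.Real_Asymp"
begin

text \<open>
  Let $\chi$ be the nonprincipal character modulo 4. Its completed L-function is entire, symmetric
  under $s \mapsto 1 - s$ and of order at most 1 up to logarithms; without zeros it would be the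
  exponential of an affine function, hence constant by symmetry, contradicting the growth of the
  Gamma factor. So $L(\rho,\chi) = 0$ for some $\rho$ with $\sigma = \Re\rho \ge 1/2$.

  Put $\psi(y) = 1/(e^y + e^{-y}) = \sum_n \chi(n) e^{-ny}$ and
  $\Theta(y) = \int_1^\infty t^{\rho-1}\psi(yt)\,dt$. The Mellin transform of $\psi$ vanishes at $\rho$,
  so $\Theta$ is bounded near 0 and has bounded variation, while it decays exponentially at infinity.
  Moebius inversion gives $\sum_n \mu(n)\chi(n)\psi(nw) = e^{-w}$, and the sums of
  $\mu(n)\chi(n)\Theta(n/x)$ over $n$ and over the multiples of a prime $p$ are
  $\Gamma(\rho) x^\sigma$ and $\Gamma(\rho)(x/p)^\sigma$ in size. Hence
  $\sum_b S(b/q)$, where $S$ has the coefficients $\mu(n)\chi(n)\Theta(n/x)$ and $b$ runs over the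
  reduced residues modulo $q$, is large for $q = p$ if $\sigma < 1$ and for $q = p^2$ if $\sigma \ge 1$.
  On the other hand $S$ is the convolution of $\widehat{\mu_R}$ with a kernel whose values at the
  Farey fractions of order $\sqrt R$ have an absolute sum of size $O(R \log R)$. With $x = R/(4\log R)$ this
  bounds the $L^1$ norm of $\widehat{\mu_R}$ from below by $R^{1/4-\epsilon}$, whereas its $L^2$ norm is at most
  $\sqrt R$.
\<close>

text \<open>Nothing is known about the location of \<rho> beyond \<sigma> \<ge> 1/2; not even
  \<sigma> < 1 is established, whence the two kinds of denominators. The vanishing of L at \<rho> is
  used in one place: otherwise \<open>Th\<close> would carry a further term of size y^(-\<sigma>)
  near 0, and the kernel would be neither bounded nor of bounded variation. The character modulo 4
  replaces zeta because its L-function has no pole, so that no singular term has to be split off.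
  One value of S could be compared only with a kernel of supremum R; taking all Farey fractions at
  once costs just another logarithm and gains the number of fractions. The exponent 1/4 arises as
  follows, up to logarithms. For \<sigma> < 1 there are sqrt R primes, each contributing at least
  sqrt(p x), of size R^(3/4). For \<sigma> \<ge> 1 the condition p^2 \<le> sqrt R leaves R^(1/4)
  primes, each contributing x, of size R. Both totals are R^(5/4), and the kernel costs R.\<close>

section \<open>Termwise integration; Gamma and Beta integrals\<close>

lemma sums_set_lebesgue_integral:
  fixes f :: "nat \<Rightarrow> real \<Rightarrow> 'a :: euclidean_space"
  assumes int: "\<And>i. f i absolutely_integrable_on S"
    and sm: "\<And>x. x \<in> S \<Longrightarrow> summable (\<lambda>i. norm (f i x))"
    and ns: "summable (\<lambda>i. integral S (\<lambda>x. norm (f i x)))"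
    and g: "\<And>x. x \<in> S \<Longrightarrow> (\<lambda>i. f i x) sums g x"
  shows "g absolutely_integrable_on S" "(\<lambda>i. integral S (f i)) sums integral S g"
proof -
  define F where "F = (\<lambda>i x. indicator S x *\<^sub>R f i x)"
  have I: "integrable lebesgue (F i)" for i
    using int[of i] by (simp add: set_integrable_def F_def)
  have sF: "AE x in lebesgue. summable (\<lambda>i. norm (F i x))"
  proof (rule AE_I2)
    fix x :: real
    show "summable (\<lambda>i. norm (F i x))"
      using sm[of x] by (cases "x \<in> S") (auto simp: F_def)
  qed
  have nint: "(\<lambda>x. norm (f i x)) absolutely_integrable_on S" for i
    using absolutely_integrable_norm[OF int[of i]] by (simp add: o_def)
  have eqn: "(\<integral>x. norm (F i x) \<partial>lebesgue) = integral S (\<lambda>x. norm (f i x))" for i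
  proof -
    have "(\<integral>x. norm (F i x) \<partial>lebesgue) = (LINT x:S|lebesgue. norm (f i x))"
      by (simp add: set_lebesgue_integral_def F_def)
    also have "\<dots> = integral S (\<lambda>x. norm (f i x))"
      by (rule set_lebesgue_integral_eq_integral(2)[OF nint])
    finally show ?thesis .
  qed
  have sI: "summable (\<lambda>i. \<integral>x. norm (F i x) \<partial>lebesgue)"
    using ns by (simp only: eqn)
  have sumF: "(\<Sum>i. F i x) = indicator S x *\<^sub>R g x" for x
    using sums_unique[OF g[of x]] by (cases "x \<in> S") (auto simp: F_def)
  have "integrable lebesgue (\<lambda>x. \<Sum>i. F i x)"
    by (rule integrable_suminf[OF I sF sI])
  then show G: "g absolutely_integrable_on S"
    unfolding sumF set_integrable_def .
  have "(\<lambda>i. \<integral>x. F i x \<partial>lebesgue) sums (\<integral>x. (\<Sum>i. F i x) \<partial>lebesgue)"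
    by (rule sums_integral[OF I sF sI])
  moreover have "(\<integral>x. F i x \<partial>lebesgue) = integral S (f i)" for i
    using set_lebesgue_integral_eq_integral(2)[OF int[of i]]
    by (simp add: set_lebesgue_integral_def F_def)
  moreover have "(\<integral>x. (\<Sum>i. F i x) \<partial>lebesgue) = integral S g"
    unfolding sumF using set_lebesgue_integral_eq_integral(2)[OF G]
    by (simp add: set_lebesgue_integral_def)
  ultimately show "(\<lambda>i. integral S (f i)) sums integral S g" by simp
qed

text \<open>Borel measurability of \<open>f\<close> permits the passage from \<open>lebesgue\<close>
  to \<open>lborel\<close>, where the affine change of variables is available.\<close>

lemma absolutely_integrable_scale_Ioi:
  fixes f :: "real \<Rightarrow> 'a :: euclidean_space"
  assumes c: "c > 0" and m: "f \<in> borel_measurable borel" and f: "f absolutely_integrable_on {0<..}"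
  shows "(\<lambda>t. f (c * t)) absolutely_integrable_on {0<..}"
    and "integral {0<..} (\<lambda>t. f (c * t)) = (1 / c) *\<^sub>R integral {0<..} f"
proof -
  define F where "F = (\<lambda>t. indicator {0<..} t *\<^sub>R f t)"
  have Fm: "F \<in> borel_measurable lborel"
    unfolding F_def using m by measurable
  have Fc: "F (0 + c * t) = indicator {0<..} t *\<^sub>R f (c * t)" for t
    using c by (auto simp: F_def indicator_def zero_less_mult_iff)
  have Fi: "integrable lborel F"
    using f Fm by (simp add: set_integrable_def F_def integrable_completion)
  have hb: "has_bochner_integral lborel F (integral {0<..} f)"
    using Fi set_lebesgue_integral_eq_integral(2)[OF f] Fm
    by (simp add: has_bochner_integral_iff set_lebesgue_integral_def F_def integral_completion)
  have hb2: "has_bochner_integral lborel (\<lambda>t. F (0 + c * t)) (integral {0<..} f /\<^sub>R \<bar>c\<bar>)"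
    using lborel_has_bochner_integral_real_affine_iff[of c F _ 0] hb c by simp
  have Fm2: "(\<lambda>t. F (0 + c * t)) \<in> borel_measurable lborel"
    using hb2 by (auto simp: has_bochner_integral_iff)
  show A: "(\<lambda>t. f (c * t)) absolutely_integrable_on {0<..}"
    using hb2 Fm2 by (simp only: set_integrable_def Fc has_bochner_integral_iff integrable_completion)
  have "integral {0<..} (\<lambda>t. f (c * t)) = (\<integral>t. F (0 + c * t) \<partial>lborel)"
    using set_lebesgue_integral_eq_integral(2)[OF A] Fm2
    by (simp only: set_lebesgue_integral_def Fc integral_completion)
  then show "integral {0<..} (\<lambda>t. f (c * t)) = (1 / c) *\<^sub>R integral {0<..} f"
    using hb2 c by (simp add: has_bochner_integral_iff divide_inverse)
qed

lemma Gamma_integral_scaled: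
  fixes s :: complex and c :: real
  assumes "Re s > 0" "c > 0"
  shows "(\<lambda>t. of_real t powr (s - 1) * of_real (exp (- (c * t)))) absolutely_integrable_on {0<..}"
    and "integral {0<..} (\<lambda>t. of_real t powr (s - 1) * of_real (exp (- (c * t)))) = Gamma s * of_real c powr (- s)"
proof -
  let ?f = "\<lambda>t::real. complex_of_real t powr (s - 1) / of_real (exp t)"
  let ?K = "complex_of_real c powr (1 - s)"
  have f: "?f absolutely_integrable_on {0<..}" "integral {0<..} ?f = Gamma s"
    using absolutely_integrable_Gamma_integral'[OF assms(1)]
      integral_unique[OF Gamma_integral_complex'[OF assms(1)]] by auto
  have m: "?f \<in> borel_measurable borel"
    by measurable
  note A = absolutely_integrable_scale_Ioi[OF assms(2) m f(1)]
  have eq: "of_real t powr (s - 1) * of_real (exp (- (c * t))) = ?K * ?f (c * t)" if "t \<in> {0<..}" for t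
  proof -
    have "complex_of_real (c * t) powr (s - 1) = of_real c powr (s - 1) * of_real t powr (s - 1)"
      using that assms by (simp add: powr_times_real)
    moreover have "?K * of_real c powr (s - 1) = 1"
      using assms by (simp flip: powr_add)
    ultimately show ?thesis
      using assms by (simp add: exp_minus field_simps)
  qed
  have c1: "?K / of_real c = of_real c powr (- s)"
    using assms by (simp add: powr_diff powr_minus field_simps)
  have "(\<lambda>t. ?K * ?f (c * t)) absolutely_integrable_on {0<..}"
    by (rule set_integrable_mult_right) (use A(1) in simp)
  then show "(\<lambda>t. of_real t powr (s - 1) * of_real (exp (- (c * t)))) absolutely_integrable_on {0<..}"
    by (subst set_integrable_cong[OF refl refl eq])
  have "integral {0<..} (\<lambda>t. ?K * ?f (c * t)) = ?K * ((1 / c) *\<^sub>R Gamma s)"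
    using A(2) f(2) by (simp only: integral_mult_right)
  also have "\<dots> = Gamma s * of_real c powr (- s)"
    by (simp add: scaleR_conv_of_real flip: c1)
  finally show "integral {0<..} (\<lambda>t. of_real t powr (s - 1) * of_real (exp (- (c * t)))) = Gamma s * of_real c powr (- s)"
    by (subst Henstock_Kurzweil_Integration.integral_cong[of "{0<..}", OF eq])
qed

text \<open>The substitution t = y^2 / (b^2 + y^2) maps the half-line onto the unit interval and
  produces the Beta integral with parameters s/2 and 1 - s/2. With \<open>b\<close> = (pi/2) n this
  is the Mellin transform of one partial fraction of \<open>psi4\<close>.\<close>

lemma Beta_integral_rational:
  fixes s b :: real
  assumes "0 < s" "s < 2" "b > 0"
  shows "(\<lambda>y. y powr (s - 1) / (b^2 + y^2)) absolutely_integrable_on {0<..}"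
    and "integral {0<..} (\<lambda>y. y powr (s - 1) / (b^2 + y^2)) = b powr (s - 2) * Gamma (s/2) * Gamma (1 - s/2) / 2"
proof -
  let ?g = "\<lambda>y. y^2 / (b^2 + y^2)" and ?g' = "\<lambda>y. 2 * b^2 * y / (b^2 + y^2)^2"
  let ?f = "\<lambda>t. t powr (s/2 - 1) * (1 - t) powr ((1 - s/2) - 1)"
  have pos: "b^2 + y^2 > 0" for y using assms by (simp add: add_pos_nonneg)
  have im: "?g ` {0<..} = {0<..<1}"
  proof (intro equalityI subsetI)
    fix t assume t: "t \<in> {0<..<1::real}"
    define y where "y = b * sqrt (t / (1 - t))"
    have "y > 0" using t assms by (auto simp: y_def)
    moreover have "y^2 = b^2 * (t / (1 - t))" using t by (simp add: y_def power_mult_distrib)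
    then have "?g y = t" using t assms by (simp add: field_simps)
    ultimately show "t \<in> ?g ` {0<..}" by (intro image_eqI[of _ _ y]) auto
  qed (use assms pos in \<open>auto simp: field_simps add_pos_pos\<close>)
  have hB: "(?f has_integral Beta (s/2) (1 - s/2)) {0..1}"
    using has_integral_Beta_real[of "s/2" "1 - s/2"] assms by simp
  have hB2: "(?f has_integral Beta (s/2) (1 - s/2)) {0<..<1}"
    using hB by (simp add: has_integral_Icc_iff_Ioo)
  have abB: "?f absolutely_integrable_on {0<..<1}"
    by (rule nonnegative_absolutely_integrable_1) (use hB2 in auto)
  have inj: "inj_on ?g {0<..}"
  proof (rule inj_onI)
    fix x y assume xy: "x \<in> {0<..}" "y \<in> {0<..}" "?g x = ?g y"
    then have "x^2 * (b^2 + y^2) = y^2 * (b^2 + x^2)"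
      using pos[of x] pos[of y] by (simp add: divide_simps mult.commute)
    then have "b^2 * (x^2 - y^2) = 0" by (simp add: algebra_simps)
    then have "x^2 = y^2" using assms by simp
    then show "x = y" using xy by (simp add: power2_eq_iff_nonneg)
  qed
  have der: "(?g has_field_derivative ?g' y) (at y within {0<..})" for y
    using pos[of y] by (auto intro!: derivative_eq_intros simp: field_simps power2_eq_square)
  have *: "(\<lambda>y. \<bar>?g' y\<bar> *\<^sub>R ?f (?g y)) absolutely_integrable_on {0<..} \<and>
     integral {0<..} (\<lambda>y. \<bar>?g' y\<bar> *\<^sub>R ?f (?g y)) = Beta (s/2) (1 - s/2)"
    using has_absolute_integral_change_of_variables_1'[of "{0<..}" ?g ?g' ?f "Beta (s/2) (1 - s/2)"]
     der inj im abB integral_unique[OF hB2] by auto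
  have eq: "y powr (s - 1) / (b^2 + y^2) = (b powr (s - 2) / 2) * (\<bar>?g' y\<bar> *\<^sub>R ?f (?g y))" if "y \<in> {0<..}" for y
  proof -
    define W where "W = b^2 + y^2"
    have W: "W > 0" using pos by (simp add: W_def)
    have y: "y > 0" using that by simp
    have "y^2 / W + b^2 / W = (y^2 + b^2) / W" by (simp only: add_divide_distrib)
    also have "y^2 + b^2 = W" by (simp add: W_def)
    also have "W / W = 1" using W by simp
    finally have 1: "1 - y^2 / W = b^2 / W" by linarith
    have p2: "z\<^sup>2 powr r = z powr (2 * r)" if "z > 0" for z r :: real
      using that powr_powr[of z 2 r] by simp
    have 2: "(y^2 / W) powr (s/2 - 1) = y powr (s - 2) * W powr (1 - s/2)"
    proof -
      have "(y^2 / W) powr (s/2 - 1) = (y^2) powr (s/2 - 1) / W powr (s/2 - 1)"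
        using y W by (simp add: powr_divide)
      also have "(y^2) powr (s/2 - 1) = y powr (s - 2)"
        using p2[OF y, of "s/2 - 1"] by (simp add: right_diff_distrib)
      also have "y powr (s - 2) / W powr (s/2 - 1) = y powr (s - 2) * W powr (1 - s/2)"
        using powr_minus_divide[of W "s/2 - 1"] by simp
      finally show ?thesis .
    qed
    have 3: "(b^2 / W) powr (1 - s/2 - 1) = b powr (- s) * W powr (s/2)"
    proof -
      have "(b^2 / W) powr (1 - s/2 - 1) = (b^2) powr (- (s/2)) / W powr (- (s/2))"
        using assms W by (simp add: powr_divide)
      also have "(b^2) powr (- (s/2)) = b powr (- s)"
        using p2[OF assms(3), of "- (s/2)"] by simp
      also have "b powr (- s) / W powr (- (s/2)) = b powr (- s) * W powr (s/2)"
        using powr_minus_divide[of W "s/2"] by simp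
      finally show ?thesis .
    qed
    have "W powr (1 - s/2) * W powr (s/2) = W" using W by (simp flip: powr_add)
    moreover have "b powr (s - 2) * b powr (- s) * b^2 = 1"
    proof -
      have "b^2 = b powr 2" using assms by simp
      then have "b powr (s - 2) * b powr (- s) * b^2 = b powr (s - 2 + (- s) + 2)" by (simp only: powr_add)
      then show ?thesis using assms by simp
    qed
    moreover have "y powr (s - 2) * y = y powr (s - 1)"
      using y by (simp add: powr_diff field_simps power2_eq_square)
    moreover have ab: "\<bar>2 * b^2 * y / W^2\<bar> = 2 * b^2 * y / W^2" using y W by simp
    moreover have "(b powr (s - 2) / 2) * (\<bar>?g' y\<bar> *\<^sub>R ?f (?g y)) =
        (b powr (s - 2) / 2) * ((2 * b^2 * y / W^2) * ((y powr (s - 2) * W powr (1 - s/2)) * (b powr (- s) * W powr (s/2))))"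
      by (simp only: real_scaleR_def W_def[symmetric] ab 1 2 3)
    moreover have "(K / 2) * ((2 * B * v / V) * ((p * q) * (r * t))) = (K * r * B) * (p * v) * (q * t) / V"
      for K B v V p q r t :: real by (simp add: ac_simps)
    ultimately have "(b powr (s - 2) / 2) * (\<bar>?g' y\<bar> *\<^sub>R ?f (?g y)) =
        (b powr (s - 2) * b powr (- s) * b^2) * (y powr (s - 2) * y) * (W powr (1 - s/2) * W powr (s/2)) / W^2"
      by (simp only:)
    also have "\<dots> = y powr (s - 1) / W"
      using \<open>W powr (1 - s/2) * W powr (s/2) = W\<close> \<open>b powr (s - 2) * b powr (- s) * b^2 = 1\<close>
        \<open>y powr (s - 2) * y = y powr (s - 1)\<close> W by (simp add: power2_eq_square)
    finally show ?thesis by (simp add: W_def)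
  qed
  show "(\<lambda>y. y powr (s - 1) / (b^2 + y^2)) absolutely_integrable_on {0<..}"
    by (subst set_integrable_cong[OF refl refl eq], assumption, rule set_integrable_mult_right) (use * in blast)
  have "integral {0<..} (\<lambda>y. y powr (s - 1) / (b^2 + y^2))
      = integral {0<..} (\<lambda>y. (b powr (s - 2) / 2) * (\<bar>?g' y\<bar> *\<^sub>R ?f (?g y)))"
    by (rule Henstock_Kurzweil_Integration.integral_cong) (rule eq)
  also have "\<dots> = (b powr (s - 2) / 2) * Beta (s/2) (1 - s/2)"
    by (subst integral_mult_right) (use * in simp)
  finally show "integral {0<..} (\<lambda>y. y powr (s - 1) / (b^2 + y^2)) = b powr (s - 2) * Gamma (s/2) * Gamma (1 - s/2) / 2"
    by (simp add: Beta_def)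
qed

text \<open>Both sides of Gamma(z) Gamma(1 - z) = pi / sin(pi z) are differentiated. Combined with
  the series of \<open>Digamma\<close>, this gives the partial fractions of the cotangent.\<close>

lemma Digamma_reflection_complex:
  fixes z :: complex
  assumes "z \<notin> \<int>"
  shows "Digamma (1 - z) - Digamma z = of_real pi * cot (of_real pi * z)"
proof -
  have nz: "z \<notin> \<int>\<^sub>\<le>\<^sub>0" "1 - z \<notin> \<int>\<^sub>\<le>\<^sub>0"
    using assms nonpos_Ints_subset_Ints Ints_diff[of 1 "1 - z"] by auto
  have sn: "sin (of_real pi * z) \<noteq> 0"
    using assms by (auto simp: sin_eq_0 mult.commute)
  define F where "F = (\<lambda>z::complex. Gamma z * Gamma (1 - z))"
  have Fs: "F = (\<lambda>z. of_real pi / sin (of_real pi * z))"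
    by (auto simp: F_def Gamma_reflection_complex)
  have "(F has_field_derivative (Gamma z * Digamma z * Gamma (1 - z) - Gamma z * (Gamma (1 - z) * Digamma (1 - z)))) (at z)"
    unfolding F_def using nz by (auto intro!: derivative_eq_intros)
  moreover have "(F has_field_derivative (- (of_real pi * (cos (of_real pi * z) * of_real pi)) / (sin (of_real pi * z))^2)) (at z)"
    unfolding Fs using sn by (auto intro!: derivative_eq_intros simp: power2_eq_square)
  ultimately have "Gamma z * Digamma z * Gamma (1 - z) - Gamma z * (Gamma (1 - z) * Digamma (1 - z))
     = - (of_real pi * (cos (of_real pi * z) * of_real pi)) / (sin (of_real pi * z))^2"
    by (rule DERIV_unique)
  then have "(Gamma z * Gamma (1 - z)) * (Digamma (1 - z) - Digamma z) =
     (of_real pi * (cos (of_real pi * z) * of_real pi)) / (sin (of_real pi * z))^2"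
    by (simp add: algebra_simps)
  then show ?thesis
    unfolding Gamma_reflection_complex using sn
    by (simp add: cot_def divide_simps power2_eq_square)
qed

section \<open>The L-function of the nonprincipal character modulo 4\<close>

text \<open>Half the hyperbolic secant. It stays bounded at 0, unlike 1/(e^y - 1), its counterpart
  for zeta.\<close>

definition psi4 :: "real \<Rightarrow> real" where
  "psi4 y = 1 / (exp y + exp (- y))"

lemma psi4_exp_sums:
  assumes "y > 0"
  shows "(\<lambda>j. exp (- (real (4 * j + 1) * y)) - exp (- (real (4 * j + 3) * y))) sums psi4 y"
proof -
  have "(\<lambda>j. (exp (-4 * y)) ^ j) sums (1 / (1 - exp (-4 * y)))"
    using assms by (intro geometric_sums) simp
  then have "(\<lambda>j. (exp (-y) - exp (-3*y)) * (exp (-4 * y)) ^ j) sums ((exp (-y) - exp (-3*y)) * (1 / (1 - exp (-4 * y))))"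
    by (rule sums_mult)
  moreover have "(exp (-y) - exp (-3*y)) * (exp (-4 * y)) ^ j
      = exp (- (real (4 * j + 1) * y)) - exp (- (real (4 * j + 3) * y))" for j
    by (simp add: left_diff_distrib exp_of_nat_mult[symmetric] algebra_simps flip: exp_add)
  moreover have "(exp (-y) - exp (-3*y)) * (1 / (1 - exp (-4 * y))) = psi4 y"
  proof -
    define u where "u = exp (-y)"
    have u: "0 < u" "u < 1" using assms by (auto simp: u_def)
    have "exp (-3*y) = u^3" "exp (-4*y) = u^4" "exp y = 1 / u"
      using exp_of_nat_mult[of 3 "-y"] exp_of_nat_mult[of 4 "-y"]
      by (simp_all add: u_def exp_minus inverse_eq_divide)
    moreover have "1 - u^4 > 0" using u by (simp add: power_less_one_iff)
    moreover have "u * (1 - u^4) = (u - u^3) * (1 + u^2)"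
      by (simp add: algebra_simps power2_eq_square power3_eq_cube power4_eq_xxxx)
    moreover have "1 / u + u = (1 + u^2) / u" using u by (simp add: field_simps power2_eq_square)
    moreover have "1 + u^2 > 0" by (simp add: add_pos_nonneg)
    moreover have "psi4 y = 1 / (1 / u + u)" using \<open>exp y = 1 / u\<close> by (simp add: psi4_def u_def)
    ultimately show ?thesis using u by (simp add: u_def[symmetric] frac_eq_eq)
  qed
  ultimately show ?thesis by simp
qed

text \<open>The Mittag-Leffler expansion of the hyperbolic secant. The cotangent expansions at the
  conjugate points \<open>z\<close> and \<open>w\<close> are added: the conjugate terms pair up to
  real rational functions of y, and the two cotangents combine to a multiple of
  \<open>psi4 y\<close>.\<close>

lemma psi4_partial_fractions:
  assumes "y > 0"
  shows "(\<lambda>j. real (4*j+1) / ((pi/2 * real (4*j+1))^2 + y^2) - real (4*j+3) / ((pi/2 * real (4*j+3))^2 + y^2))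
           sums (2 / pi * psi4 y)"
proof -
  define x where "x = 2 * y / pi"
  have x: "x > 0" using assms by (simp add: x_def)
  define z where "z = (1 - \<i> * of_real x) / 4"
  define w where "w = (1 + \<i> * of_real x) / 4"
  have Im: "Im z \<noteq> 0" "Im w \<noteq> 0" "Im (1 - z) \<noteq> 0" "Im (1 - w) \<noteq> 0" using x by (auto simp: z_def w_def)
  then have nI: "z \<notin> \<int>" "w \<notin> \<int>" and n0: "z \<noteq> 0" "w \<noteq> 0" "1 - z \<noteq> 0" "1 - w \<noteq> 0"
    by (auto simp: complex_is_Int_iff)
  have D: "(\<lambda>k. inverse (v + of_nat k) - inverse (1 - v + of_nat k)) sums (Digamma (1 - v) - Digamma v)"
    if "v \<noteq> 0" "1 - v \<noteq> 0" for v :: complex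
    using sums_diff[OF summable_sums[OF summable_Digamma[OF that(2)]] summable_sums[OF summable_Digamma[OF that(1)]]]
    by (simp add: Digamma_def)
  have S: "(\<lambda>k. (inverse (z + of_nat k) - inverse (1 - z + of_nat k)) + (inverse (w + of_nat k) - inverse (1 - w + of_nat k)))
     sums (of_real pi * cot (of_real pi * z) + of_real pi * cot (of_real pi * w))"
    using sums_add[OF D[of z] D[of w]] n0 Digamma_reflection_complex[OF nI(1)] Digamma_reflection_complex[OF nI(2)]
    by simp
  have pair: "inverse (p - \<i> * of_real x) + inverse (p + \<i> * of_real x) = of_real (2 * p' / (p'^2 + x^2))"
    if "p = of_real p'" "p' > 0" for p :: complex and p' :: real
  proof -
    have "p - \<i> * of_real x \<noteq> 0" "p + \<i> * of_real x \<noteq> 0" using that x by (auto simp: complex_eq_iff)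
    moreover have "(p - \<i> * of_real x) * (p + \<i> * of_real x) = of_real (p'^2 + x^2)"
      by (simp add: that algebra_simps power2_eq_square)
    moreover have inv: "inverse a + inverse b = (a + b) / (a * b)" if "a \<noteq> 0" "b \<noteq> 0" for a b :: complex
      using that by (simp add: field_simps)
    ultimately have "inverse (p - \<i> * of_real x) + inverse (p + \<i> * of_real x) = (2 * p) / of_real (p'^2 + x^2)"
      by (subst inv) auto
    then show ?thesis by (simp add: that)
  qed
  have trm: "(inverse (z + of_nat k) - inverse (1 - z + of_nat k)) + (inverse (w + of_nat k) - inverse (1 - w + of_nat k))
     = of_real (8 * (real (4*k+1) / (real (4*k+1)^2 + x^2) - real (4*k+3) / (real (4*k+3)^2 + x^2)))" for k
  proof -
    have "z + of_nat k = (of_real (real (4*k+1)) - \<i> * of_real x) / 4" "w + of_nat k = (of_real (real (4*k+1)) + \<i> * of_real x) / 4"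
       "1 - z + of_nat k = (of_real (real (4*k+3)) + \<i> * of_real x) / 4" "1 - w + of_nat k = (of_real (real (4*k+3)) - \<i> * of_real x) / 4"
      by (simp_all add: z_def w_def field_simps)
    note e4 = this
    have i4: "inverse (q / 4) = 4 * inverse q" for q :: complex by (simp add: inverse_eq_divide)
    have gen: "(4 * a - 4 * b) + (4 * c - 4 * d) = 4 * (a + c) - 4 * (d + b)" for a b c d :: complex by simp
    have "(inverse (z + of_nat k) - inverse (1 - z + of_nat k)) + (inverse (w + of_nat k) - inverse (1 - w + of_nat k))
      = 4 * (inverse (of_real (real (4*k+1)) - \<i> * of_real x) + inverse (of_real (real (4*k+1)) + \<i> * of_real x))
       - 4 * (inverse (of_real (real (4*k+3)) - \<i> * of_real x) + inverse (of_real (real (4*k+3)) + \<i> * of_real x))"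
      unfolding e4 i4 by (rule gen)
    also have "\<dots> = 4 * of_real (2 * real (4*k+1) / (real (4*k+1)^2 + x^2)) - 4 * of_real (2 * real (4*k+3) / (real (4*k+3)^2 + x^2))"
      by (subst (1 2) pair[OF refl]) auto
    finally show ?thesis by (simp add: algebra_simps)
  qed
  \<comment> \<open>The angles pi z and pi w are pi/4 - iy/2 and pi/4 + iy/2. Their sum is pi/2, so
    the sum of their cotangents is the reciprocal of the product of their sines, and this product is
    cos(iy)/2 = cosh(y)/2.\<close>
  define u where "u = of_real (y / 2) * \<i>"
  have zu: "of_real pi * z = of_real pi / 4 - u" "of_real pi * w = of_real pi / 4 + u"
    by (simp_all add: z_def w_def u_def x_def field_simps)
  have "sin (of_real pi / 4 - u) * sin (of_real pi / 4 + u) = cos (2 * u) / 2"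
  proof -
    have "cos ((of_real pi / 4 - u) - (of_real pi / 4 + u)) - cos ((of_real pi / 4 - u) + (of_real pi / 4 + u))
       = 2 * (sin (of_real pi / 4 - u) * sin (of_real pi / 4 + u))"
      by (simp only: cos_diff cos_add) (simp add: algebra_simps)
    moreover have "(of_real pi / 4 - u) - (of_real pi / 4 + u) = - (2 * u)"
       "(of_real pi / 4 - u) + (of_real pi / 4 + u) = of_real pi / (2::complex)" by (simp_all add: field_simps)
    moreover have "cos (of_real pi / (2::complex)) = 0"
      by (metis cos_of_real cos_pi_half of_real_0 of_real_divide of_real_numeral)
    ultimately show ?thesis by simp
  qed
  moreover have "cos (2 * u) = of_real ((exp y + exp (-y)) / 2)"
  proof -
    have "2 * u = \<i> * of_real y" by (simp add: u_def)
    then show ?thesis by (simp add: cos_exp_eq exp_of_real flip: mult.assoc) (simp add: exp_of_real add.commute flip: of_real_minus)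
  qed
  ultimately have P: "sin (of_real pi / 4 - u) * sin (of_real pi / 4 + u) = of_real (1 / (4 * psi4 y))"
    by (simp add: psi4_def)
  have "psi4 y > 0" by (simp add: psi4_def add_pos_pos)
  then have sn: "sin (of_real pi / 4 - u) \<noteq> 0" "sin (of_real pi / 4 + u) \<noteq> 0" using P by auto
  have "cot (of_real pi / 4 - u) + cot (of_real pi / 4 + u) = sin ((of_real pi / 4 - u) + (of_real pi / 4 + u)) / (sin (of_real pi / 4 - u) * sin (of_real pi / 4 + u))"
    unfolding sin_add[of "of_real pi / 4 - u"] using sn by (simp add: cot_def field_simps)
  also have "(of_real pi / 4 - u) + (of_real pi / 4 + u) = of_real (pi / 2)" by (simp add: field_simps)
  also have "sin (complex_of_real (pi/2)) = 1" by (metis of_real_1 sin_of_real sin_pi_half)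
  finally have C: "cot (of_real pi / 4 - u) + cot (of_real pi / 4 + u) = of_real (4 * psi4 y)"
    unfolding P by simp
  have "(\<lambda>k. complex_of_real (8 * (real (4*k+1) / (real (4*k+1)^2 + x^2) - real (4*k+3) / (real (4*k+3)^2 + x^2)))) sums of_real (pi * (4 * psi4 y))"
    using S unfolding trm zu distrib_left[symmetric] C by simp
  then have R: "(\<lambda>k. 8 * (real (4*k+1) / (real (4*k+1)^2 + x^2) - real (4*k+3) / (real (4*k+3)^2 + x^2))) sums (pi * (4 * psi4 y))"
    by (simp only: sums_of_real_iff)
  have sc: "n / ((pi/2 * n)^2 + y^2) = (1 / (2 * pi^2)) * (8 * (n / (n^2 + x^2)))" for n :: real
  proof -
    have "(pi/2 * n)^2 + y^2 = pi^2 / 4 * (n^2 + x^2)"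
      by (simp add: x_def power_mult_distrib power_divide field_simps)
    then show ?thesis by (simp add: field_simps)
  qed
  have "(\<lambda>k. (1 / (2 * pi^2)) * (8 * (real (4*k+1) / (real (4*k+1)^2 + x^2) - real (4*k+3) / (real (4*k+3)^2 + x^2)))) sums ((1 / (2 * pi^2)) * (pi * (4 * psi4 y)))"
    by (rule sums_mult[OF R])
  moreover have "(1 / (2 * pi^2)) * (pi * (4 * psi4 y)) = 2 / pi * psi4 y" by (simp add: power2_eq_square)
  moreover have "(\<lambda>k. (1 / (2 * pi^2)) * (8 * (real (4*k+1) / (real (4*k+1)^2 + x^2) - real (4*k+3) / (real (4*k+3)^2 + x^2))))
     = (\<lambda>j. real (4*j+1) / ((pi/2 * real (4*j+1))^2 + y^2) - real (4*j+3) / ((pi/2 * real (4*j+3))^2 + y^2))"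
    unfolding sc by (simp add: right_diff_distrib)
  ultimately show ?thesis by simp
qed

text \<open>Pairing consecutive terms makes the series converge absolutely for $\Re s > 0$.\<close>

definition L4_term :: "nat \<Rightarrow> complex \<Rightarrow> complex" where
  "L4_term j s = of_real (real (4*j+1)) powr (- s) - of_real (real (4*j+3)) powr (- s)"

definition L4 :: "complex \<Rightarrow> complex" where
  "L4 s = (\<Sum>j. L4_term j s)"

text \<open>The mean value inequality on the segment from 4j+1 to 4j+3: the derivative of z^(-s)
  gains a factor 1/z. Replacing 4j+1 by the smaller \<open>Suc j\<close> leaves a shifted
  p-series.\<close>

lemma norm_L4_term_le:
  assumes "Re s > 0"
  shows "norm (L4_term j s) \<le> 2 * norm s * real (Suc j) powr (- (Re s + 1))"
proof -
  define S where "S = closed_segment (complex_of_real (real (4*j+1))) (of_real (real (4*j+3)))"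
  have S: "\<exists>t. z = of_real t \<and> real (4*j+1) \<le> t" if "z \<in> S" for z
  proof -
    have "z \<in> of_real ` closed_segment (real (4*j+1)) (real (4*j+3))"
      using that unfolding S_def by (simp only: closed_segment_of_real)
    then show ?thesis by (auto simp: closed_segment_eq_real_ivl)
  qed
  have "norm (of_real (real (4*j+1)) powr (- s) - of_real (real (4*j+3)) powr (- s))
     \<le> (norm s * real (Suc j) powr (- (Re s + 1))) * norm (complex_of_real (real (4*j+1)) - of_real (real (4*j+3)))"
  proof (rule field_differentiable_bound[of S "\<lambda>z. z powr (-s)" "\<lambda>z. - s * z powr (- s - 1)"])
    show "convex S" by (simp add: S_def)
    fix z assume "z \<in> S"
    then obtain t where t: "z = of_real t" "real (4*j+1) \<le> t" using S by blast
    have "0 < real (4*j+1)" by simp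
    with t(2) have t0: "t > 0" by linarith
    show "((\<lambda>z. z powr (-s)) has_field_derivative - s * z powr (- s - 1)) (at z within S)"
      unfolding t(1) by (rule has_field_derivative_at_within, rule has_field_derivative_powr)
        (use t0 in \<open>simp add: nonpos_Reals_of_real_iff\<close>)
    have "norm (z powr (- s - 1)) = t powr (- (Re s + 1))"
      using t t0 by (simp add: norm_powr_real_powr)
    also have "\<dots> \<le> real (Suc j) powr (- (Re s + 1))"
      using t assms by (intro powr_mono2') auto
    finally show "norm (- s * z powr (- s - 1)) \<le> norm s * real (Suc j) powr (- (Re s + 1))"
      by (simp add: norm_mult mult_left_mono)
  qed (auto simp: S_def)
  also have "norm (complex_of_real (real (4*j+1)) - of_real (real (4*j+3))) = 2"
    by (simp only: of_real_diff[symmetric] norm_of_real)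
  finally show ?thesis unfolding L4_term_def by (simp only: mult.commute mult.left_commute)
qed

lemma summable_Suc_powr:
  assumes "\<sigma> > (0::real)"
  shows "summable (\<lambda>j. real (Suc j) powr (- (\<sigma> + 1)))"
proof -
  have "summable (\<lambda>j. real j powr (- (\<sigma> + 1)))"
    using assms by (subst summable_real_powr_iff) simp
  then show ?thesis by (subst summable_Suc_iff)
qed

lemma summable_norm_L4_term:
  assumes "Re s > 0"
  shows "summable (\<lambda>j. norm (L4_term j s))"
proof (rule summable_comparison_test')
  show "summable (\<lambda>j. 2 * norm s * real (Suc j) powr (- (Re s + 1)))"
    by (intro summable_mult summable_Suc_powr assms)
  show "norm (norm (L4_term j s)) \<le> 2 * norm s * real (Suc j) powr (- (Re s + 1))" for j
    using norm_L4_term_le[OF assms] by simp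
qed

lemma L4_sums: "Re s > 0 \<Longrightarrow> (\<lambda>j. L4_term j s) sums L4 s"
  unfolding L4_def by (rule summable_sums[OF summable_norm_cancel[OF summable_norm_L4_term]])

text \<open>Linear growth in a closed half-plane is all that the order estimate of the completed
  function asks of \<open>L4\<close>.\<close>

lemma norm_L4_le:
  assumes "\<delta> > 0"
  shows "\<exists>C>0. \<forall>s. Re s \<ge> \<delta> \<longrightarrow> norm (L4 s) \<le> C * norm s"
proof (intro exI conjI allI impI)
  let ?C = "2 * (\<Sum>j. real (Suc j) powr (- (\<delta> + 1)))"
  show "?C > 0"
    using suminf_pos[OF summable_Suc_powr[OF assms]] by simp
  fix s assume s: "Re s \<ge> \<delta>"
  then have s0: "Re s > 0" using assms by simp
  have "norm (L4 s) \<le> (\<Sum>j. norm (L4_term j s))"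
    unfolding L4_def by (rule summable_norm[OF summable_norm_L4_term[OF s0]])
  also have "\<dots> \<le> (\<Sum>j. 2 * norm s * real (Suc j) powr (- (\<delta> + 1)))"
  proof (rule suminf_le)
    fix j
    have "real (Suc j) powr (- (Re s + 1)) \<le> real (Suc j) powr (- (\<delta> + 1))"
      using s by (intro powr_mono) auto
    then show "norm (L4_term j s) \<le> 2 * norm s * real (Suc j) powr (- (\<delta> + 1))"
      using norm_L4_term_le[OF s0, of j] by (meson mult_left_mono norm_ge_zero order_trans mult_nonneg_nonneg zero_le_numeral)
  qed (intro summable_norm_L4_term[OF s0] summable_mult summable_Suc_powr assms)+
  also have "\<dots> = ?C * norm s"
    using suminf_mult[OF summable_Suc_powr[OF assms], of "2 * norm s"] by simp
  finally show "norm (L4 s) \<le> ?C * norm s" .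
qed

lemma holomorphic_L4: "L4 holomorphic_on {s. Re s > 0}"
proof (rule holomorphic_uniform_sequence[where f = "\<lambda>n s. \<Sum>j<n. L4_term j s"])
  show "open {s. Re s > 0}" by (rule open_halfspace_Re_gt)
  show "(\<lambda>s. \<Sum>j<n. L4_term j s) holomorphic_on {s. Re s > 0}" for n
    unfolding L4_term_def by (intro holomorphic_intros)
  fix x assume x: "x \<in> {s. Re s > 0}"
  define d where "d = Re x / 2"
  have d: "d > 0" using x by (simp add: d_def)
  have B: "Re s \<ge> d \<and> norm s \<le> norm x + d" if "s \<in> cball x d" for s
  proof -
    have "norm (x - s) \<le> d" using that by (simp add: dist_norm)
    then have "Re (x - s) \<le> d" and "norm s \<le> norm x + d"
      using complex_Re_le_cmod[of "x - s"] norm_triangle_ineq4[of x "x - s"] by auto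
    then show ?thesis by (auto simp: d_def)
  qed
  have "uniform_limit (cball x d) (\<lambda>n s. \<Sum>j<n. L4_term j s) (\<lambda>s. \<Sum>j. L4_term j s) sequentially"
  proof (rule Weierstrass_m_test)
    show "summable (\<lambda>j. 2 * (norm x + d) * real (Suc j) powr (- (d + 1)))"
      by (intro summable_mult summable_Suc_powr d)
    fix j s assume s: "s \<in> cball x d"
    have "norm (L4_term j s) \<le> 2 * norm s * real (Suc j) powr (- (Re s + 1))"
      using B[OF s] d by (intro norm_L4_term_le) auto
    also have "\<dots> \<le> 2 * (norm x + d) * real (Suc j) powr (- (d + 1))"
      using B[OF s] d by (intro mult_mono powr_mono) auto
    finally show "norm (L4_term j s) \<le> 2 * (norm x + d) * real (Suc j) powr (- (d + 1))" .
  qed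
  then have "uniform_limit (cball x d) (\<lambda>n s. \<Sum>j<n. L4_term j s) L4 sequentially"
    by (simp add: L4_def[abs_def])
  moreover have "cball x d \<subseteq> {s. Re s > 0}" using B d by force
  ultimately show "\<exists>d>0. cball x d \<subseteq> {s. Re s > 0} \<and>
      uniform_limit (cball x d) (\<lambda>n s. \<Sum>j<n. L4_term j s) L4 sequentially" using d by blast
qed

lemma L4_real:
  assumes "s > 0"
  shows "L4 (of_real s) = of_real (\<Sum>j. real (4*j+1) powr (- s) - real (4*j+3) powr (- s))"
    and "(\<lambda>j. real (4*j+1) powr (- s) - real (4*j+3) powr (- s)) sums (\<Sum>j. real (4*j+1) powr (- s) - real (4*j+3) powr (- s))"
proof -
  have t: "L4_term j (of_real s) = of_real (real (4*j+1) powr (- s) - real (4*j+3) powr (- s))" for j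
    unfolding L4_term_def of_real_minus[symmetric] by (subst (1 2) powr_of_real) auto
  have "summable (\<lambda>j. norm (L4_term j (of_real s)))"
    using assms by (intro summable_norm_L4_term) simp
  then have sm: "summable (\<lambda>j. real (4*j+1) powr (- s) - real (4*j+3) powr (- s))"
    unfolding t norm_of_real by (rule summable_rabs_cancel)
  then show "(\<lambda>j. real (4*j+1) powr (- s) - real (4*j+3) powr (- s)) sums (\<Sum>j. real (4*j+1) powr (- s) - real (4*j+3) powr (- s))"
    by (rule summable_sums)
  show "L4 (of_real s) = of_real (\<Sum>j. real (4*j+1) powr (- s) - real (4*j+3) powr (- s))"
    unfolding L4_def t by (rule suminf_of_real[OF sm, symmetric])
qed

section \<open>The Mellin transform of psi and the functional equation\<close>

text \<open>Each pair of exponentials has a nonnegative difference, so the integral of the norm of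
  the j-th term is exactly Gamma(Re s) times the j-th term of \<open>L4\<close> at the real point Re
  s. Absolute convergence is therefore inherited from the series at that point, throughout Re s >
  0.\<close>

lemma Mellin_psi4:
  assumes s: "Re s > 0"
  shows "(\<lambda>y. of_real y powr (s - 1) * of_real (psi4 y)) absolutely_integrable_on {0<..}"
    and "integral {0<..} (\<lambda>y. of_real y powr (s - 1) * of_real (psi4 y)) = Gamma s * L4 s"
proof -
  define f where "f = (\<lambda>j y. complex_of_real y powr (s - 1) * of_real (exp (- (real (4*j+1) * y)) - exp (- (real (4*j+3) * y))))"
  have feq: "f j = (\<lambda>y. of_real y powr (s - 1) * of_real (exp (- (real (4*j+1) * y))) - of_real y powr (s - 1) * of_real (exp (- (real (4*j+3) * y))))" for j
    by (rule ext) (simp only: f_def of_real_diff right_diff_distrib)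
  note G = Gamma_integral_scaled[OF s]
  have p13: "real (4*j+1) > 0" "real (4*j+3) > 0" for j by simp_all
  have ai: "f j absolutely_integrable_on {0<..}" for j
    unfolding feq by (intro set_integral_diff G) auto
  have fi: "integral {0<..} (f j) = Gamma s * L4_term j s" for j
    unfolding feq L4_term_def right_diff_distrib
    by (subst Henstock_Kurzweil_Integration.integral_diff)
       (simp_all only: set_lebesgue_integral_eq_integral(1)[OF G(1)] G(2) p13)
  let ?t = "complex_of_real (Re s)"
  have st: "Re ?t > 0" using s by simp
  note H = Gamma_integral_scaled[OF st]
  have nrm: "complex_of_real (norm (f j y)) = of_real y powr (?t - 1) * of_real (exp (- (real (4*j+1) * y))) - of_real y powr (?t - 1) * of_real (exp (- (real (4*j+3) * y)))"
    if "y \<in> {0<..}" for j y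
  proof -
    have "exp (- (real (4*j+3) * y)) \<le> exp (- (real (4*j+1) * y))"
      using that by (auto intro!: mult_right_mono)
    moreover have "norm (complex_of_real y powr (s - 1)) = y powr (Re s - 1)"
      using that by (simp add: norm_powr_real_powr)
    ultimately have N: "norm (f j y) = y powr (Re s - 1) * (exp (- (real (4*j+1) * y)) - exp (- (real (4*j+3) * y)))"
      unfolding f_def norm_mult norm_of_real by simp
    have "of_real y powr (of_real (Re s - 1)) = complex_of_real (y powr (Re s - 1))"
      by (rule powr_of_real) (use that in auto)
    then have pw: "of_real y powr (?t - 1) = complex_of_real (y powr (Re s - 1))" by simp
    show ?thesis
      by (simp only: N pw of_real_mult of_real_diff right_diff_distrib)
  qed
  have nint: "(\<lambda>y. norm (f j y)) integrable_on {0<..}" for j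
    using absolutely_integrable_norm[OF ai[of j]] by (auto simp: o_def intro: set_lebesgue_integral_eq_integral(1))
  have ni: "complex_of_real (integral {0<..} (\<lambda>y. norm (f j y))) = Gamma ?t * L4_term j ?t" for j
  proof -
    have "complex_of_real (integral {0<..} (\<lambda>y. norm (f j y))) = integral {0<..} (\<lambda>y. complex_of_real (norm (f j y)))"
      using integral_linear[OF nint[of j] bounded_linear_of_real[where 'a = complex]] by (simp add: o_def)
    also have "\<dots> = integral {0<..} (\<lambda>y. of_real y powr (?t - 1) * of_real (exp (- (real (4*j+1) * y))) - of_real y powr (?t - 1) * of_real (exp (- (real (4*j+3) * y))))"
      by (rule Henstock_Kurzweil_Integration.integral_cong) (rule nrm)
    also have "\<dots> = Gamma ?t * L4_term j ?t"
      unfolding L4_term_def right_diff_distrib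
      by (subst Henstock_Kurzweil_Integration.integral_diff)
       (simp_all only: set_lebesgue_integral_eq_integral(1)[OF H(1)] H(2) p13)
    finally show ?thesis .
  qed
  have "summable (\<lambda>j. Gamma ?t * L4_term j ?t)"
    using sums_summable[OF L4_sums[OF st]] by (rule summable_mult)
  then have ns: "summable (\<lambda>j. integral {0<..} (\<lambda>y. norm (f j y)))"
    unfolding ni[symmetric] by (simp only: summable_complex_of_real)
  have sm: "summable (\<lambda>j. norm (f j y))" and su: "(\<lambda>j. f j y) sums (of_real y powr (s - 1) * of_real (psi4 y))" if "y \<in> {0<..}" for y
  proof -
    have S: "(\<lambda>j. exp (- (real (4 * j + 1) * y)) - exp (- (real (4 * j + 3) * y))) sums psi4 y"
      using that psi4_exp_sums by simp
    show "(\<lambda>j. f j y) sums (of_real y powr (s - 1) * of_real (psi4 y))"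
      unfolding f_def by (intro sums_mult) (use S in \<open>simp only: sums_of_real_iff\<close>)
    have "exp (- (real (4*j+3) * y)) \<le> exp (- (real (4*j+1) * y))" for j
      using that by (auto intro!: mult_right_mono)
    then have "norm (f j y) = norm (complex_of_real y powr (s - 1)) * (exp (- (real (4 * j + 1) * y)) - exp (- (real (4 * j + 3) * y)))" for j
      unfolding f_def norm_mult norm_of_real by simp
    then show "summable (\<lambda>j. norm (f j y))"
      using sums_summable[OF sums_mult[OF S]] by simp
  qed
  note R = sums_set_lebesgue_integral[where f = f and S = "{0<..}", OF ai sm ns su]
  show "(\<lambda>y. of_real y powr (s - 1) * of_real (psi4 y)) absolutely_integrable_on {0<..}"
    by (rule R(1))
  have "(\<lambda>j. Gamma s * L4_term j s) sums integral {0<..} (\<lambda>y. of_real y powr (s - 1) * of_real (psi4 y))"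
    using R(2) by (simp only: fi)
  then show "integral {0<..} (\<lambda>y. of_real y powr (s - 1) * of_real (psi4 y)) = Gamma s * L4 s"
    using sums_mult[OF L4_sums[OF s], of "Gamma s"] sums_unique2 by blast
qed

definition l4 :: "real \<Rightarrow> real" where
  "l4 s = (\<Sum>j. real (4*j+1) powr (- s) - real (4*j+3) powr (- s))"

lemma L4_of_real: "s > 0 \<Longrightarrow> L4 (of_real s) = of_real (l4 s)"
  using L4_real(1) by (simp add: l4_def)

lemma l4_sums: "s > 0 \<Longrightarrow> (\<lambda>j. real (4*j+1) powr (- s) - real (4*j+3) powr (- s)) sums l4 s"
  using L4_real(2) by (simp add: l4_def)

text \<open>The Mellin transform of \<open>psi4\<close> is computed twice. The exponential series
  gives Gamma(s) L(s), while the partial fractions give a multiple of L(1 - s) by the Beta integral.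
  The partial fractions do the work usually done by Poisson summation.\<close>

lemma l4_functional_equation:
  assumes s: "0 < s" "s < 1"
  shows "Gamma s * l4 s = (pi/2) powr (s - 1) / 2 * (Gamma (s/2) * Gamma (1 - s/2)) * l4 (1 - s)"
proof -
  define a where "a = pi / 2"
  have a: "a > 0" by (simp add: a_def)
  define G where "G = Gamma (s/2) * Gamma (1 - s/2)"
  define u where "u = (\<lambda>n y. y powr (s - 1) / ((a * n)^2 + y^2))"
  have G0: "G > 0" unfolding G_def using s by (intro mult_pos_pos Gamma_real_pos) auto
  have ui: "u n absolutely_integrable_on {0<..}" and uI: "integral {0<..} (u n) = (a * n) powr (s - 2) * G / 2" if "n > 0" for n
    using Beta_integral_rational[of s "a * n"] that a s by (auto simp: u_def G_def)
  define f where "f = (\<lambda>j y. real (4*j+1) * u (real (4*j+1)) y - real (4*j+3) * u (real (4*j+3)) y)"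
  have p13: "real (4*j+1) > 0" "real (4*j+3) > 0" for j by simp_all
  have fi: "f j absolutely_integrable_on {0<..}" for j
    unfolding f_def by (intro set_integral_diff set_integrable_mult_right ui p13)
  have nsq: "n * ((a * n) powr (s - 2) * G / 2) = a powr (s - 2) * G / 2 * n powr (- (1 - s))" if "n > 0" for n
  proof -
    have "n * n powr (s - 2) = n powr (- (1 - s))"
      using that by (simp add: powr_mult_base)
    then show ?thesis using that a by (simp add: powr_mult)
  qed
  have fI: "integral {0<..} (f j) = a powr (s - 2) * G / 2 * (real (4*j+1) powr (- (1 - s)) - real (4*j+3) powr (- (1 - s)))" for j
  proof -
    have "integral {0<..} (f j) = real (4*j+1) * integral {0<..} (u (real (4*j+1))) - real (4*j+3) * integral {0<..} (u (real (4*j+3)))"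
      unfolding f_def
      by (subst Henstock_Kurzweil_Integration.integral_diff)
         (auto simp only: integral_mult_right intro!: integrable_on_mult_right set_lebesgue_integral_eq_integral(1) ui p13)
    also have "\<dots> = a powr (s - 2) * G / 2 * real (4*j+1) powr (- (1 - s)) - a powr (s - 2) * G / 2 * real (4*j+3) powr (- (1 - s))"
      by (simp only: uI p13 nsq)
    finally show ?thesis by (simp only: right_diff_distrib)
  qed
  \<comment> \<open>Pairing is essential here: n * u(n) alone has an integral of order n^(s-1),
    which is not summable. In the difference the numerator is at most \<open>D2\<close>, which
    leaves 2 * u(n), with an integral of order n^(s-2) and s < 1.\<close>
  have nb: "norm (f j y) \<le> 2 * u (real (4*j+1)) y" if "y \<in> {0<..}" for j y
  proof -
    define n where "n = real (4*j+1)"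
    have n: "n > 0" "real (4*j+3) = n + 2" by (simp_all add: n_def)
    define D where "D = (a * n)^2 + y^2"
    define D2 where "D2 = (a * (n + 2))^2 + y^2"
    have D: "D > 0" "D2 > 0" using that n a by (simp_all add: D_def D2_def add_pos_pos)
    have "n / D - (n + 2) / D2 = 2 * (a^2 * n * (n + 2) - y^2) / (D * D2)"
      using D by (simp add: field_simps) (simp add: D_def D2_def power2_eq_square algebra_simps)
    moreover have "\<bar>a^2 * n * (n + 2) - y^2\<bar> \<le> D2"
    proof -
      have "a^2 * n * (n + 2) \<le> (a * (n + 2))^2"
      proof -
        have "n * (n + 2) \<le> (n + 2) * (n + 2)" using n(1) by (intro mult_right_mono) auto
        then have "a^2 * (n * (n + 2)) \<le> a^2 * ((n + 2) * (n + 2))" by (rule mult_left_mono) simp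
        then show ?thesis by (simp add: power2_eq_square mult_ac)
      qed
      moreover have "0 \<le> a^2 * n * (n + 2)" using n by simp
      ultimately show ?thesis unfolding D2_def by (smt (verit) zero_le_power2)
    qed
    moreover have "\<bar>2 * x / (D * D2)\<bar> \<le> 2 * D2 / (D * D2)" if "\<bar>x\<bar> \<le> D2" for x
    proof -
      have "\<bar>2 * x / (D * D2)\<bar> = 2 * \<bar>x\<bar> / (D * D2)" using D by (simp add: abs_mult)
      also have "\<dots> \<le> 2 * D2 / (D * D2)" using D that by (intro divide_right_mono) auto
      finally show ?thesis .
    qed
    ultimately have "\<bar>n / D - (n + 2) / D2\<bar> \<le> 2 * D2 / (D * D2)"
      by (simp only:)
    then have B: "\<bar>n / D - (n + 2) / D2\<bar> \<le> 2 / D" using D by simp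
    have "f j y = y powr (s - 1) * (n / D - (n + 2) / D2)"
      unfolding f_def u_def n(2) n_def[symmetric] D_def D2_def by (simp add: algebra_simps)
    then have "norm (f j y) = y powr (s - 1) * \<bar>n / D - (n + 2) / D2\<bar>"
      by (simp add: abs_mult)
    also have "\<dots> \<le> y powr (s - 1) * (2 / D)"
      using B by (intro mult_left_mono) auto
    finally show ?thesis by (simp add: u_def D_def n_def mult.commute)
  qed
  have sm: "summable (\<lambda>j. norm (f j y))" and su: "(\<lambda>j. f j y) sums (2 / pi * (y powr (s - 1) * psi4 y))" if "y \<in> {0<..}" for y
  proof -
    have "(\<lambda>j. y powr (s - 1) * (real (4*j+1) / ((a * real (4*j+1))^2 + y^2) - real (4*j+3) / ((a * real (4*j+3))^2 + y^2)))
           sums (y powr (s - 1) * (2 / pi * psi4 y))"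
      unfolding a_def by (rule sums_mult[OF psi4_partial_fractions]) (use that in simp)
    moreover have "f j y = y powr (s - 1) * (real (4*j+1) / ((a * real (4*j+1))^2 + y^2) - real (4*j+3) / ((a * real (4*j+3))^2 + y^2))" for j
      unfolding f_def u_def right_diff_distrib by (simp only: times_divide_eq_right mult.commute)
    ultimately show "(\<lambda>j. f j y) sums (2 / pi * (y powr (s - 1) * psi4 y))"
      by (simp add: mult_ac)
    show "summable (\<lambda>j. norm (f j y))"
    proof (rule summable_comparison_test')
      show "summable (\<lambda>j. 2 * y powr (s - 1) * real (Suc j) powr (- (1 + 1)))"
        by (intro summable_mult summable_Suc_powr) simp
      fix j
      have "u (real (4*j+1)) y \<le> y powr (s - 1) / (real (Suc j))^2"
        unfolding u_def
      proof (rule divide_left_mono)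
        have "1 \<le> a" using pi_ge_two by (simp add: a_def)
        then have "real (Suc j) \<le> a * real (4*j+1)"
          using mult_mono[of 1 a "real (Suc j)" "real (4*j+1)"] by simp
        then have "(real (Suc j))^2 \<le> (a * real (4*j+1))^2" by (intro power_mono) auto
        then show "(real (Suc j))^2 \<le> (a * real (4*j+1))^2 + y^2" by (simp add: add_increasing2)
        show "0 < ((a * real (4*j+1))^2 + y^2) * (real (Suc j))^2"
          using that a by (intro mult_pos_pos add_pos_pos) auto
      qed simp
      then have "norm (f j y) \<le> 2 * (y powr (s - 1) / (real (Suc j))^2)"
        using nb[OF that, of j] by linarith
      moreover have "real (Suc j) powr (- (1 + 1)) = 1 / (real (Suc j))^2"
        by (simp add: powr_minus_divide)
      ultimately show "norm (norm (f j y)) \<le> 2 * y powr (s - 1) * real (Suc j) powr (- (1 + 1))"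
        by simp
    qed
  qed
  have nint: "(\<lambda>y. norm (f j y)) integrable_on {0<..}" for j
    using absolutely_integrable_norm[OF fi[of j]] by (auto simp: o_def intro: set_lebesgue_integral_eq_integral(1))
  have ns: "summable (\<lambda>j. integral {0<..} (\<lambda>y. norm (f j y)))"
  proof (rule summable_comparison_test')
    show "summable (\<lambda>j. a powr (s - 2) * \<bar>G\<bar> * real (Suc j) powr (- ((1 - s) + 1)))"
      by (intro summable_mult summable_Suc_powr) (use s in simp)
    fix j
    have "integral {0<..} (\<lambda>y. norm (f j y)) \<le> integral {0<..} (\<lambda>y. 2 * u (real (4*j+1)) y)"
      by (intro integral_le nint integrable_on_mult_right set_lebesgue_integral_eq_integral(1) ui p13 nb)
    also have "\<dots> = 2 * ((a * real (4*j+1)) powr (s - 2) * G / 2)"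
      by (simp only: integral_mult_right uI p13)
    also have "\<dots> = (a * real (4*j+1)) powr (s - 2) * G" by simp
    also have "\<dots> = a powr (s - 2) * real (4*j+1) powr (s - 2) * G"
      using a by (simp only: powr_mult)
    also have "\<dots> \<le> a powr (s - 2) * real (Suc j) powr (s - 2) * \<bar>G\<bar>"
    proof (rule mult_mono)
      have "real (4*j+1) powr (s - 2) \<le> real (Suc j) powr (s - 2)"
        using s by (intro powr_mono2') auto
      then show "a powr (s - 2) * real (4*j+1) powr (s - 2) \<le> a powr (s - 2) * real (Suc j) powr (s - 2)"
        by (rule mult_left_mono) simp
    qed (use G0 in auto)
    finally show "norm (integral {0<..} (\<lambda>y. norm (f j y))) \<le> a powr (s - 2) * \<bar>G\<bar> * real (Suc j) powr (- ((1 - s) + 1))"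
      using integral_nonneg[OF nint[of j]] by (simp add: mult_ac)
  qed
  note R = sums_set_lebesgue_integral[where f = f and S = "{0<..}", OF fi sm ns su]
  have I: "integral {0<..} (\<lambda>y. 2 / pi * (y powr (s - 1) * psi4 y)) = a powr (s - 2) * G / 2 * l4 (1 - s)"
  proof (rule sums_unique2)
    show "(\<lambda>j. a powr (s - 2) * G / 2 * (real (4*j+1) powr (- (1 - s)) - real (4*j+3) powr (- (1 - s))))
        sums integral {0<..} (\<lambda>y. 2 / pi * (y powr (s - 1) * psi4 y))"
      using R(2) by (simp only: fI)
    show "(\<lambda>j. a powr (s - 2) * G / 2 * (real (4*j+1) powr (- (1 - s)) - real (4*j+3) powr (- (1 - s))))
        sums (a powr (s - 2) * G / 2 * l4 (1 - s))"
      by (rule sums_mult[OF l4_sums]) (use s in simp)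
  qed
  have "complex_of_real (Gamma s * l4 s) = Gamma (of_real s) * L4 (of_real s)"
    using s by (simp add: L4_of_real Gamma_complex_of_real)
  also have "\<dots> = integral {0<..} (\<lambda>y. complex_of_real y powr (of_real s - 1) * of_real (psi4 y))"
    using Mellin_psi4(2)[of "of_real s"] s by simp
  also have "\<dots> = integral {0<..} (\<lambda>y. complex_of_real (y powr (s - 1) * psi4 y))"
  proof (rule Henstock_Kurzweil_Integration.integral_cong)
    fix y :: real assume "y \<in> {0<..}"
    then have "of_real y powr (of_real (s - 1)) = complex_of_real (y powr (s - 1))"
      by (intro powr_of_real) auto
    then show "complex_of_real y powr (of_real s - 1) * of_real (psi4 y) = complex_of_real (y powr (s - 1) * psi4 y)" by simp
  qed
  also have "\<dots> = of_real (integral {0<..} (\<lambda>y. y powr (s - 1) * psi4 y))"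
  proof -
    have "(\<lambda>y. pi / 2 * (2 / pi * (y powr (s - 1) * psi4 y))) integrable_on {0<..}"
      by (intro integrable_on_mult_right set_lebesgue_integral_eq_integral(1) R(1))
    then have "(\<lambda>y. y powr (s - 1) * psi4 y) integrable_on {0<..}" by simp
    from integral_linear[OF this bounded_linear_of_real[where 'a = complex]]
    show ?thesis by (simp only: o_def)
  qed
  finally have "Gamma s * l4 s = integral {0<..} (\<lambda>y. y powr (s - 1) * psi4 y)"
    by (simp only: of_real_eq_iff)
  moreover have "integral {0<..} (\<lambda>y. 2 / pi * (y powr (s - 1) * psi4 y)) = 2 / pi * integral {0<..} (\<lambda>y. y powr (s - 1) * psi4 y)"
    by (rule integral_mult_right)
  ultimately have "2 / pi * (Gamma s * l4 s) = a powr (s - 2) * G / 2 * l4 (1 - s)" using I by simp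
  then have "Gamma s * l4 s = (a * a powr (s - 2)) * G / 2 * l4 (1 - s)"
    by (simp add: a_def field_simps)
  also have "a * a powr (s - 2) = a powr (s - 1)" using a by (simp add: powr_mult_base)
  finally show ?thesis by (simp add: a_def G_def)
qed

lemma Gamma_legendre_duplication_real:
  fixes s :: real
  assumes "s > 0"
  shows "Gamma (s/2) * Gamma ((s+1)/2) = 2 powr (1 - s) * sqrt pi * Gamma s"
proof -
  have "of_real (s/2) \<notin> (\<int>\<^sub>\<le>\<^sub>0 :: complex set)" "of_real (s/2) + 1/2 \<notin> (\<int>\<^sub>\<le>\<^sub>0 :: complex set)"
    using assms by (auto elim!: nonpos_Ints_cases simp: complex_eq_iff)
  from Gamma_legendre_duplication[OF this]
  have "Gamma (complex_of_real (s/2)) * Gamma (of_real ((s+1)/2)) =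
      exp ((1 - of_real s) * of_real (ln 2)) * of_real (sqrt pi) * Gamma (of_real s)"
    by (simp add: add_divide_distrib)
  also have "exp ((1 - of_real s) * of_real (ln 2)) = complex_of_real (2 powr (1 - s))"
    by (simp add: powr_def flip: exp_of_real)
  finally have "complex_of_real (Gamma (s/2) * Gamma ((s+1)/2)) = of_real (2 powr (1 - s) * sqrt pi * Gamma s)"
    unfolding Gamma_complex_of_real of_real_mult .
  then show ?thesis by (simp only: of_real_eq_iff)
qed

text \<open>The completed L-function: conductor 4, and Gamma factor of an odd character.\<close>

definition Z4 :: "complex \<Rightarrow> complex" where
  "Z4 s = of_real (4/pi) powr (s/2) * Gamma ((s+1)/2) * L4 s"

lemma Z4_of_real:
  assumes "s > 0"
  shows "Z4 (of_real s) = of_real ((4/pi) powr (s/2) * Gamma ((s+1)/2) * l4 s)"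
proof -
  have "complex_of_real (4/pi) powr of_real (s/2) = of_real ((4/pi) powr (s/2))"
    by (rule powr_of_real) auto
  moreover have "(of_real s + 1)/2 = complex_of_real ((s+1)/2)" by simp
  ultimately show ?thesis
    using assms unfolding Z4_def by (simp only: L4_of_real Gamma_complex_of_real of_real_mult) simp
qed

text \<open>Duplication splits Gamma(s) into Gamma(s/2) Gamma((s+1)/2), and Gamma(s/2) cancels
  against the Beta factor of the functional equation. The elementary factors collected in
  \<open>?K\<close> are identified by comparing logarithms.\<close>

lemma Z4_real_symmetric:
  assumes s: "0 < s" "s < 1"
  shows "Z4 (of_real s) = Z4 (1 - of_real s)"
proof -
  let ?K = "(4/pi) powr (s/2) * (2 powr (1 - s) * sqrt pi * ((pi/2) powr (s - 1) / 2))"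
  have K: "?K = (4/pi) powr ((1 - s)/2)"
  proof -
    have ln4: "ln (4::real) = 2 * ln 2" using ln_realpow[of 2 2] by simp
    have lsq: "ln (sqrt pi) = ln pi / 2" by (simp add: ln_sqrt)
    have "ln ?K = s/2 * (ln 4 - ln pi) + ((1 - s) * ln 2 + ln (sqrt pi) + ((s - 1) * (ln pi - ln 2) - ln 2))"
      by (simp add: ln_mult ln_div ln_powr)
    also have "\<dots> = (1 - s)/2 * (ln 4 - ln pi)" unfolding ln4 lsq by (simp add: field_simps)
    also have "\<dots> = ln ((4/pi) powr ((1 - s)/2))" by (simp add: ln_div ln_powr)
    finally show ?thesis by (subst (asm) ln_inj_iff) auto
  qed
  have G0: "Gamma (s/2) > 0" using s by (intro Gamma_real_pos) auto
  have "Gamma (s/2) * (Gamma ((s+1)/2) * l4 s) = 2 powr (1 - s) * sqrt pi * (Gamma s * l4 s)"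
    using Gamma_legendre_duplication_real[OF s(1)] by (simp add: mult_ac)
  also have "\<dots> = Gamma (s/2) * (2 powr (1 - s) * sqrt pi * ((pi/2) powr (s - 1) / 2) * Gamma (1 - s/2) * l4 (1 - s))"
    unfolding l4_functional_equation[OF s] by simp
  finally have "Gamma ((s+1)/2) * l4 s = 2 powr (1 - s) * sqrt pi * ((pi/2) powr (s - 1) / 2) * Gamma (1 - s/2) * l4 (1 - s)"
    using G0 by simp
  then have "(4/pi) powr (s/2) * Gamma ((s+1)/2) * l4 s = ?K * Gamma (1 - s/2) * l4 (1 - s)"
    by (simp add: mult.assoc)
  also have "1 - s/2 = ((1 - s) + 1) / 2" by simp
  finally have "(4/pi) powr (s/2) * Gamma ((s+1)/2) * l4 s = (4/pi) powr ((1 - s)/2) * Gamma (((1 - s) + 1) / 2) * l4 (1 - s)"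
    unfolding K .
  then show ?thesis
    using Z4_of_real[of s] Z4_of_real[of "1 - s"] s by simp
qed

lemma holomorphic_Z4: "Z4 holomorphic_on {s. Re s > 0}"
proof -
  have "(s + 1) / 2 \<notin> \<int>\<^sub>\<le>\<^sub>0" if "Re s > 0" for s
    using that by (auto elim!: nonpos_Ints_cases simp: complex_eq_iff)
  then show ?thesis
    unfolding Z4_def by (intro holomorphic_intros holomorphic_L4) auto
qed

text \<open>The functional equation is available on the real interval (0,1) only; the identity
  theorem carries it to the whole strip.\<close>

lemma Z4_symmetric:
  assumes "0 < Re s" "Re s < 1"
  shows "Z4 s = Z4 (1 - s)"
proof -
  let ?S = "{s. 0 < Re s} \<inter> {s. Re s < 1}"
  have "(\<lambda>z. Z4 z - Z4 (1 - z)) s = 0"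
  proof (rule analytic_continuation[of "\<lambda>z. Z4 z - Z4 (1 - z)" ?S "of_real ` {0<..<1}" "1/2"])
    show "(\<lambda>z. Z4 z - Z4 (1 - z)) holomorphic_on ?S"
      by (intro holomorphic_intros holomorphic_on_subset[OF holomorphic_Z4] holomorphic_on_compose_gen[OF _ holomorphic_Z4, unfolded o_def]) auto
    show "open ?S" by (intro open_Int open_halfspace_Re_gt open_halfspace_Re_lt)
    show "connected ?S" by (intro convex_connected convex_Int convex_halfspace_Re_gt convex_halfspace_Re_lt)
    show "(1/2::complex) islimpt of_real ` {0<..<1}"
    proof -
      have "(1/2::real) islimpt {0<..<1}" by (simp add: islimpt_greaterThanLessThan1 open_imp_islimpt interior_open)
      then have "complex_of_real (1/2) islimpt of_real ` {0<..<1}"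
      proof (rule islimpt_isCont_image)
        show "eventually (\<lambda>x. complex_of_real x \<noteq> of_real (1/2)) (at (1/2))"
          unfolding eventually_at of_real_eq_iff by (intro exI[of _ 1]) simp
      qed (auto intro!: continuous_intros)
      then show ?thesis by simp
    qed
  qed (use assms Z4_real_symmetric in auto)
  then show ?thesis by simp
qed

section \<open>Existence of a zero\<close>

lemma norm_Gamma_le:
  assumes "Re s > 0"
  shows "norm (Gamma s) \<le> Gamma (Re s)"
proof -
  have C: "((\<lambda>t. complex_of_real t powr (s - 1) / of_real (exp t)) has_integral Gamma s) {0..}"
    by (rule Gamma_integral_complex[OF assms])
  have R: "((\<lambda>t. t powr (Re s - 1) / exp t) has_integral Gamma (Re s)) {0..}"
    by (rule Gamma_integral_real[OF assms])
  have "norm (integral {0..} (\<lambda>t. complex_of_real t powr (s - 1) / of_real (exp t)))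
      \<le> integral {0..} (\<lambda>t. t powr (Re s - 1) / exp t)"
  proof (rule integral_norm_bound_integral)
    show "(\<lambda>t. complex_of_real t powr (s - 1) / of_real (exp t)) integrable_on {0..}" using C by blast
    show "(\<lambda>t. t powr (Re s - 1) / exp t) integrable_on {0..}" using R by blast
    fix t :: real assume "t \<in> {0..}"
    then show "norm (complex_of_real t powr (s - 1) / of_real (exp t)) \<le> t powr (Re s - 1) / exp t"
      by (cases "t = 0") (auto simp: norm_divide norm_powr_real_powr)
  qed
  then show ?thesis using integral_unique[OF C] integral_unique[OF R] by simp
qed

text \<open>Logarithmic convexity: \<open>x\<close> lies between n and n + 1, where Gamma takes the
  values (n-1)! and n!, both at most n!.\<close>

lemma Gamma_real_le:
  fixes x :: real
  assumes "x \<ge> 1"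
  shows "Gamma x \<le> x powr x"
proof -
  define n where "n = nat \<lfloor>x\<rfloor>"
  have n: "real n \<le> x" "x \<le> real n + 1" "n \<ge> 1" using assms by (auto simp: n_def le_nat_iff)
  define t where "t = x - real n"
  have t: "0 \<le> t" "t \<le> 1" "x = (1 - t) * real n + t * (real n + 1)" using n by (auto simp: t_def algebra_simps)
  have "(ln \<circ> Gamma) ((1 - t) *\<^sub>R real n + t *\<^sub>R (real n + 1)) \<le> (1 - t) * (ln \<circ> Gamma) (real n) + t * (ln \<circ> Gamma) (real n + 1)"
    using n t by (intro convex_onD[OF log_convex_Gamma_real]) auto
  then have "ln (Gamma x) \<le> (1 - t) * ln (Gamma (real n)) + t * ln (Gamma (real n + 1))"
    using t(3) by simp
  also have "\<dots> \<le> (1 - t) * ln (fact n) + t * ln (fact n)"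
  proof (intro add_mono mult_left_mono)
    have "Gamma (real n + 1) = fact n" using Gamma_fact[of n, where 'a = real] by (simp add: add.commute)
    then show "ln (Gamma (real n + 1)) \<le> ln (fact n :: real)" by simp
    have "Gamma (real n) = fact (n - 1)" using Gamma_fact[of "n - 1", where 'a = real] n by (simp add: of_nat_diff)
    then show "ln (Gamma (real n)) \<le> ln (fact n :: real)" using fact_mono[of "n - 1" n, where 'a = real] by simp
  qed (use t in auto)
  finally have "ln (Gamma x) \<le> ln (fact n)" by (simp add: algebra_simps)
  moreover have "Gamma x > 0" using assms by (intro Gamma_real_pos) auto
  ultimately have "Gamma x \<le> fact n" by simp
  also have "fact n \<le> (of_nat (n ^ n) :: real)" by (rule fact_le_power)
  then have "fact n \<le> real n ^ n" by simp
  also have "\<dots> = real n powr real n" using n by (simp add: powr_realpow)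
  also have "\<dots> \<le> x powr real n" using n by (intro powr_mono2) auto
  also have "\<dots> \<le> x powr x" using n by (intro powr_mono) auto
  finally show ?thesis .
qed

text \<open>The true order is x log x. The power 3/2 absorbs the logarithm and stays below 2, which
  is what forces the logarithm of a zero-free function to be affine. The shift by 1 reaches the
  range where \<open>Gamma_real_le\<close> applies.\<close>

lemma ln_Gamma_real_le:
  fixes x :: real
  assumes "x \<ge> 1/2"
  shows "ln (Gamma x) \<le> 1 + 2 * (x + 1) powr (3/2)"
proof -
  have G: "Gamma x > 0" using assms by (intro Gamma_real_pos) auto
  have "x \<notin> \<int>\<^sub>\<le>\<^sub>0" using assms by (auto elim!: nonpos_Ints_cases)
  then have "Gamma (x + 1) = x * Gamma x" by (rule Gamma_plus1)
  then have "Gamma x = Gamma (x + 1) / x" using assms by simp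
  also have "\<dots> \<le> 2 * Gamma (x + 1)"
  proof -
    have "1 / x \<le> 2" using assms by (simp add: field_simps)
    moreover have "Gamma (x + 1) > 0" using assms by (intro Gamma_real_pos) auto
    ultimately show ?thesis using mult_right_mono[of "1/x" 2 "Gamma (x + 1)"] by simp
  qed
  also have "\<dots> \<le> 2 * (x + 1) powr (x + 1)" using Gamma_real_le[of "x + 1"] assms by simp
  finally have "ln (Gamma x) \<le> ln (2 * (x + 1) powr (x + 1))"
    using G by (subst ln_le_cancel_iff) auto
  also have "\<dots> = ln 2 + (x + 1) * ln (x + 1)" using assms by (simp add: ln_mult ln_powr)
  also have "ln (x + 1) \<le> 2 * (x + 1) powr (1/2)"
  proof -
    have "ln ((x + 1) powr (1/2)) \<le> (x + 1) powr (1/2) - 1" using assms by (intro ln_le_minus_one) auto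
    then show ?thesis using assms by (simp add: ln_powr)
  qed
  then have "ln 2 + (x + 1) * ln (x + 1) \<le> 1 + (x + 1) * (2 * (x + 1) powr (1/2))"
    using assms ln_2_less_1 by (intro add_mono mult_left_mono) auto
  also have "(x + 1) * (2 * (x + 1) powr (1/2)) = 2 * (x + 1) powr (3/2)"
    using assms powr_mult_base[of "x + 1" "1/2"] by simp
  finally show ?thesis .
qed

text \<open>The map u -> u / (2M - u) sends the half-plane Re u < M into the unit disc and fixes 0.
  The Schwarz lemma at a point of norm at most 1/2 then gives |f w| \<le> (2M + |f w|) / 2.\<close>

lemma Borel_Caratheodory_half:
  assumes hol: "f holomorphic_on ball 0 r" and r: "r > 0" and f0: "f 0 = 0"
    and bd: "\<And>z. norm z < r \<Longrightarrow> Re (f z) < M" and w: "norm w \<le> r / 2"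
  shows "norm (f w) \<le> 2 * M"
proof -
  have M: "M > 0" using bd[of 0] r f0 by simp
  define g where "g = (\<lambda>z. f (of_real r * z))"
  have rz: "norm (of_real r * z) < r" if "norm z < 1" for z :: complex
    using that r by (simp add: norm_mult)
  have less: "norm (g z) < norm (2 * of_real M - g z)" and ne: "2 * of_real M - g z \<noteq> 0" if "norm z < 1" for z
  proof -
    have R: "Re (g z) < M" unfolding g_def by (intro bd rz that)
    have "(norm (2 * of_real M - g z))^2 - (norm (g z))^2 = 4 * M * (M - Re (g z))"
      unfolding cmod_power2 by (simp add: power2_eq_square algebra_simps)
    also have "\<dots> > 0" using R M by simp
    finally have "(norm (g z))^2 < (norm (2 * of_real M - g z))^2" by simp
    then show "norm (g z) < norm (2 * of_real M - g z)" by (rule power_less_imp_less_base) simp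
    then show "2 * of_real M - g z \<noteq> 0" by (metis norm_not_less_zero norm_zero)
  qed
  define k where "k = (\<lambda>z. g z / (2 * of_real M - g z))"
  have ghol: "g holomorphic_on ball 0 1"
    unfolding g_def
    by (rule holomorphic_on_compose_gen[OF _ hol, unfolded o_def]) (use rz in \<open>auto intro!: holomorphic_intros\<close>)
  have khol: "k holomorphic_on ball 0 1"
    unfolding k_def by (intro holomorphic_intros ghol) (use ne in auto)
  define z where "z = w / of_real r"
  have z: "norm z \<le> 1/2" using w r by (simp add: z_def norm_divide field_simps)
  have gz: "g z = f w" using r by (simp add: g_def z_def)
  have "norm (k z) \<le> norm z"
  proof (rule Schwarz_Lemma(1)[OF khol])
    show "k 0 = 0" by (simp add: k_def g_def f0)
    show "norm (k z) < 1" if "norm z < 1" for z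
      using less[OF that] ne[OF that] by (simp add: k_def norm_divide)
  qed (use z in simp)
  then have "norm (g z) \<le> norm z * norm (2 * of_real M - g z)"
    using ne[of z] z by (simp add: k_def norm_divide divide_le_eq)
  also have "\<dots> \<le> 1/2 * (2 * M + norm (g z))"
  proof (rule mult_mono)
    show "norm (2 * of_real M - g z) \<le> 2 * M + norm (g z)"
      using norm_triangle_ineq4[of "2 * of_real M" "g z"] M by (simp add: norm_mult)
  qed (use z in auto)
  finally show ?thesis unfolding gz by simp
qed

text \<open>By Borel-Caratheodory the one-sided bound controls |h|. Cauchy's estimate on a circle of
  radius r bounds the second derivative by a quantity of order r^(3/2) / r^2, so it
  vanishes.\<close>

lemma entire_affine_of_Re_bound:
  assumes hol: "h holomorphic_on UNIV" and A: "A \<ge> 0"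
    and bd: "\<And>z. Re (h z) \<le> A * (norm z + 3) powr (3/2)"
  shows "\<exists>b. \<forall>z. deriv h z = b"
proof -
  define f where "f = (\<lambda>z. h z - h 0)"
  have fhol: "f holomorphic_on S" for S
    unfolding f_def by (intro holomorphic_intros holomorphic_on_subset[OF hol]) auto
  \<comment> \<open>The radius 2|w| + 2 places \<open>w\<close> in the ball of half the radius and
    is positive even for w = 0.\<close>
  have B: "norm (f w) \<le> 2 * (A * (2 * norm w + 5) powr (3/2) + norm (h 0) + 1)" for w
  proof (rule Borel_Caratheodory_half[where f = f and w = w and r = "2 * norm w + 2"])
    fix z :: complex assume z: "norm z < 2 * norm w + 2"
    have "Re (f z) \<le> A * (norm z + 3) powr (3/2) + norm (h 0)"
      using bd[of z] abs_Re_le_cmod[of "h 0"] by (simp add: f_def)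
    also have "\<dots> < A * (2 * norm w + 5) powr (3/2) + norm (h 0) + 1"
    proof -
      have "(norm z + 3) powr (3/2) \<le> (2 * norm w + 5) powr (3/2)" using z by (intro powr_mono2) auto
      then show ?thesis using A by (smt (verit) mult_left_mono)
    qed
    finally show "Re (f z) < A * (2 * norm w + 5) powr (3/2) + norm (h 0) + 1" .
  qed (auto simp: f_def intro: fhol[unfolded f_def] add_nonneg_pos)
  have D2: "(deriv ^^ 2) f \<xi> = 0" for \<xi>
  proof -
    have "norm ((deriv ^^ 2) f \<xi>) \<le> fact 2 * (2 * (A * (2 * (norm \<xi> + r) + 5) powr (3/2) + norm (h 0) + 1)) / r^2" if "r > 0" for r
    proof (rule Cauchy_inequality[OF fhol holomorphic_on_imp_continuous_on[OF fhol] that])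
      fix x assume x: "norm (\<xi> - x) = r"
      then have "norm x \<le> norm \<xi> + r" by (smt (verit) norm_triangle_sub norm_minus_commute)
      then have "(2 * norm x + 5) powr (3/2) \<le> (2 * (norm \<xi> + r) + 5) powr (3/2)" by (intro powr_mono2) auto
      then have "A * (2 * norm x + 5) powr (3/2) \<le> A * (2 * (norm \<xi> + r) + 5) powr (3/2)"
        using A by (rule mult_left_mono)
      with B[of x] show "norm (f x) \<le> 2 * (A * (2 * (norm \<xi> + r) + 5) powr (3/2) + norm (h 0) + 1)" by simp
    qed
    note F = this
    have ev: "\<forall>\<^sub>F r in at_top. norm ((deriv ^^ 2) f \<xi>) \<le> fact 2 * (2 * (A * (2 * (norm \<xi> + r) + 5) powr (3/2) + norm (h 0) + 1)) / r^2"
      by (rule eventually_mono[OF eventually_gt_at_top[of 0]]) (rule F)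
    have "((\<lambda>r. fact 2 * (2 * (A * (2 * (x + r) + 5) powr (3/2) + y + 1)) / r^2) \<longlongrightarrow> 0) at_top" for x y :: real
      by real_asymp
    from tendsto_lowerbound[OF this ev] show ?thesis by simp
  qed
  have der: "(f has_field_derivative deriv f z) (at z)" for z
    by (rule holomorphic_derivI[OF fhol open_UNIV UNIV_I])
  have dhol: "deriv f holomorphic_on UNIV" by (rule holomorphic_deriv[OF fhol]) simp
  have "(deriv f has_field_derivative 0) (at z)" for z
    using holomorphic_derivI[OF dhol open_UNIV, of z] D2[of z] by (simp add: numeral_2_eq_2)
  then have "\<exists>c. \<forall>z\<in>UNIV. deriv f z = c"
    using has_field_derivative_zero_constant[of UNIV "deriv f"] by auto
  moreover have "deriv f z = deriv h z" for z
    using der[of z] holomorphic_derivI[OF hol open_UNIV, of z] unfolding f_def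
    by (auto intro!: DERIV_imp_deriv derivative_eq_intros)
  ultimately show ?thesis by auto
qed

lemma ln_norm_Z4_le:
  shows "\<exists>A\<ge>0. \<forall>s. Re s \<ge> 1/2 \<longrightarrow> Z4 s \<noteq> 0 \<longrightarrow> ln (norm (Z4 s)) \<le> A * (norm s + 2) powr (3/2)"
proof -
  obtain C where C: "C > 0" "\<And>s. Re s \<ge> 1/2 \<Longrightarrow> norm (L4 s) \<le> C * norm s"
    using norm_L4_le[of "1/2"] by auto
  define A where "A = 5 + \<bar>ln C\<bar>"
  have "ln (norm (Z4 s)) \<le> A * (norm s + 2) powr (3/2)" if s: "Re s \<ge> 1/2" and nz: "Z4 s \<noteq> 0" for s
  proof -
    define r where "r = norm s + 2"
    define R where "R = r powr (3/2)"
    have r: "r \<ge> 2" by (simp add: r_def)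
    have rR: "r \<le> R" using r powr_mono[of 1 "3/2" r] by (simp add: R_def)
    have Rs: "Re s \<le> r - 2" using complex_Re_le_cmod[of s] by (simp add: r_def)
    have L0: "L4 s \<noteq> 0" using nz by (auto simp: Z4_def)
    have s0: "norm s > 0" using s by auto
    have "norm (Z4 s) = (4/pi) powr (Re s / 2) * norm (Gamma ((s+1)/2)) * norm (L4 s)"
      by (simp add: Z4_def norm_mult norm_powr_real_powr)
    also have "\<dots> \<le> (4/pi) powr (Re s / 2) * Gamma ((Re s + 1)/2) * (C * norm s)"
    proof (intro mult_mono mult_nonneg_nonneg)
      show "norm (Gamma ((s+1)/2)) \<le> Gamma ((Re s + 1)/2)" using norm_Gamma_le[of "(s+1)/2"] s by simp
      show "0 \<le> Gamma ((Re s + 1)/2)" using s by (intro less_imp_le Gamma_real_pos) auto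
    qed (use C s in auto)
    finally have le: "norm (Z4 s) \<le> (4/pi) powr (Re s / 2) * Gamma ((Re s + 1)/2) * (C * norm s)" .
    have Gp: "Gamma ((Re s + 1)/2) > 0" using s by (intro Gamma_real_pos) auto
    have "ln (norm (Z4 s)) \<le> ln ((4/pi) powr (Re s / 2) * Gamma ((Re s + 1)/2) * (C * norm s))"
      using le nz Gp C s0 by (subst ln_le_cancel_iff) auto
    also have "\<dots> = Re s / 2 * ln (4/pi) + ln (Gamma ((Re s + 1)/2)) + (ln C + ln (norm s))"
      using Gp C s0 by (simp add: ln_mult ln_powr)
    also have "\<dots> \<le> Re s / 2 * 1 + (1 + 2 * ((Re s + 1)/2 + 1) powr (3/2)) + (\<bar>ln C\<bar> + norm s)"
    proof (intro add_mono mult_left_mono)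
      have "ln (4/pi) \<le> 4/pi - 1" by (intro ln_le_minus_one) auto
      also have "\<dots> \<le> 1" using pi_ge_two by (simp add: field_simps)
      finally show "ln (4/pi) \<le> 1" .
      show "ln (Gamma ((Re s + 1)/2)) \<le> 1 + 2 * ((Re s + 1)/2 + 1) powr (3/2)" using s by (intro ln_Gamma_real_le) auto
      show "ln (norm s) \<le> norm s" using ln_le_minus_one[OF s0] by simp
    qed (use s in auto)
    also have "\<dots> \<le> r + (1 + 2 * R) + (\<bar>ln C\<bar> + r)"
    proof -
      have "(Re s + 1)/2 + 1 \<le> r" using Rs r by (simp add: field_simps)
      then have "((Re s + 1)/2 + 1) powr (3/2) \<le> R" unfolding R_def using s by (intro powr_mono2) auto
      then show ?thesis using Rs r s by (simp add: r_def)
    qed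
    also have "\<dots> \<le> A * R"
    proof -
      have "\<bar>ln C\<bar> * 1 \<le> \<bar>ln C\<bar> * R" using r rR by (intro mult_left_mono) auto
      then show ?thesis unfolding A_def distrib_right using r rR by linarith
    qed
    finally show ?thesis by (simp add: R_def r_def)
  qed
  moreover have "A \<ge> 0" by (simp add: A_def)
  ultimately show ?thesis by blast
qed

text \<open>All pairs are nonnegative, and the first alone is at least 1 - 1/3.\<close>

lemma l4_ge:
  assumes "s \<ge> 1"
  shows "l4 s \<ge> 2/3"
proof -
  let ?t = "\<lambda>j. real (4*j+1) powr (- s) - real (4*j+3) powr (- s)"
  have nn: "?t j \<ge> 0" for j
    using powr_mono2'[of "-s" "real (4*j+1)" "real (4*j+3)"] assms by simp
  have "?t 0 = 1 - 3 powr (- s)" by simp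
  moreover have "3 powr (- s) \<le> 3 powr (-1 :: real)" using assms by (intro powr_mono) auto
  then have "3 powr (- s) \<le> 1/3" by (simp add: powr_minus_divide)
  moreover have "sum ?t {0} \<le> suminf ?t"
    using l4_sums[of s] assms nn by (intro sum_le_suminf) (auto simp: sums_iff)
  ultimately show ?thesis by (simp add: l4_def)
qed

lemma exists_L4_zero: "\<exists>\<rho>. Re \<rho> \<ge> 1/2 \<and> L4 \<rho> = 0"
proof (rule ccontr)
  assume "\<not> ?thesis"
  then have nz: "L4 s \<noteq> 0" if "Re s \<ge> 1/2" for s using that by blast
  \<comment> \<open>Gluing \<open>Z4\<close> to its reflection along the strip gives the entire
    function directly, without continuing \<open>L4\<close> itself. The negated claim excludes zeros
    for Re s \<ge> 1/2 only; the symmetry of \<open>E\<close> excludes the others.\<close>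
  define E where "E = (\<lambda>s. if Re s > 0 then Z4 s else Z4 (1 - s))"
  have E1: "E s = Z4 s" if "Re s > 0" for s using that by (simp add: E_def)
  have E2: "E s = Z4 (1 - s)" if "Re s < 1" for s using that Z4_symmetric[of s] by (simp add: E_def)
  have Esym: "E (1 - s) = E s" for s
    by (cases "Re s > 0") (use E1[of s] E2[of "1 - s"] E1[of "1 - s"] E2[of s] in auto)
  have hol1: "E holomorphic_on {s. Re s > 0}"
    using holomorphic_Z4 by (rule holomorphic_transform) (use E1 in auto)
  have "(\<lambda>s. Z4 (1 - s)) holomorphic_on {s. Re s < 1}"
    by (rule holomorphic_on_compose_gen[OF _ holomorphic_Z4, unfolded o_def]) (auto intro!: holomorphic_intros)
  then have hol2: "E holomorphic_on {s. Re s < 1}"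
    by (rule holomorphic_transform) (use E2 in auto)
  have "E holomorphic_on {s. Re s > 0} \<union> {s. Re s < 1}"
    by (intro holomorphic_on_Un hol1 hol2 open_halfspace_Re_gt open_halfspace_Re_lt)
  moreover have "{s. Re s > 0} \<union> {s. Re s < 1} = (UNIV :: complex set)" by auto
  ultimately have Ehol: "E holomorphic_on UNIV" by simp
  have Z0: "Z4 s \<noteq> 0" if "Re s \<ge> 1/2" for s
  proof -
    have "(s + 1) / 2 \<notin> \<int>\<^sub>\<le>\<^sub>0" using that by (auto elim!: nonpos_Ints_cases simp: complex_eq_iff)
    then show ?thesis using nz[OF that] by (simp add: Z4_def Gamma_eq_zero_iff)
  qed
  have Enz: "E s \<noteq> 0" for s
  proof (cases "Re s \<ge> 1/2")
    case False
    then have "E s = Z4 (1 - s)" "Re (1 - s) \<ge> 1/2" using E2[of s] by auto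
    then show ?thesis using Z0 by simp
  qed (use E1[of s] Z0[of s] in auto)
  obtain h where h: "h holomorphic_on UNIV" "\<And>s. exp (h s) = E s"
    using holomorphic_logarithm_exists[of UNIV E 0] Ehol Enz by auto
  obtain A where A: "A \<ge> 0" "\<And>s. Re s \<ge> 1/2 \<Longrightarrow> ln (norm (Z4 s)) \<le> A * (norm s + 2) powr (3/2)"
    using ln_norm_Z4_le Z0 by auto
  have Reh: "Re (h s) = ln (norm (E s))" for s
    by (simp flip: h(2))
  have "Re (h s) \<le> A * (norm s + 3) powr (3/2)" for s
  proof (cases "Re s \<ge> 1/2")
    case True
    then have "Re (h s) \<le> A * (norm s + 2) powr (3/2)" using A(2)[OF True] E1[of s] by (simp add: Reh)
    also have "\<dots> \<le> A * (norm s + 3) powr (3/2)" using A(1) by (intro mult_left_mono powr_mono2) auto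
    finally show ?thesis .
  next
    case False
    then have "Re (h s) \<le> A * (norm (1 - s) + 2) powr (3/2)" using A(2)[of "1 - s"] E2[of s] by (simp add: Reh)
    also have "\<dots> \<le> A * (norm s + 3) powr (3/2)"
      using A(1) norm_triangle_ineq4[of 1 s] by (intro mult_left_mono powr_mono2) auto
    finally show ?thesis .
  qed
  then obtain b where b: "\<And>z. deriv h z = b" using entire_affine_of_Re_bound[OF h(1) A(1)] by blast
  have hd: "(h has_field_derivative b) (at z)" for z
    using holomorphic_derivI[OF h(1) open_UNIV, of z] by (simp add: b)
  have Ed: "(E has_field_derivative (E z * b)) (at z)" for z
  proof -
    have "((\<lambda>s. exp (h s)) has_field_derivative (exp (h z) * b)) (at z)"
      by (rule DERIV_fun_exp[OF hd])
    then show ?thesis by (simp add: h(2))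
  qed
  \<comment> \<open>E' = bE, while differentiating E(1 - s) = E(s) gives E' = -bE. As
    \<open>E\<close> has no zero, b = 0.\<close>
  have "((\<lambda>s. E (1 - s)) has_field_derivative (E (1 - z) * b * (-1))) (at z)" for z
    by (rule DERIV_chain2[OF Ed]) (auto intro!: derivative_eq_intros)
  then have "(E has_field_derivative (- (E z * b))) (at z)" for z
    by (simp add: Esym)
  from DERIV_unique[OF this[of 0] Ed[of 0]] have "b = 0" using Enz[of 0] by simp
  then have "\<exists>c. \<forall>z\<in>UNIV. E z = c"
    using Ed by (intro has_field_derivative_zero_constant) auto
  then obtain c where c: "\<And>z. E z = c" by auto
  \<comment> \<open>At s = 2n + 1 the Gamma factor is n!, the conductor factor is at least 1 because
    pi < 4, and L is at least 2/3.\<close>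
  have cn: "norm c \<ge> 2/3 * fact n" for n
  proof -
    define s where "s = 2 * real n + 1"
    have s: "s \<ge> 1" by (simp add: s_def)
    have "c = of_real ((4/pi) powr (s/2) * Gamma ((s+1)/2) * l4 s)"
      using c[of "of_real s"] E1[of "of_real s"] Z4_of_real[of s] s by simp
    then have "norm c = (4/pi) powr (s/2) * \<bar>Gamma ((s+1)/2)\<bar> * \<bar>l4 s\<bar>"
      by (simp add: norm_mult abs_mult)
    moreover have "Gamma ((s+1)/2) = fact n"
    proof -
      have e: "(s+1)/2 = 1 + real n" by (simp add: s_def field_simps)
      show ?thesis unfolding e by (rule Gamma_fact)
    qed
    moreover have "(4/pi) powr (s/2) \<ge> 1" using pi_less_4 s by (intro ge_one_powr_ge_zero) auto
    moreover have "1 * fact n * (2/3) \<le> P * fact n * \<bar>l4 s\<bar>" if "P \<ge> 1" for P :: real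
      using l4_ge[OF s] that by (intro mult_mono) auto
    ultimately have "norm c \<ge> 1 * fact n * (2/3)" by simp
    then show ?thesis by simp
  qed
  obtain n where n: "3/2 * norm c < real n" using reals_Archimedean2[of "3/2 * norm c"] by auto
  have "real n \<le> real (fact n)" by (simp only: of_nat_le_iff fact_ge_self)
  then have "real n \<le> fact n" by simp
  with n cn[of n] show False by linarith
qed

section \<open>The Moebius function twisted by the character\<close>

lemma moebius_1 [simp]: "moebius (Suc 0) = 1"
  using squarefree_1[where 'a = nat] by (simp add: moebius_def)

lemma abs_moebius_le: "\<bar>moebius n\<bar> \<le> 1"
  by (simp add: moebius_def)

lemma moebius_prime_mult:
  assumes p: "prime p" and d: "\<not> p dvd d"
  shows "moebius (p * d) = - moebius d"
proof (cases "squarefree d")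
  case True
  have cop: "coprime p d" using p d by (simp add: prime_imp_coprime)
  have d0: "d \<noteq> 0" using d by (metis dvd_0_right)
  have sq: "squarefree (p * d)"
    by (rule squarefree_mult_coprime[OF cop squarefree_prime[OF p] True])
  have "prime_factors (p * d) = insert p (prime_factors d)"
    using p d0 by (simp add: prime_factors_product prime_factorization_prime)
  moreover have "p \<notin> prime_factors d" using d by (auto simp: in_prime_factors_iff)
  ultimately have "card (prime_factors (p * d)) = Suc (card (prime_factors d))" by simp
  then show ?thesis using True sq by (simp add: moebius_def)
next
  case False
  then have "\<not> squarefree (p * d)" using squarefree_multD(2) by blast
  then show ?thesis using False by (simp add: moebius_def)
qed

lemma moebius_not_squarefree:
  assumes "p > 1" "p^2 dvd n"
  shows "moebius n = 0"
  using assms squarefreeD[of n p] by (auto simp: moebius_def)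

text \<open>For a prime p dividing N, multiplication by p matches the squarefree divisors prime to p
  (\<open>A\<close>) with those divisible by p (\<open>B\<close>) and reverses the sign of the
  Moebius function.\<close>

lemma sum_moebius_divisors:
  assumes "N > 0"
  shows "(\<Sum>d | d dvd N. moebius d) = (if N = 1 then 1 else 0)"
proof (cases "N = 1")
  case True
  then show ?thesis by simp
next
  case False
  then obtain p where p: "prime p" "p dvd N" using prime_factor_nat by blast
  define A where "A = {d. d dvd N \<and> \<not> p dvd d \<and> squarefree d}"
  define B where "B = {d. d dvd N \<and> p dvd d \<and> squarefree d}"
  have fin: "finite {d. d dvd N}" using assms by simp
  have finA: "finite A" "finite B" by (auto intro: finite_subset[OF _ fin] simp: A_def B_def)
  have B: "B = (*) p ` A"
  proof (intro equalityI subsetI)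
    fix d assume d: "d \<in> B"
    then obtain e where e: "d = p * e" by (auto simp: B_def)
    have "\<not> p dvd e"
    proof
      assume "p dvd e"
      then have "p^2 dvd d" by (simp add: e power2_eq_square)
      then show False using d squarefreeD[of d p] p by (auto simp: B_def)
    qed
    moreover have "squarefree e" "e dvd N" using d e by (auto simp: B_def dest: squarefree_multD dvd_mult_right)
    ultimately show "d \<in> (*) p ` A" using e by (auto simp: A_def)
  next
    fix d assume "d \<in> (*) p ` A"
    then obtain e where e: "d = p * e" "e dvd N" "\<not> p dvd e" "squarefree e" by (auto simp: A_def)
    have cop: "coprime p e" using p e by (simp add: prime_imp_coprime)
    then have "p * e dvd N" using p e by (intro divides_mult)
    moreover have "squarefree (p * e)"
      by (rule squarefree_mult_coprime[OF cop squarefree_prime[OF p(1)] e(4)])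
    ultimately show "d \<in> B" using e by (auto simp: B_def)
  qed
  have inj: "inj_on ((*) p) A" using p by (auto simp: inj_on_def)
  have "(\<Sum>d | d dvd N. moebius d) = (\<Sum>d\<in>A \<union> B. moebius d)"
    by (rule sum.mono_neutral_right[OF fin]) (auto simp: A_def B_def moebius_def)
  also have "\<dots> = sum moebius A + sum moebius B"
    by (rule sum.union_disjoint[OF finA]) (auto simp: A_def B_def)
  also have "sum moebius B = (\<Sum>d\<in>A. moebius (p * d))"
    unfolding B by (simp add: sum.reindex[OF inj])
  also have "\<dots> = (\<Sum>d\<in>A. - moebius d)"
    by (rule sum.cong) (use p moebius_prime_mult in \<open>auto simp: A_def\<close>)
  finally show ?thesis using False by (simp add: sum_negf)
qed

definition chi4 :: "nat \<Rightarrow> real" where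
  "chi4 n = (if n mod 4 = 1 then 1 else if n mod 4 = 3 then -1 else 0)"

lemma chi4_mult: "chi4 (m * n) = chi4 m * chi4 n"
proof -
  have "m mod 4 \<in> {0,1,2,3}" "n mod 4 \<in> {0,1,2,3}" by auto
  then show ?thesis unfolding chi4_def mod_mult_eq[of m 4 n, symmetric] by auto
qed

lemma abs_chi4_le: "\<bar>chi4 n\<bar> \<le> 1"
  by (simp add: chi4_def)

lemma chi4_0 [simp]: "chi4 0 = 0" and chi4_1 [simp]: "chi4 (Suc 0) = 1"
  by (simp_all add: chi4_def)

lemma abs_chi4_odd: "odd n \<Longrightarrow> \<bar>chi4 n\<bar> = 1"
proof -
  assume "odd n"
  then have "n mod 4 = 1 \<or> n mod 4 = 3" by presburger
  then show ?thesis by (auto simp: chi4_def)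
qed

lemma psi4_chi_sums:
  assumes y: "y > 0"
  shows "summable (\<lambda>k. norm (chi4 k * exp (- (real k * y))))"
    and "(\<lambda>k. chi4 k * exp (- (real k * y))) sums psi4 y"
proof -
  have geo: "summable (\<lambda>k. (exp (- y)) ^ k)" using y by (intro summable_geometric) simp
  have pw: "(exp (- y)) ^ k = exp (- (real k * y))" for k by (simp flip: exp_of_nat_mult)
  show sm: "summable (\<lambda>k. norm (chi4 k * exp (- (real k * y))))"
  proof (rule summable_comparison_test'[OF geo])
    show "norm (norm (chi4 k * exp (- (real k * y)))) \<le> (exp (- y)) ^ k" for k
      unfolding pw using abs_chi4_le[of k] by (simp add: abs_mult mult_left_le_one_le)
  qed
  then have su: "(\<lambda>k. chi4 k * exp (- (real k * y))) sums (\<Sum>k. chi4 k * exp (- (real k * y)))"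
    by (rule summable_sums[OF summable_norm_cancel])
  have "(\<lambda>n. \<Sum>k\<in>{n * 4..<n * 4 + 4}. chi4 k * exp (- (real k * y))) sums (\<Sum>k. chi4 k * exp (- (real k * y)))"
    by (rule sums_group[OF su]) simp
  moreover have "(\<Sum>k\<in>{n * 4..<n * 4 + 4}. chi4 k * exp (- (real k * y)))
      = exp (- (real (4 * n + 1) * y)) - exp (- (real (4 * n + 3) * y))" for n
  proof -
    have "{n * 4..<n * 4 + 4} = {4*n, 4*n+1, 4*n+2, 4*n+3}" by auto
    moreover have "(4*n) mod 4 = 0" "(4*n+1) mod 4 = 1" "(4*n+2) mod 4 = 2" "(4*n+3) mod 4 = 3"
      by presburger+
    then have "chi4 (4*n) = 0" "chi4 (4*n+1) = 1" "chi4 (4*n+2) = 0" "chi4 (4*n+3) = -1"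
      unfolding chi4_def by simp_all
    ultimately show ?thesis by simp
  qed
  ultimately have "(\<lambda>n. exp (- (real (4 * n + 1) * y)) - exp (- (real (4 * n + 3) * y))) sums (\<Sum>k. chi4 k * exp (- (real k * y)))"
    by (simp only:)
  then have "(\<Sum>k. chi4 k * exp (- (real k * y))) = psi4 y"
    by (rule sums_unique2[OF _ psi4_exp_sums[OF y]])
  then show "(\<lambda>k. chi4 k * exp (- (real k * y))) sums psi4 y" using su by simp
qed

text \<open>The Dirichlet coefficients of 1/L(s, \<chi>).\<close>

definition amu :: "nat \<Rightarrow> real" where
  "amu n = of_int (moebius n) * chi4 n"

lemma amu_0 [simp]: "amu 0 = 0" by (simp add: amu_def)

lemma abs_amu_le: "\<bar>amu n\<bar> \<le> 1"
proof -
  have "\<bar>real_of_int (moebius n)\<bar> \<le> 1" using abs_moebius_le[of n] by (simp flip: of_int_abs)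
  then show ?thesis unfolding amu_def abs_mult using abs_chi4_le[of n] by (intro mult_le_one) auto
qed

lemma psi4_bounds: "0 < psi4 y" "psi4 y \<le> exp (- y)" "y \<ge> 0 \<Longrightarrow> psi4 y \<le> 1/2"
proof -
  show "0 < psi4 y" by (simp add: psi4_def add_pos_pos)
  have "psi4 y \<le> 1 / exp y" unfolding psi4_def by (intro divide_left_mono mult_pos_pos add_pos_pos) auto
  then show "psi4 y \<le> exp (- y)" by (simp add: exp_minus inverse_eq_divide)
  have "exp y + exp (- y) - 2 = (exp y - 1)^2 / exp y"
    by (simp add: exp_minus field_simps power2_eq_square)
  also have "\<dots> \<ge> 0" by simp
  finally have "2 \<le> exp y + exp (- y)" by simp
  then show "psi4 y \<le> 1/2" by (simp add: psi4_def field_simps)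
qed

lemma summable_amu_psi4:
  assumes z: "z > 0"
  shows "summable (\<lambda>n. norm (amu n * psi4 (real n * z)))"
proof (rule summable_comparison_test')
  show "summable (\<lambda>n. exp (- z) ^ n)" using z by (intro summable_geometric) simp
  fix n
  have "norm (amu n * psi4 (real n * z)) \<le> 1 * exp (- (real n * z))"
    unfolding norm_mult using abs_amu_le[of n] psi4_bounds[of "real n * z"] by (intro mult_mono) auto
  then show "norm (norm (amu n * psi4 (real n * z))) \<le> exp (- z) ^ n"
    by (simp flip: exp_of_nat_mult)
qed

text \<open>Expanding \<open>psi4\<close> gives a double series over n and k. Complete
  multiplicativity of \<open>chi4\<close> makes the terms with nk = N share the factor chi4(N)
  e^(-Nz), and summing \<mu>(n) over n dividing N leaves N = 1. The index 0 is left out, since the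
  exponentials do not decay there.\<close>

lemma amu_psi4_sums:
  assumes z: "z > 0"
  shows "(\<lambda>n. amu n * psi4 (real n * z)) sums exp (- z)"
proof -
  define A where "A = {1::nat..}"
  define f where "f = (\<lambda>(n,k). amu n * (chi4 k * exp (- (real k * (real n * z)))))"
  define g where "g = (\<lambda>n::nat. exp (- (real n * z / 2)))"
  have gsum: "(g has_sum (\<Sum>n. g n)) UNIV"
  proof (rule norm_summable_imp_has_sum)
    have "summable (\<lambda>n. (exp (- z / 2)) ^ n)" using z by (intro summable_geometric) simp
    moreover have "(\<lambda>n. (exp (- z / 2)) ^ n) = g" by (rule ext) (simp add: g_def flip: exp_of_nat_mult)
    ultimately have "summable g" by (simp only:)
    then show "summable (\<lambda>n. norm (g n))" "g sums (\<Sum>n. g n)" by (auto simp: g_def summable_sums)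
  qed
  have gA: "g summable_on A" by (rule summable_on_subset_banach[OF has_sum_imp_summable[OF gsum]]) simp
  have "(\<lambda>(n,k). g n * g k) summable_on Sigma A (\<lambda>_. A)"
  proof (rule summable_on_SigmaI)
    show "((\<lambda>k. (case (n, k) of (n, k) \<Rightarrow> g n * g k)) has_sum (g n * infsum g A)) A" if "n \<in> A" for n
      using has_sum_cmult_right[OF has_sum_infsum[OF gA], of "g n"] by simp
    show "(\<lambda>n. g n * infsum g A) summable_on A" by (rule summable_on_cmult_left[OF gA])
  qed (auto simp: g_def)
  then have "(\<lambda>x. norm (f x)) summable_on Sigma A (\<lambda>_. A)"
  proof (rule Infinite_Sum.abs_summable_on_comparison_test')
    fix x assume "x \<in> Sigma A (\<lambda>_. A)"
    then obtain n k where x: "x = (n,k)" "n \<ge> 1" "k \<ge> 1" by (auto simp: A_def)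
    \<comment> \<open>For n, k \<ge> 1 the product dominates the mean, so the double series is
      majorized by a product of two geometric series.\<close>
    have "real n + real k \<le> 2 * (real k * real n)"
    proof -
      have "real n \<le> real k * real n" "real k \<le> real k * real n" using x by auto
      then show ?thesis by linarith
    qed
    then have "(real n + real k) * z \<le> 2 * (real k * real n) * z" using z by (intro mult_right_mono) auto
    then have le: "exp (- (real k * (real n * z))) \<le> g n * g k"
      by (simp add: g_def algebra_simps flip: exp_add)
    have "norm (f x) = \<bar>amu n\<bar> * (\<bar>chi4 k\<bar> * exp (- (real k * (real n * z))))" by (simp add: f_def x abs_mult)
    also have "\<dots> \<le> 1 * (1 * exp (- (real k * (real n * z))))"
      by (intro mult_mono abs_amu_le abs_chi4_le) auto
    finally show "norm (f x) \<le> (case x of (n, k) \<Rightarrow> g n * g k)" using le by (simp add: x)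
  qed
  then have fs: "(f has_sum infsum f (A \<times> A)) (A \<times> A)"
    by (rule has_sum_infsum[OF Infinite_Sum.abs_summable_summable])
  have H1: "((\<lambda>n. amu n * psi4 (real n * z)) has_sum infsum f (A \<times> A)) A"
  proof (rule has_sum_Sigma'[OF fs])
    fix n assume n: "n \<in> A"
    then have nz: "real n * z > 0" using z by (simp add: A_def)
    have "((\<lambda>k. chi4 k * exp (- (real k * (real n * z)))) has_sum psi4 (real n * z)) UNIV"
      by (rule norm_summable_imp_has_sum[OF psi4_chi_sums[OF nz]])
    then have "((\<lambda>k. chi4 k * exp (- (real k * (real n * z)))) has_sum psi4 (real n * z)) A"
      by (subst (asm) has_sum_cong_neutral[where T = A and g = "\<lambda>k. chi4 k * exp (- (real k * (real n * z)))"])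
         (auto simp: A_def not_less_eq_eq)
    then show "((\<lambda>k. f (n, k)) has_sum amu n * psi4 (real n * z)) A"
      unfolding f_def by (auto intro: has_sum_cmult_right)
  qed
  define h where "h = (\<lambda>(N,n). of_int (moebius n) * (chi4 N * exp (- (real N * z))))"
  \<comment> \<open>The rearrangement from pairs (n, k) to pairs (nk, n) with n dividing nk.\<close>
  have "(f has_sum infsum f (A \<times> A)) (A \<times> A) = (h has_sum infsum f (A \<times> A)) (Sigma A (\<lambda>N. {n. n dvd N}))"
  proof (rule has_sum_reindex_bij_witness[where j = "\<lambda>(n,k). (n * k, n)" and i = "\<lambda>(N,n). (n, N div n)"])
    fix a assume "a \<in> A \<times> A"
    then obtain n k where a: "a = (n, k)" "n \<ge> 1" "k \<ge> 1" by (auto simp: A_def)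
    show "(case case a of (n, k) \<Rightarrow> (n * k, n) of (N, n) \<Rightarrow> (n, N div n)) = a" using a by simp
    show "(case a of (n, k) \<Rightarrow> (n * k, n)) \<in> Sigma A (\<lambda>N. {n. n dvd N})" using a by (simp add: A_def)
    show "h (case a of (n, k) \<Rightarrow> (n * k, n)) = f a" by (simp add: a(1) h_def f_def amu_def chi4_mult mult_ac)
  next
    fix b assume "b \<in> Sigma A (\<lambda>N. {n. n dvd N})"
    then obtain N n where b: "b = (N, n)" "N \<ge> 1" "n dvd N" by (auto simp: A_def)
    from b(3) obtain k where k: "N = n * k" ..
    then have nk: "n \<ge> 1" "k \<ge> 1" using b(2) by (auto simp: Suc_le_eq)
    show "(case case b of (N, n) \<Rightarrow> (n, N div n) of (n, k) \<Rightarrow> (n * k, n)) = b" using b k nk by simp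
    show "(case b of (N, n) \<Rightarrow> (n, N div n)) \<in> A \<times> A" using b k nk by (simp add: A_def)
  qed simp
  then have "(h has_sum infsum f (A \<times> A)) (Sigma A (\<lambda>N. {n. n dvd N}))" using fs by simp
  then have "((\<lambda>(N,n). of_int (moebius n) * (chi4 N * exp (- (real N * z)))) has_sum infsum f (A \<times> A)) (Sigma A (\<lambda>N. {n. n dvd N}))"
    unfolding h_def .
  then have H2: "((\<lambda>N. if N = 1 then exp (- z) else 0) has_sum infsum f (A \<times> A)) A"
  proof (rule has_sum_Sigma')
    fix N assume N: "N \<in> A"
    then have fin: "finite {n. n dvd N}" by (simp add: A_def)
    have "(\<Sum>n | n dvd N. of_int (moebius n) * (chi4 N * exp (- (real N * z)))) =
       of_int (\<Sum>n | n dvd N. moebius n) * (chi4 N * exp (- (real N * z)))"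
      by (simp add: sum_distrib_right)
    also have "\<dots> = (if N = 1 then exp (- z) else 0)"
      using N by (subst sum_moebius_divisors) (auto simp: A_def)
    finally show "((\<lambda>n. case (N, n) of (N, n) \<Rightarrow> of_int (moebius n) * (chi4 N * exp (- (real N * z)))) has_sum
        (if N = 1 then exp (- z) else 0)) {n. n dvd N}"
      using has_sum_finite[OF fin, of "\<lambda>n. of_int (moebius n) * (chi4 N * exp (- (real N * z)))"] by simp
  qed
  have "((\<lambda>N::nat. if N = 1 then exp (- z) else 0) has_sum exp (- z)) {1}"
    using has_sum_finite[of "{1::nat}" "\<lambda>N. if N = 1 then exp (- z) else 0"] by simp
  then have "((\<lambda>N::nat. if N = 1 then exp (- z) else 0) has_sum exp (- z)) A"
    by (subst has_sum_cong_neutral[where T = "{1}" and g = "\<lambda>N. if N = 1 then exp (- z) else 0"]) (auto simp: A_def)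
  then have "infsum f (A \<times> A) = exp (- z)" by (rule has_sum_unique[OF H2])
  with H1 have "((\<lambda>n. amu n * psi4 (real n * z)) has_sum exp (- z)) A" by simp
  then have "((\<lambda>n. amu n * psi4 (real n * z)) has_sum exp (- z)) UNIV"
    by (subst has_sum_cong_neutral[where T = A and g = "\<lambda>n. amu n * psi4 (real n * z)"])
       (auto simp: A_def not_less_eq_eq)
  then show ?thesis by (rule has_sum_imp_sums)
qed

section \<open>Sums restricted to integers prime to p, or to multiples of p\<close>

definition Bp :: "nat \<Rightarrow> real \<Rightarrow> real" where
  "Bp p w = (\<Sum>n. if p dvd n then 0 else amu n * psi4 (real n * w))"

lemma amu_prime_mult:
  assumes "prime p"
  shows "amu (p * n) = (if p dvd n then 0 else - chi4 p * amu n)"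
proof (cases "p dvd n")
  case True
  then have "p^2 dvd p * n" by (auto simp: power2_eq_square)
  then have "moebius (p * n) = 0" using prime_gt_1_nat[OF assms] by (intro moebius_not_squarefree[of p])
  then show ?thesis using True by (simp add: amu_def)
next
  case False
  then show ?thesis by (simp add: amu_def moebius_prime_mult[OF assms False] chi4_mult)
qed

lemma Bp_sums:
  assumes w: "w > 0"
  shows "(\<lambda>n. if p dvd n then 0 else amu n * psi4 (real n * w)) sums Bp p w"
    and "\<bar>Bp p w\<bar> \<le> 1 / (exp w - 1)"
proof -
  have sn: "summable (\<lambda>n. norm (if p dvd n then 0 else amu n * psi4 (real n * w)))"
    by (rule summable_comparison_test'[OF summable_amu_psi4[OF w]]) auto
  then show "(\<lambda>n. if p dvd n then 0 else amu n * psi4 (real n * w)) sums Bp p w"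
    unfolding Bp_def by (rule summable_sums[OF summable_norm_cancel])
  have geo: "(\<lambda>n. exp (- w) ^ n) sums (1 / (1 - exp (- w)))" using w by (intro geometric_sums) simp
  have geo': "(\<lambda>n. exp (- w) ^ Suc n) sums (1 / (1 - exp (- w)) - 1)"
    using geo by (subst sums_Suc_iff) simp
  let ?t = "\<lambda>n. norm (if p dvd n then 0 else amu n * psi4 (real n * w))"
  have "\<bar>Bp p w\<bar> \<le> suminf ?t"
    unfolding Bp_def using summable_norm[OF sn] by simp
  also have "\<dots> = suminf (\<lambda>n. ?t (Suc n))" using suminf_split_head[OF sn] by simp
  also have "\<dots> \<le> suminf (\<lambda>n. exp (- w) ^ Suc n)"
  proof (rule suminf_le)
    fix n
    have "\<bar>amu (Suc n)\<bar> * psi4 (real (Suc n) * w) \<le> 1 * exp (- (real (Suc n) * w))"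
      using psi4_bounds[of "real (Suc n) * w"] by (intro mult_mono abs_amu_le) auto
    also have "\<dots> = exp (- w) ^ Suc n" by (simp only: mult_1 flip: exp_of_nat_mult) simp
    finally have *: "\<bar>amu (Suc n)\<bar> * psi4 (real (Suc n) * w) \<le> exp (- w) ^ Suc n" .
    have "\<bar>psi4 (real (Suc n) * w)\<bar> = psi4 (real (Suc n) * w)" using psi4_bounds(1)[of "real (Suc n) * w"] by simp
    then show "?t (Suc n) \<le> exp (- w) ^ Suc n" using *
      by (cases "p dvd Suc n") (simp_all add: abs_mult del: of_nat_Suc power_Suc)
  qed (use summable_Suc_iff[THEN iffD2, OF sn] sums_summable[OF geo'] in auto)
  also have "\<dots> = 1 / (1 - exp (- w)) - 1" using geo' by (simp add: sums_iff)
  also have "\<dots> = 1 / (exp w - 1)" using w by (simp add: exp_minus field_simps)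
  finally show "\<bar>Bp p w\<bar> \<le> 1 / (exp w - 1)" .
qed

lemma amu_psi4_multiples_sums:
  assumes p: "prime p" and w: "w > 0"
  shows "(\<lambda>n. if p dvd n then amu n * psi4 (real n * w) else 0) sums (- chi4 p * Bp p (real p * w))"
proof -
  have pw: "real p * w > 0" using prime_gt_0_nat[OF p] w by simp
  have "(\<lambda>n. - chi4 p * (if p dvd n then 0 else amu n * psi4 (real n * (real p * w)))) sums (- chi4 p * Bp p (real p * w))"
    by (rule sums_mult[OF Bp_sums(1)[OF pw]])
  moreover have "- chi4 p * (if p dvd n then 0 else amu n * psi4 (real n * (real p * w))) =
      (\<lambda>n. if p dvd n then amu n * psi4 (real n * w) else 0) (p * n)" for n
    using amu_prime_mult[OF p, of n] by (simp add: mult_ac)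
  ultimately have "(\<lambda>n. (\<lambda>n. if p dvd n then amu n * psi4 (real n * w) else 0) (p * n)) sums (- chi4 p * Bp p (real p * w))"
    by simp
  then show ?thesis
    by (subst (asm) sums_mono_reindex) (use prime_gt_0_nat[OF p] in \<open>auto simp: strict_mono_def\<close>)
qed

text \<open>The full sum e^(-w) splits into the integers prime to p and the multiples n = pm. In the
  latter only m prime to p survive, because \<mu>(p^2 m) = 0, and they reproduce \<open>Bp\<close>
  at scale pw.\<close>

lemma Bp_recursion:
  assumes p: "prime p" and w: "w > 0"
  shows "Bp p w = exp (- w) + chi4 p * Bp p (real p * w)"
proof -
  have "(\<lambda>n. (if p dvd n then 0 else amu n * psi4 (real n * w)) + (if p dvd n then amu n * psi4 (real n * w) else 0))
      sums (Bp p w + (- chi4 p * Bp p (real p * w)))"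
    by (rule sums_add[OF Bp_sums(1)[OF w] amu_psi4_multiples_sums[OF p w]])
  moreover have "(\<lambda>n. (if p dvd n then 0 else amu n * psi4 (real n * w)) + (if p dvd n then amu n * psi4 (real n * w) else 0))
     = (\<lambda>n. amu n * psi4 (real n * w))" by auto
  ultimately have "exp (- w) = Bp p w + (- chi4 p * Bp p (real p * w))"
    using sums_unique2[OF amu_psi4_sums[OF w]] by simp
  then show ?thesis by simp
qed

lemma has_integral_powr_0_1:
  fixes \<sigma> :: real
  assumes "\<sigma> > 0"
  shows "((\<lambda>t. t powr (\<sigma> - 1)) has_integral (1 / \<sigma>)) {0<..1}"
proof -
  have "((\<lambda>t. t powr (\<sigma> - 1)) has_integral (1 powr (\<sigma> - 1 + 1) / (\<sigma> - 1 + 1))) {0..1}"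
    by (rule has_integral_powr_from_0) (use assms in auto)
  then have I: "((\<lambda>t. t powr (\<sigma> - 1)) has_integral (1 / \<sigma>)) {0..1}" by simp
  show ?thesis
  proof (rule has_integral_spike_set_eq[THEN iffD1, OF _ _ I])
    show "negligible {x \<in> {0..1} - {0<..1}. x powr (\<sigma> - 1) \<noteq> 0}"
      by (rule negligible_subset[OF negligible_sing[of 0]]) auto
    show "negligible {x \<in> {0<..1} - {0..1}. x powr (\<sigma> - 1) \<noteq> 0}"
      by (rule negligible_subset[OF negligible_sing[of 0]]) auto
  qed
qed

lemma exp_minus_le_powr:
  fixes a :: real
  assumes a: "a \<ge> 0"
  obtains C where "C > 0" "\<And>u. u > 0 \<Longrightarrow> exp (- u) \<le> C * u powr (- a)"
proof -
  define n where "n = nat \<lceil>a\<rceil>"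
  have n: "a \<le> real n" unfolding n_def by linarith
  have "exp (- u) \<le> (1 + fact n) * u powr (- a)" if u: "u > 0" for u :: real
  proof -
    have "u powr a \<le> 1 + u ^ n"
    proof (cases "u \<le> 1")
      case True
      then have "u powr a \<le> 1 powr a" using u a by (intro powr_mono2) auto
      then show ?thesis using u by (simp add: add_increasing2)
    next
      case False
      then have "u powr a \<le> u powr real n" using n by (intro powr_mono) auto
      then show ?thesis using u by (simp add: powr_realpow)
    qed
    moreover have "u ^ n \<le> fact n * exp u"
    proof -
      have S: "(\<lambda>k. u ^ k /\<^sub>R fact k) sums exp u" by (rule exp_converges)
      have "sum (\<lambda>k. u ^ k /\<^sub>R fact k) {n} \<le> suminf (\<lambda>k. u ^ k /\<^sub>R fact k)"
        by (rule sum_le_suminf) (use u S in \<open>auto simp: sums_iff\<close>)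
      then have "u ^ n / fact n \<le> exp u" using S by (simp add: sums_iff divide_inverse mult.commute)
      then show ?thesis by (simp add: field_simps)
    qed
    moreover have "1 \<le> exp u" using u by simp
    ultimately have "u powr a \<le> (1 + fact n) * exp u" unfolding distrib_right mult_1 by linarith
    then have "exp (- u) * u powr a \<le> 1 + fact n"
      using u by (simp add: exp_minus field_simps)
    then show ?thesis using u by (simp add: powr_minus field_simps)
  qed
  then show ?thesis using that[of "1 + fact n"] by (simp add: add_pos_pos)
qed

text \<open>Iterating the recursion gives a sum of e^(-p^k v) with unimodular or zero coefficients.
  For a \<ge> 3/4 and p \<ge> 3 each step multiplies v^(-a) by at most 1/2, so the constant 2C
  reproduces itself as C + 2C/2. The remainder after k steps is at most 1/(p^k v) by the crude bound
  of \<open>Bp_sums\<close> and vanishes in the limit.\<close>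

lemma abs_Bp_le:
  assumes a: "a \<ge> 3/4" and C: "C > 0" "\<And>u. u > 0 \<Longrightarrow> exp (- u) \<le> C * u powr (- a)"
    and p: "prime p" "p \<ge> 3" and v: "v > 0"
  shows "\<bar>Bp p v\<bar> \<le> 2 * C * v powr (- a)"
proof -
  have p0: "real p > 0" using p by simp
  have half: "real p powr (- a) \<le> 1/2"
  proof -
    have "real p powr (- a) \<le> 3 powr (- a)" using p a by (intro powr_mono2') auto
    also have "\<dots> \<le> 3 powr (- (3/4))" using a by (intro powr_mono) auto
    also have "\<dots> \<le> 1/2"
    proof -
      \<comment> \<open>The threshold 3/4 on the exponent comes from 16 \<le> 27.\<close>
      have "(2::real) powr 4 \<le> 3 powr 3" by simp
      then have "((2::real) powr 4) powr (1/4) \<le> (3 powr 3) powr (1/4)" by (intro powr_mono2) auto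
      moreover have "((2::real) powr 4) powr (1/4) = 2" by (simp only: powr_powr) simp
      moreover have "((3::real) powr 3) powr (1/4) = 3 powr (3/4)" by (simp only: powr_powr) simp
      ultimately have "(2::real) \<le> 3 powr (3/4)" by simp
      then show ?thesis by (simp add: powr_minus_divide field_simps)
    qed
    finally show ?thesis .
  qed
  have step: "\<bar>Bp p v\<bar> \<le> 2 * C * v powr (- a) + 1 / (real p ^ k * v)" if "v > 0" for k v
    using that
  proof (induction k arbitrary: v)
    case 0
    have "v \<le> exp v - 1" using exp_ge_add_one_self[of v] by linarith
    then have "1 / (exp v - 1) \<le> 1 / v" using 0 by (intro divide_left_mono) auto
    then have "\<bar>Bp p v\<bar> \<le> 1 / v" using Bp_sums(2)[OF 0, of p] by linarith
    moreover have "0 \<le> 2 * C * v powr (- a)" using C by simp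
    ultimately show ?case by simp
  next
    case (Suc k)
    have pv: "real p * v > 0" using Suc.prems p0 by simp
    have "\<bar>Bp p v\<bar> \<le> \<bar>exp (- v)\<bar> + \<bar>chi4 p * Bp p (real p * v)\<bar>"
      unfolding Bp_recursion[OF p(1) Suc.prems] by (rule abs_triangle_ineq)
    also have "\<dots> \<le> exp (- v) + \<bar>Bp p (real p * v)\<bar>"
      using abs_chi4_le[of p] by (simp add: abs_mult mult_left_le_one_le)
    also have "\<dots> \<le> C * v powr (- a) + (2 * C * (real p * v) powr (- a) + 1 / (real p ^ k * (real p * v)))"
      by (intro add_mono C(2) Suc.prems Suc.IH pv)
    also have "2 * C * (real p * v) powr (- a) = (2 * C * v powr (- a)) * real p powr (- a)"
      using Suc.prems p0 by (simp add: powr_mult)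
    also have "\<dots> \<le> (2 * C * v powr (- a)) * (1/2)"
      using half C by (intro mult_left_mono) auto
    finally show ?case by (simp add: mult_ac)
  qed
  have "(\<lambda>k. 2 * C * v powr (- a) + 1 / v * (1 / real p) ^ k) \<longlonglongrightarrow> 2 * C * v powr (- a) + 1 / v * 0"
    using p by (intro tendsto_intros LIMSEQ_realpow_zero) auto
  then have "(\<lambda>k. 2 * C * v powr (- a) + 1 / (real p ^ k * v)) \<longlonglongrightarrow> 2 * C * v powr (- a)"
    by (simp add: power_divide mult_ac)
  then show ?thesis
    by (rule LIMSEQ_le_const) (use step[OF v] in auto)
qed

section \<open>The test function attached to a zero\<close>

locale L4_zero =
  fixes \<rho> :: complex
  assumes Re_rho: "Re \<rho> \<ge> 1/2" and L4_rho: "L4 \<rho> = 0"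
begin

abbreviation "\<sigma> \<equiv> Re \<rho>"

definition kern :: "real \<Rightarrow> complex" where
  "kern t = of_real t powr (\<rho> - 1)"

lemma norm_kern: "t > 0 \<Longrightarrow> norm (kern t) = t powr (\<sigma> - 1)"
  by (simp add: kern_def norm_powr_real_powr)

lemma kern_mult: "t > 0 \<Longrightarrow> y > 0 \<Longrightarrow> kern (y * t) = kern y * kern t"
  by (simp add: kern_def powr_times_real)

lemma sigma_pos: "\<sigma> > 0" and sigma_half: "\<sigma> \<ge> 1/2" using Re_rho by auto

text \<open>After scaling, this is y^(-\<rho>) times a multiple of the Mellin transform at \<rho>,
  which is Gamma(\<rho>) L(\<rho>) up to scaling and hence 0.\<close>

lemma kern_psi4_integral:
  assumes y: "y > 0"
  shows "(\<lambda>t. kern t * of_real (psi4 (y * t))) absolutely_integrable_on {0<..}"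
    and "integral {0<..} (\<lambda>t. kern t * of_real (psi4 (y * t))) = 0"
proof -
  let ?f = "\<lambda>t. kern t * of_real (psi4 t)"
  have m: "?f \<in> borel_measurable borel"
    unfolding kern_def psi4_def by measurable
  have f: "?f absolutely_integrable_on {0<..}" "integral {0<..} ?f = 0"
    using Mellin_psi4[OF sigma_pos] L4_rho by (auto simp: kern_def)
  note A = absolutely_integrable_scale_Ioi[OF y m f(1)]
  have k0: "kern y \<noteq> 0" using y by (simp add: kern_def)
  have eq: "kern t * of_real (psi4 (y * t)) = (1 / kern y) * ?f (y * t)" if "t \<in> {0<..}" for t
    using that y k0 by (simp add: kern_mult)
  have "(\<lambda>t. (1 / kern y) * ?f (y * t)) absolutely_integrable_on {0<..}"
    by (rule set_integrable_mult_right) (rule A(1))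
  then show "(\<lambda>t. kern t * of_real (psi4 (y * t))) absolutely_integrable_on {0<..}"
    by (subst set_integrable_cong[OF refl refl eq])
  have "integral {0<..} (\<lambda>t. kern t * of_real (psi4 (y * t))) = integral {0<..} (\<lambda>t. (1 / kern y) * ?f (y * t))"
    by (rule Henstock_Kurzweil_Integration.integral_cong) (rule eq)
  also have "\<dots> = (1 / kern y) * integral {0<..} (\<lambda>t. ?f (y * t))"
    by (rule integral_mult_right)
  also have "\<dots> = 0" unfolding A(2) f(2) by simp
  finally show "integral {0<..} (\<lambda>t. kern t * of_real (psi4 (y * t))) = 0" .
qed

lemma integral_Ioi_split:
  fixes f :: "real \<Rightarrow> complex"
  assumes "f absolutely_integrable_on {0<..}"
  shows "f absolutely_integrable_on {0<..1}" "f absolutely_integrable_on {1..}"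
    "integral {0<..} f = integral {0<..1} f + integral {1..} f"
proof -
  show a: "f absolutely_integrable_on {0<..1}" and b: "f absolutely_integrable_on {1..}"
    by (auto intro: set_integrable_subset[OF assms])
  have e: "{0<..} = {0<..1} \<union> {1::real..}" by auto
  have "{0<..1} \<inter> {1..} = {1::real}" by auto
  then have "negligible ({0<..1} \<inter> {1::real..})" by simp
  then show "integral {0<..} f = integral {0<..1} f + integral {1..} f"
    unfolding e using a b by (intro integral_Un set_lebesgue_integral_eq_integral(1))
qed

definition Th :: "real \<Rightarrow> complex" where
  "Th y = integral {1..} (\<lambda>t. kern t * of_real (psi4 (y * t)))"

text \<open>The definition of \<open>Th\<close> gives its decay at infinity, this representation its boundedness near 0.\<close>

lemma Th_alt:
  assumes "y > 0"
  shows "Th y = - integral {0<..1} (\<lambda>t. kern t * of_real (psi4 (y * t)))"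
  using integral_Ioi_split(3)[OF kern_psi4_integral(1)[OF assms]] kern_psi4_integral(2)[OF assms]
  unfolding Th_def by (simp add: add_eq_0_iff)

text \<open>A decreasing function with values in [0,1] whose decrements dominate the increments of
  \<open>Th\<close>. It bounds the total variation of \<open>Th\<close> by a telescoping
  sum.\<close>

definition V :: "real \<Rightarrow> real" where
  "V y = integral {0<..1} (\<lambda>t. t powr (\<sigma> - 1) * psi4 (y * t))"

lemma psi4_antimono:
  assumes "0 \<le> a" "a \<le> b"
  shows "psi4 b \<le> psi4 a"
proof -
  have "exp a + exp (- a) \<le> exp b + exp (- b)"
    using cosh_real_nonneg_le_iff[of a b] assms by (simp add: cosh_def)
  then show ?thesis unfolding psi4_def
    by (intro divide_left_mono mult_pos_pos add_pos_pos) auto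
qed

lemma V_integrable:
  assumes "y \<ge> 0"
  shows "(\<lambda>t. t powr (\<sigma> - 1) * psi4 (y * t)) integrable_on {0<..1}"
proof -
  have "(\<lambda>t. t powr (\<sigma> - 1)) absolutely_integrable_on {0<..1}"
    by (rule nonnegative_absolutely_integrable_1) (use has_integral_powr_0_1[OF sigma_pos] in auto)
  then have "(\<lambda>t. t powr (\<sigma> - 1) * psi4 (y * t)) absolutely_integrable_on {0<..1}"
  proof (rule set_integrable_bound)
    have "(\<lambda>t. indicator {0<..1} t *\<^sub>R (t powr (\<sigma> - 1) * psi4 (y * t))) \<in> borel_measurable borel"
      unfolding psi4_def by measurable
    then have "(\<lambda>t. indicator {0<..1} t *\<^sub>R (t powr (\<sigma> - 1) * psi4 (y * t))) \<in> borel_measurable lborel"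
      by simp
    then show "set_borel_measurable lebesgue {0<..1} (\<lambda>t. t powr (\<sigma> - 1) * psi4 (y * t))"
      unfolding set_borel_measurable_def by (rule measurable_completion)
    show "AE t in lebesgue. t \<in> {0<..1} \<longrightarrow> norm (t powr (\<sigma> - 1) * psi4 (y * t)) \<le> norm (t powr (\<sigma> - 1))"
    proof (rule AE_I2, rule impI)
      fix t :: real assume t: "t \<in> {0<..1}"
      have "0 < psi4 (y * t)" "psi4 (y * t) \<le> 1/2"
        using psi4_bounds(1)[of "y * t"] psi4_bounds(3)[of "y * t"] assms t by auto
      then show "norm (t powr (\<sigma> - 1) * psi4 (y * t)) \<le> norm (t powr (\<sigma> - 1))"
        by (simp add: abs_mult mult_left_le)
    qed
  qed
  then show ?thesis by (rule set_lebesgue_integral_eq_integral(1))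
qed

lemma V_bounds:
  assumes "y \<ge> 0"
  shows "0 \<le> V y" "V y \<le> 1"
proof -
  show "0 \<le> V y" unfolding V_def
    by (rule integral_nonneg[OF V_integrable[OF assms]]) (use psi4_bounds(1) in \<open>auto intro!: mult_nonneg_nonneg less_imp_le\<close>)
  have I: "((\<lambda>t. t powr (\<sigma> - 1) * (1/2)) has_integral (1 / \<sigma> * (1/2))) {0<..1}"
    by (rule has_integral_mult_left[OF has_integral_powr_0_1[OF sigma_pos]])
  have "V y \<le> integral {0<..1} (\<lambda>t. t powr (\<sigma> - 1) * (1/2))" unfolding V_def
  proof (rule integral_le[OF V_integrable[OF assms]])
    show "(\<lambda>t. t powr (\<sigma> - 1) * (1/2)) integrable_on {0<..1}" using I by blast
    show "t powr (\<sigma> - 1) * psi4 (y * t) \<le> t powr (\<sigma> - 1) * (1/2)" if "t \<in> {0<..1}" for t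
      using that assms by (intro mult_left_mono psi4_bounds(3)) auto
  qed
  also have "\<dots> = 1 / \<sigma> * (1/2)" by (rule integral_unique[OF I])
  also have "\<dots> \<le> 1" using sigma_half by (simp add: field_simps)
  finally show "V y \<le> 1" .
qed

text \<open>In the representation over (0,1] the integrand varies with y only through the decreasing
  \<open>psi4\<close>, so taking absolute values inside loses no sign: the difference of the two
  majorants remains.\<close>

lemma norm_Th_diff_le:
  assumes "0 < a" "a \<le> b"
  shows "norm (Th a - Th b) \<le> V a - V b"
proof -
  have b: "b > 0" using assms by simp
  have ia: "(\<lambda>t. kern t * of_real (psi4 (a * t))) integrable_on {0<..1}"
    using integral_Ioi_split(1)[OF kern_psi4_integral(1)[OF assms(1)]] by (rule set_lebesgue_integral_eq_integral(1))
  have ib: "(\<lambda>t. kern t * of_real (psi4 (b * t))) integrable_on {0<..1}"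
    using integral_Ioi_split(1)[OF kern_psi4_integral(1)[OF b]] by (rule set_lebesgue_integral_eq_integral(1))
  have va: "(\<lambda>t. t powr (\<sigma> - 1) * psi4 (a * t)) integrable_on {0<..1}" using V_integrable assms by simp
  have vb: "(\<lambda>t. t powr (\<sigma> - 1) * psi4 (b * t)) integrable_on {0<..1}" using V_integrable b by simp
  have "Th a - Th b = - integral {0<..1} (\<lambda>t. kern t * of_real (psi4 (a * t)) - kern t * of_real (psi4 (b * t)))"
    unfolding Th_alt[OF assms(1)] Th_alt[OF b] Henstock_Kurzweil_Integration.integral_diff[OF ia ib] by simp
  then have "norm (Th a - Th b) = norm (integral {0<..1} (\<lambda>t. kern t * of_real (psi4 (a * t)) - kern t * of_real (psi4 (b * t))))"
    by (simp only: norm_minus_cancel)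
  also have "\<dots> \<le> integral {0<..1} (\<lambda>t. t powr (\<sigma> - 1) * psi4 (a * t) - t powr (\<sigma> - 1) * psi4 (b * t))"
  proof (rule integral_norm_bound_integral[OF integrable_diff[OF ia ib] integrable_diff[OF va vb]])
    fix t :: real assume t: "t \<in> {0<..1}"
    have le: "psi4 (b * t) \<le> psi4 (a * t)" using t assms by (intro psi4_antimono mult_right_mono) auto
    have "norm (kern t * of_real (psi4 (a * t)) - kern t * of_real (psi4 (b * t))) = norm (kern t) * \<bar>psi4 (a * t) - psi4 (b * t)\<bar>"
      by (simp only: right_diff_distrib[symmetric] of_real_diff[symmetric] norm_mult norm_of_real)
    also have "\<dots> = t powr (\<sigma> - 1) * (psi4 (a * t) - psi4 (b * t))" using t le by (simp add: norm_kern)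
    finally show "norm (kern t * of_real (psi4 (a * t)) - kern t * of_real (psi4 (b * t)))
        \<le> t powr (\<sigma> - 1) * psi4 (a * t) - t powr (\<sigma> - 1) * psi4 (b * t)" by (simp add: right_diff_distrib)
  qed
  also have "\<dots> = V a - V b" unfolding V_def by (rule Henstock_Kurzweil_Integration.integral_diff[OF va vb])
  finally show ?thesis .
qed

lemma norm_Th_le_1:
  assumes "y > 0"
  shows "norm (Th y) \<le> 1"
proof -
  have i: "(\<lambda>t. kern t * of_real (psi4 (y * t))) integrable_on {0<..1}"
    using integral_Ioi_split(1)[OF kern_psi4_integral(1)[OF assms]] by (rule set_lebesgue_integral_eq_integral(1))
  have "norm (Th y) \<le> V y"
    unfolding Th_alt[OF assms] norm_minus_cancel V_def
  proof (rule integral_norm_bound_integral[OF i V_integrable])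
    show "norm (kern t * of_real (psi4 (y * t))) \<le> t powr (\<sigma> - 1) * psi4 (y * t)" if "t \<in> {0<..1}" for t
      using that psi4_bounds(1)[of "y * t"] by (simp add: norm_mult norm_kern)
  qed (use assms in simp)
  then show ?thesis using V_bounds[of y] assms by simp
qed

lemma powr_exp_integrable:
  assumes w: "w > 0"
  shows "(\<lambda>t. t powr (\<sigma> - 1) * exp (- (w * t))) absolutely_integrable_on {1..}"
proof -
  have "(\<lambda>t. kern t * of_real (exp (- (w * t)))) absolutely_integrable_on {1..}"
    unfolding kern_def by (rule integral_Ioi_split(2)[OF Gamma_integral_scaled(1)[OF sigma_pos w]])
  then have "(\<lambda>t. norm (kern t * of_real (exp (- (w * t))))) absolutely_integrable_on {1..}"
    using absolutely_integrable_norm by (simp add: o_def)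
  moreover have "norm (kern t * of_real (exp (- (w * t)))) = t powr (\<sigma> - 1) * exp (- (w * t))" if "t \<in> {1..}" for t
    using that by (simp add: norm_mult norm_kern)
  ultimately show ?thesis by (subst (asm) set_integrable_cong[OF refl refl]) auto
qed

definition K :: real where "K = integral {1..} (\<lambda>t. t powr (\<sigma> - 1) * exp (- (1 * t)))"

lemma K_nonneg: "K \<ge> 0"
  unfolding K_def by (rule integral_nonneg) (auto intro: set_lebesgue_integral_eq_integral(1) powr_exp_integrable[OF zero_less_one, simplified])

lemma norm_kern_psi4_le:
  assumes "y > 0" "t \<ge> 1"
  shows "norm (kern t * of_real (psi4 (y * t))) \<le> t powr (\<sigma> - 1) * exp (- (y * t))"
  using assms psi4_bounds(1)[of "y * t"] psi4_bounds(2)[of "y * t"]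
  by (auto simp: norm_mult norm_kern intro!: mult_left_mono)

lemma norm_Th_le_exp:
  assumes "y \<ge> 1"
  shows "norm (Th y) \<le> exp 1 * K * exp (- y)"
proof -
  have y: "y > 0" using assms by simp
  have ii: "(\<lambda>t. t powr (\<sigma> - 1) * exp (- (1 * t))) integrable_on {1..}"
    using powr_exp_integrable[of 1] by (intro set_lebesgue_integral_eq_integral(1)) simp
  have "norm (Th y) \<le> integral {1..} (\<lambda>t. exp (1 - y) * (t powr (\<sigma> - 1) * exp (- (1 * t))))"
    unfolding Th_def
  proof (rule integral_norm_bound_integral)
    show "(\<lambda>t. kern t * of_real (psi4 (y * t))) integrable_on {1..}"
      by (rule set_lebesgue_integral_eq_integral(1)[OF integral_Ioi_split(2)[OF kern_psi4_integral(1)[OF y]]])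
    show "(\<lambda>t. exp (1 - y) * (t powr (\<sigma> - 1) * exp (- (1 * t)))) integrable_on {1..}"
      by (rule integrable_on_mult_right[OF ii])
    fix t :: real assume t: "t \<in> {1..}"
    \<comment> \<open>This inequality separates the variables, yt \<ge> y + t - 1, and so extracts
      the factor e^(-y) from the integral.\<close>
    have "0 \<le> (y - 1) * (t - 1)" using t assms by simp
    then have "- (y * t) \<le> (1 - y) + - (1 * t)" by (simp add: algebra_simps)
    then have "exp (- (y * t)) \<le> exp (1 - y) * exp (- (1 * t))" by (simp flip: exp_add)
    then have "t powr (\<sigma> - 1) * exp (- (y * t)) \<le> t powr (\<sigma> - 1) * (exp (1 - y) * exp (- (1 * t)))"
      by (rule mult_left_mono) simp
    also have "\<dots> = exp (1 - y) * (t powr (\<sigma> - 1) * exp (- (1 * t)))" by (simp only: mult.left_commute)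
    finally have "t powr (\<sigma> - 1) * exp (- (y * t)) \<le> exp (1 - y) * (t powr (\<sigma> - 1) * exp (- (1 * t)))" .
    moreover have "norm (kern t * of_real (psi4 (y * t))) \<le> t powr (\<sigma> - 1) * exp (- (y * t))"
      by (rule norm_kern_psi4_le[OF y]) (use t in simp)
    ultimately show "norm (kern t * of_real (psi4 (y * t))) \<le> exp (1 - y) * (t powr (\<sigma> - 1) * exp (- (1 * t)))"
      by (rule order_trans[rotated])
  qed
  also have "\<dots> = exp (1 - y) * K" unfolding K_def by (rule integral_mult_right)
  also have "\<dots> = exp 1 * K * exp (- y)" by (simp add: exp_diff exp_minus divide_inverse)
  finally show ?thesis .
qed

section \<open>Arithmetic sums weighted by Theta\<close>

text \<open>Sum and integral are interchanged. General coefficients serve both the full sum and the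
  sum over multiples of p. The condition \<open>c 0 = 0\<close> removes the term with n = 0, whose
  integrand does not decay; for n \<ge> 1 the inequality nt \<ge> n + t - 1 provides a majorant that
  is geometric in n.\<close>

lemma Th_series:
  assumes x: "x > 0" and c: "\<And>n. \<bar>c n\<bar> \<le> 1" "c 0 = 0"
    and g: "\<And>t. t \<ge> 1 \<Longrightarrow> (\<lambda>n. c n * psi4 (real n * (t / x))) sums g t"
  shows "(\<lambda>t. kern t * of_real (g t)) absolutely_integrable_on {1..}"
    and "(\<lambda>n. of_real (c n) * Th (real n / x)) sums integral {1..} (\<lambda>t. kern t * of_real (g t))"
    and "summable (\<lambda>n. norm (of_real (c n) * Th (real n / x)))"
proof -
  define f where "f = (\<lambda>n t. complex_of_real (c n) * (kern t * of_real (psi4 (real n / x * t))))"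
  have fi: "f n absolutely_integrable_on {1..}" for n
  proof (cases "n = 0")
    case True
    then show ?thesis by (simp add: f_def c(2) set_integrable_def)
  next
    case False
    then have "real n / x > 0" using x by simp
    then show ?thesis unfolding f_def
      by (intro set_integrable_mult_right integral_Ioi_split(2) kern_psi4_integral(1))
  qed
  have fI: "integral {1..} (f n) = of_real (c n) * Th (real n / x)" for n
    unfolding f_def Th_def by (rule integral_mult_right)
  have nb: "norm (f n t) \<le> exp (1 / x) * exp (- (1 / x)) ^ n * (t powr (\<sigma> - 1) * exp (- (1 / x * t)))" if t: "t \<in> {1..}" for n t
  proof (cases "n = 0")
    case True
    then show ?thesis by (simp add: f_def c(2))
  next
    case False
    then have n: "real n \<ge> 1" by simp
    have y: "real n / x > 0" using x False by simp
    have "norm (f n t) \<le> 1 * (t powr (\<sigma> - 1) * exp (- (real n / x * t)))"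
      unfolding f_def norm_mult[of "complex_of_real (c n)"]
      using norm_kern_psi4_le[OF y, of t] t c(1)[of n] by (intro mult_mono) auto
    also have "exp (- (real n / x * t)) \<le> exp (1 / x) * exp (- (1 / x)) ^ n * exp (- (1 / x * t))"
    proof -
      have "0 \<le> (real n - 1) * (t - 1)" using t n by simp
      then have "real n + t - 1 \<le> real n * t" by (simp add: algebra_simps)
      then have "(real n + t - 1) / x \<le> real n * t / x" using x by (intro divide_right_mono) auto
      then have "- (real n / x * t) \<le> 1 / x + real n * (- (1 / x)) + (- (1 / x * t))"
        by (simp add: diff_divide_distrib add_divide_distrib)
      then show ?thesis by (simp only: exp_of_nat_mult[symmetric] exp_add[symmetric] exp_le_cancel_iff)
    qed
    then have "1 * (t powr (\<sigma> - 1) * exp (- (real n / x * t))) \<le> 1 * (t powr (\<sigma> - 1) * (exp (1 / x) * exp (- (1 / x)) ^ n * exp (- (1 / x * t))))"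
      by (intro mult_left_mono) auto
    finally show ?thesis by (simp only: mult_1 mult.left_commute)
  qed
  have geo: "summable (\<lambda>n. exp (- (1 / x)) ^ n)" using x by (intro summable_geometric) simp
  have sm: "summable (\<lambda>n. norm (f n t))" if t: "t \<in> {1..}" for t
  proof (rule summable_comparison_test')
    show "summable (\<lambda>n. exp (1 / x) * exp (- (1 / x)) ^ n * (t powr (\<sigma> - 1) * exp (- (1 / x * t))))"
      by (intro summable_mult2 summable_mult geo)
    show "norm (norm (f n t)) \<le> exp (1 / x) * exp (- (1 / x)) ^ n * (t powr (\<sigma> - 1) * exp (- (1 / x * t)))" for n
      using nb[OF t, of n] by simp
  qed
  have x1: "1 / x > 0" using x by simp
  have pei: "(\<lambda>t. t powr (\<sigma> - 1) * exp (- (1 / x * t))) integrable_on {1..}"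
    using powr_exp_integrable[OF x1] by (rule set_lebesgue_integral_eq_integral(1))
  have nint: "(\<lambda>t. norm (f n t)) integrable_on {1..}" for n
    using absolutely_integrable_norm[OF fi[of n]] by (auto simp: o_def intro: set_lebesgue_integral_eq_integral(1))
  have ns: "summable (\<lambda>n. integral {1..} (\<lambda>t. norm (f n t)))"
  proof (rule summable_comparison_test')
    show "summable (\<lambda>n. exp (1 / x) * exp (- (1 / x)) ^ n * integral {1..} (\<lambda>t. t powr (\<sigma> - 1) * exp (- (1 / x * t))))"
      by (intro summable_mult2 summable_mult geo)
    fix n
    have "integral {1..} (\<lambda>t. norm (f n t)) \<le> integral {1..} (\<lambda>t. exp (1 / x) * exp (- (1 / x)) ^ n * (t powr (\<sigma> - 1) * exp (- (1 / x * t))))"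
      by (intro integral_le nint integrable_on_mult_right pei nb)
    also have "\<dots> = exp (1 / x) * exp (- (1 / x)) ^ n * integral {1..} (\<lambda>t. t powr (\<sigma> - 1) * exp (- (1 / x * t)))"
      by (rule integral_mult_right)
    finally show "norm (integral {1..} (\<lambda>t. norm (f n t))) \<le> exp (1 / x) * exp (- (1 / x)) ^ n * integral {1..} (\<lambda>t. t powr (\<sigma> - 1) * exp (- (1 / x * t)))"
      using integral_nonneg[OF nint[of n]] by simp
  qed
  have su: "(\<lambda>n. f n t) sums (kern t * of_real (g t))" if t: "t \<in> {1..}" for t
  proof -
    have "(\<lambda>n. complex_of_real (c n * psi4 (real n * (t / x)))) sums of_real (g t)"
      using g[of t] t by (simp only: sums_of_real_iff atLeast_iff)
    then have "(\<lambda>n. kern t * complex_of_real (c n * psi4 (real n * (t / x)))) sums (kern t * of_real (g t))"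
      by (rule sums_mult)
    moreover have "kern t * complex_of_real (c n * psi4 (real n * (t / x))) = f n t" for n
      by (simp add: f_def)
    ultimately show ?thesis by simp
  qed
  note R = sums_set_lebesgue_integral[where f = f and S = "{1..}", OF fi sm ns su]
  show "(\<lambda>t. kern t * of_real (g t)) absolutely_integrable_on {1..}" by (rule R(1))
  show "(\<lambda>n. of_real (c n) * Th (real n / x)) sums integral {1..} (\<lambda>t. kern t * of_real (g t))"
    using R(2) by (simp only: fI)
  show "summable (\<lambda>n. norm (of_real (c n) * Th (real n / x)))"
  proof (rule summable_comparison_test'[OF ns])
    fix n
    have "norm (integral {1..} (f n)) \<le> integral {1..} (\<lambda>t. norm (f n t))"
      by (rule integral_norm_bound_integral[OF set_lebesgue_integral_eq_integral(1)[OF fi[of n]] nint[of n]]) simp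
    then show "norm (norm (of_real (c n) * Th (real n / x))) \<le> integral {1..} (\<lambda>t. norm (f n t))"
      by (simp only: fI real_norm_def abs_norm_cancel)
  qed
qed

text \<open>The missing piece of the Gamma integral is at most the integral of t^(\<sigma>-1) over
  (0,1], that is 1/\<sigma> \<le> 2.\<close>

lemma exp_integral_approx:
  assumes w: "w > 0"
  shows "(\<lambda>t. kern t * of_real (exp (- (w * t)))) absolutely_integrable_on {1..}"
    and "norm (integral {1..} (\<lambda>t. kern t * of_real (exp (- (w * t)))) - Gamma \<rho> * of_real w powr (- \<rho>)) \<le> 2"
proof -
  have ai: "(\<lambda>t. kern t * of_real (exp (- (w * t)))) absolutely_integrable_on {0<..}"
    unfolding kern_def by (rule Gamma_integral_scaled(1)[OF sigma_pos w])
  note S = integral_Ioi_split[OF ai]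
  show "(\<lambda>t. kern t * of_real (exp (- (w * t)))) absolutely_integrable_on {1..}" by (rule S(2))
  have E: "integral {0<..} (\<lambda>t. kern t * of_real (exp (- (w * t)))) = Gamma \<rho> * of_real w powr (- \<rho>)"
    unfolding kern_def by (rule Gamma_integral_scaled(2)[OF sigma_pos w])
  have "integral {1..} (\<lambda>t. kern t * of_real (exp (- (w * t)))) - Gamma \<rho> * of_real w powr (- \<rho>)
      = - integral {0<..1} (\<lambda>t. kern t * of_real (exp (- (w * t))))"
    unfolding E[symmetric] S(3) by (simp only: diff_add_eq_diff_diff_swap diff_self diff_0)
  then have "norm (integral {1..} (\<lambda>t. kern t * of_real (exp (- (w * t)))) - Gamma \<rho> * of_real w powr (- \<rho>))
      = norm (integral {0<..1} (\<lambda>t. kern t * of_real (exp (- (w * t)))))" by (simp only: norm_minus_cancel)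
  also have "\<dots> \<le> integral {0<..1} (\<lambda>t. t powr (\<sigma> - 1))"
  proof (rule integral_norm_bound_integral)
    show "(\<lambda>t. kern t * of_real (exp (- (w * t)))) integrable_on {0<..1}"
      by (rule set_lebesgue_integral_eq_integral(1)[OF S(1)])
    show "(\<lambda>t. t powr (\<sigma> - 1)) integrable_on {0<..1}" using has_integral_powr_0_1[OF sigma_pos] by blast
    show "norm (kern t * of_real (exp (- (w * t)))) \<le> t powr (\<sigma> - 1)" if "t \<in> {0<..1}" for t
      using that w by (simp add: norm_mult norm_kern mult_left_le)
  qed
  also have "\<dots> = 1 / \<sigma>" by (rule integral_unique[OF has_integral_powr_0_1[OF sigma_pos]])
  also have "\<dots> \<le> 2" using sigma_half by (simp add: field_simps)
  finally show "norm (integral {1..} (\<lambda>t. kern t * of_real (exp (- (w * t)))) - Gamma \<rho> * of_real w powr (- \<rho>)) \<le> 2" .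
qed

definition U1 :: "real \<Rightarrow> complex" where
  "U1 x = (\<Sum>n. of_real (amu n) * Th (real n / x))"

definition Up :: "nat \<Rightarrow> real \<Rightarrow> complex" where
  "Up p x = (\<Sum>n. of_real (if p dvd n then amu n else 0) * Th (real n / x))"

lemma U1_sums:
  assumes "x > 0"
  shows "(\<lambda>n. of_real (amu n) * Th (real n / x)) sums U1 x"
    and "norm (U1 x) \<le> norm (Gamma \<rho>) * x powr \<sigma> + 2"
proof -
  have g: "(\<lambda>n. amu n * psi4 (real n * (t / x))) sums exp (- (1 / x * t))" if "t \<ge> 1" for t
    using amu_psi4_sums[of "t / x"] that assms by simp
  note T = Th_series[of x amu, OF assms abs_amu_le amu_0 g]
  show "(\<lambda>n. of_real (amu n) * Th (real n / x)) sums U1 x"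
    unfolding U1_def using T(2) by (simp add: sums_iff)
  have "U1 x = integral {1..} (\<lambda>t. kern t * of_real (exp (- (1 / x * t))))"
    unfolding U1_def using T(2) by (simp add: sums_iff)
  moreover have "norm (integral {1..} (\<lambda>t. kern t * of_real (exp (- (1 / x * t)))) - Gamma \<rho> * of_real (1 / x) powr (- \<rho>)) \<le> 2"
    by (rule exp_integral_approx(2)) (use assms in simp)
  moreover have "norm (Gamma \<rho> * of_real (1 / x) powr (- \<rho>)) = norm (Gamma \<rho>) * x powr \<sigma>"
  proof -
    have "norm (complex_of_real (1 / x) powr (- \<rho>)) = (1 / x) powr (- \<sigma>)"
      using assms by (subst norm_powr_real_powr) auto
    also have "\<dots> = x powr \<sigma>" using assms by (simp add: powr_minus powr_divide)
    finally show ?thesis by (simp only: norm_mult)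
  qed
  ultimately show "norm (U1 x) \<le> norm (Gamma \<rho>) * x powr \<sigma> + 2"
    using norm_triangle_ineq2[of "U1 x" "Gamma \<rho> * of_real (1 / x) powr (- \<rho>)"] by simp
qed

text \<open>Up to sign the multiples of p contribute \<open>Bp p (w * t)\<close>. One step of the
  recursion isolates e^(-wt), which gives the Gamma integral at scale x/p, and leaves
  \<open>Bp\<close> at scale p^2/x. The decay exponent \<sigma> + 1/4 is just large enough to leave
  the convergent integral of t^(-5/4), equal to 4, whence 8C = 4 * 2C.\<close>

lemma Up_sums:
  assumes x: "x > 0" and p: "prime p" "p \<ge> 3"
    and C: "C > 0" "\<And>u. u > 0 \<Longrightarrow> exp (- u) \<le> C * u powr (- (\<sigma> + 1/4))"
  shows "(\<lambda>n. of_real (if p dvd n then amu n else 0) * Th (real n / x)) sums Up p x"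
    and "norm (Up p x) \<ge> norm (Gamma \<rho>) * (x / real p) powr \<sigma> - 2 - 8 * C * (x / (real p)^2) powr (\<sigma> + 1/4)"
proof -
  define w where "w = real p / x"
  have p0: "real p > 0" using p by simp
  have w: "w > 0" using x p0 by (simp add: w_def)
  have g: "(\<lambda>n. (if p dvd n then amu n else 0) * psi4 (real n * (t / x))) sums (- chi4 p * Bp p (w * t))" if "t \<ge> 1" for t
  proof -
    have "(\<lambda>n. if p dvd n then amu n * psi4 (real n * (t / x)) else 0) sums (- chi4 p * Bp p (real p * (t / x)))"
      by (rule amu_psi4_multiples_sums[OF p(1)]) (use that x in simp)
    moreover have "(\<lambda>n. if p dvd n then amu n * psi4 (real n * (t / x)) else 0) = (\<lambda>n. (if p dvd n then amu n else 0) * psi4 (real n * (t / x)))"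
      by (rule ext) simp
    ultimately show ?thesis by (simp add: w_def)
  qed
  have c: "\<bar>if p dvd n then amu n else 0\<bar> \<le> 1" "(if p dvd 0 then amu 0 else 0) = 0" for n
    using abs_amu_le[of n] by auto
  note T = Th_series[of x "\<lambda>n. if p dvd n then amu n else 0", OF x c g]
  show "(\<lambda>n. of_real (if p dvd n then amu n else 0) * Th (real n / x)) sums Up p x"
    unfolding Up_def using T(2) by (simp add: sums_iff)
  define I where "I = integral {1..} (\<lambda>t. kern t * of_real (- chi4 p * Bp p (w * t)))"
  have UI: "Up p x = I" unfolding Up_def I_def using T(2) by (simp add: sums_iff)
  define E where "E = integral {1..} (\<lambda>t. kern t * of_real (exp (- (w * t))))"
  have Ei: "(\<lambda>t. kern t * of_real (exp (- (w * t)))) integrable_on {1..}"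
    by (rule set_lebesgue_integral_eq_integral(1)[OF exp_integral_approx(1)[OF w]])
  have Ii: "(\<lambda>t. kern t * of_real (- chi4 p * Bp p (w * t))) integrable_on {1..}"
    by (rule set_lebesgue_integral_eq_integral(1)[OF T(1)])
  have odd: "odd p" using p prime_odd_nat[of p] by auto
  have chi1: "\<bar>chi4 p\<bar> = 1" by (rule abs_chi4_odd[OF odd])
  have cEi: "(\<lambda>t. of_real (- chi4 p) * (kern t * of_real (exp (- (w * t))))) integrable_on {1..}"
    by (rule integrable_on_mult_right[OF Ei])
  have "I - of_real (- chi4 p) * E = integral {1..} (\<lambda>t. kern t * of_real (- chi4 p * Bp p (w * t)) - of_real (- chi4 p) * (kern t * of_real (exp (- (w * t)))))"
    unfolding Henstock_Kurzweil_Integration.integral_diff[OF Ii cEi] I_def E_def by (simp only: integral_mult_right)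
  then have "norm (I - of_real (- chi4 p) * E) = norm (integral {1..} (\<lambda>t. kern t * of_real (- chi4 p * Bp p (w * t)) - of_real (- chi4 p) * (kern t * of_real (exp (- (w * t))))))"
    by (simp only:)
  also have "\<dots> \<le> integral {1..} (\<lambda>t. 2 * C * (real p * w) powr (- (\<sigma> + 1/4)) * t powr (- (5/4)))"
  proof (rule integral_norm_bound_integral[OF integrable_diff[OF Ii cEi]])
    show "(\<lambda>t. 2 * C * (real p * w) powr (- (\<sigma> + 1/4)) * t powr (- (5/4))) integrable_on {1..}"
      using has_integral_powr_to_inf[of "- (5/4)" 1] by (intro integrable_on_mult_right) auto
    fix t :: real assume t: "t \<in> {1..}"
    have t0: "t > 0" using t by simp
    have wt: "w * t > 0" using w t0 by simp
    have pwt: "real p * (w * t) > 0" using p0 wt by simp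
    have "kern t * of_real (- chi4 p * Bp p (w * t)) - of_real (- chi4 p) * (kern t * of_real (exp (- (w * t))))
        = kern t * of_real (- chi4 p * (Bp p (w * t) - exp (- (w * t))))" by (simp add: algebra_simps)
    then have "norm (kern t * of_real (- chi4 p * Bp p (w * t)) - of_real (- chi4 p) * (kern t * of_real (exp (- (w * t)))))
        = t powr (\<sigma> - 1) * \<bar>Bp p (w * t) - exp (- (w * t))\<bar>"
      using t0 chi1 by (simp only: norm_mult norm_of_real norm_kern abs_mult abs_minus_cancel mult_1)
    also have "\<bar>Bp p (w * t) - exp (- (w * t))\<bar> = \<bar>Bp p (real p * (w * t))\<bar>"
      using chi1 unfolding Bp_recursion[OF p(1) wt] by (simp add: abs_mult)
    also have "\<dots> \<le> 2 * C * (real p * (w * t)) powr (- (\<sigma> + 1/4))"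
      by (rule abs_Bp_le[OF _ C p pwt]) (use sigma_half in simp)
    also have "(real p * (w * t)) powr (- (\<sigma> + 1/4)) = (real p * w) powr (- (\<sigma> + 1/4)) * t powr (- (\<sigma> + 1/4))"
      using p0 w t0 by (simp add: powr_mult)
    finally have "norm (kern t * of_real (- chi4 p * Bp p (w * t)) - of_real (- chi4 p) * (kern t * of_real (exp (- (w * t)))))
        \<le> t powr (\<sigma> - 1) * (2 * C * ((real p * w) powr (- (\<sigma> + 1/4)) * t powr (- (\<sigma> + 1/4))))"
      by (simp add: mult_left_mono)
    also have "\<dots> = 2 * C * (real p * w) powr (- (\<sigma> + 1/4)) * (t powr (\<sigma> - 1) * t powr (- (\<sigma> + 1/4)))" by (simp only: mult_ac)
    also have "t powr (\<sigma> - 1) * t powr (- (\<sigma> + 1/4)) = t powr (- (5/4))" by (simp flip: powr_add)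
    finally show "norm (kern t * of_real (- chi4 p * Bp p (w * t)) - of_real (- chi4 p) * (kern t * of_real (exp (- (w * t)))))
        \<le> 2 * C * (real p * w) powr (- (\<sigma> + 1/4)) * t powr (- (5/4))" .
  qed
  also have "\<dots> = 2 * C * (real p * w) powr (- (\<sigma> + 1/4)) * 4"
    using integral_unique[OF has_integral_powr_to_inf[of "- (5/4)" 1]] by simp
  also have "(real p * w) powr (- (\<sigma> + 1/4)) = (x / (real p)^2) powr (\<sigma> + 1/4)"
  proof -
    have "x / (real p)^2 = inverse (real p * w)" using x p0 by (simp add: w_def field_simps power2_eq_square)
    then show ?thesis by (simp only: powr_minus inverse_powr)
  qed
  finally have D: "norm (I - of_real (- chi4 p) * E) \<le> 8 * C * (x / (real p)^2) powr (\<sigma> + 1/4)" by simp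
  have N: "norm (of_real (- chi4 p) * E) = norm E" using chi1 by (simp add: norm_mult)
  have "norm (Gamma \<rho> * of_real w powr (- \<rho>)) = norm (Gamma \<rho>) * (x / real p) powr \<sigma>"
  proof -
    have "norm (complex_of_real w powr (- \<rho>)) = w powr (- \<sigma>)"
      using w by (subst norm_powr_real_powr) auto
    also have "\<dots> = (x / real p) powr \<sigma>" unfolding w_def using x p0 by (simp add: powr_minus powr_divide)
    finally show ?thesis by (simp only: norm_mult)
  qed
  then have "norm E \<ge> norm (Gamma \<rho>) * (x / real p) powr \<sigma> - 2"
    using exp_integral_approx(2)[OF w] norm_triangle_ineq2[of "Gamma \<rho> * of_real w powr (- \<rho>)" E]
    unfolding E_def[symmetric] by (simp add: norm_minus_commute)
  then show "norm (Up p x) \<ge> norm (Gamma \<rho>) * (x / real p) powr \<sigma> - 2 - 8 * C * (x / (real p)^2) powr (\<sigma> + 1/4)"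
    using D N norm_triangle_ineq2[of "of_real (- chi4 p) * E" I] unfolding UI by (simp add: norm_minus_commute)
qed

end

section \<open>Trigonometric polynomials at Farey fractions\<close>

definition ee :: "real \<Rightarrow> complex" where
  "ee t = cis (2 * pi * t)"

lemma ee_add: "ee (s + t) = ee s * ee t"
  by (simp add: ee_def cis_mult distrib_left)

lemma norm_ee [simp]: "norm (ee t) = 1"
  by (simp add: ee_def)

lemma ee_of_nat_mult: "ee (real n * t) = ee t ^ n"
  by (simp add: ee_def Complex.DeMoivre mult_ac)

lemma ee_of_int [simp]: "ee (of_int m) = 1"
  by (metis cis_multiple_2pi ee_def Ints_of_int mult.assoc mult.commute)

lemma ee_frac: "ee (frac u) = ee u"
proof -
  have "u = frac u + of_int \<lfloor>u\<rfloor>" by (simp add: frac_def)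
  then have "ee u = ee (frac u) * ee (of_int \<lfloor>u\<rfloor>)" by (metis ee_add)
  then show ?thesis by simp
qed

lemma sin_ge_quarter:
  assumes "0 \<le> y" "y \<le> pi / 2"
  shows "sin y \<ge> y / 4"
proof (cases "y \<le> pi / 3")
  case True
  have "(\<lambda>x. sin x - x / 4) 0 \<le> (\<lambda>x. sin x - x / 4) y"
  proof (rule DERIV_nonneg_imp_nondecreasing[OF assms(1)])
    fix x assume x: "0 \<le> x" "x \<le> y"
    have "cos (pi / 3) \<le> cos x" using x True by (intro cos_monotone_0_pi_le) auto
    then show "\<exists>d. ((\<lambda>x. sin x - x / 4) has_real_derivative d) (at x) \<and> 0 \<le> d"
      by (intro exI[of _ "cos x - 1/4"]) (auto intro!: derivative_eq_intros simp: cos_60)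
  qed
  then show ?thesis by simp
next
  case False
  have "sin (pi / 3) \<le> sin y" using False assms by (intro sin_monotone_2pi_le) auto
  moreover have "sin (pi/3) = sqrt 3 / 2" by (rule sin_60)
  moreover have "sqrt 3 \<ge> 1" by simp
  moreover have "y / 4 \<le> 1 / 2" using assms pi_less_4 by simp
  ultimately show ?thesis by linarith
qed

text \<open>The norm equals 2 sin(pi f), which is bounded below by the distance from f to the
  nearest integer.\<close>

lemma norm_1_minus_ee_ge:
  assumes "0 \<le> f" "f < 1"
  shows "norm (1 - ee f) \<ge> min f (1 - f)"
proof -
  have e: "(norm (1 - ee f))^2 = (2 * sin (pi * f))^2"
  proof -
    have "(norm (1 - ee f))^2 = (1 - cos (2 * pi * f))^2 + (sin (2 * pi * f))^2"
      by (simp add: ee_def cmod_power2)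
    also have "\<dots> = 2 - 2 * cos (2 * (pi * f))"
      using sin_cos_squared_add[of "2 * (pi * f)"] by (simp add: power2_eq_square algebra_simps)
    also have "\<dots> = (2 * sin (pi * f))^2" unfolding cos_double_sin by (simp add: power_mult_distrib)
    finally show ?thesis .
  qed
  have s0: "sin (pi * f) \<ge> 0" using assms by (intro sin_ge_zero) auto
  have ne: "norm (1 - ee f) = 2 * sin (pi * f)"
    using power2_eq_imp_eq[OF e] s0 by simp
  have half: "sin (pi * g) \<ge> g / 2" if g: "0 \<le> g" "g \<le> 1/2" for g
  proof -
    have "2 * g \<le> pi * g" using g pi_ge_two by (intro mult_right_mono) auto
    then have "g / 2 \<le> pi * g / 4" by simp
    also have "\<dots> \<le> sin (pi * g)" using g by (intro sin_ge_quarter) auto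
    finally show ?thesis .
  qed
  show ?thesis
  proof (cases "f \<le> 1/2")
    case True
    then show ?thesis using half[of f] assms by (simp add: ne)
  next
    case False
    have "sin (pi * f) = sin (pi * (1 - f))" by (simp add: right_diff_distrib)
    then show ?thesis using half[of "1 - f"] False assms by (simp add: ne)
  qed
qed

lemma harm_le_ln: "n \<ge> 1 \<Longrightarrow> harm n \<le> ln (real n) + (1::real)"
proof -
  assume "n \<ge> 1"
  then have "harm n - ln (of_nat n) \<le> harm 1 - ln (of_nat 1 :: real)" by (intro euler_mascheroni_sequence_decreasing) auto
  then show ?thesis by (simp add: harm_expand)
qed

text \<open>Points that are 1/N apart modulo 1 lie in different cells of length 1/N. In the k-th
  cell from either end of [0,1) the function is at most D N / k, and at most A in the two end cells.
  Summing yields harmonic sums, hence the logarithm.\<close>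

lemma sum_separated_le:
  fixes \<beta> :: "'i \<Rightarrow> real" and h :: "real \<Rightarrow> real"
  assumes fin: "finite I" and N: "N \<ge> 1"
    and sep: "\<And>i j m. i \<in> I \<Longrightarrow> j \<in> I \<Longrightarrow> i \<noteq> j \<Longrightarrow> \<bar>\<beta> i - \<beta> j - of_int m\<bar> \<ge> 1 / real N"
    and A: "\<And>u. h u \<le> A" and D: "\<And>u. h u * norm (1 - ee u) \<le> D" "D \<ge> 0" and A0: "A \<ge> 0"
  shows "(\<Sum>i\<in>I. h (\<beta> i + \<alpha>)) \<le> 2 * A + 2 * D * real N * (1 + ln (real N))"
proof -
  define j where "j = (\<lambda>i. nat \<lfloor>real N * frac (\<beta> i + \<alpha>)\<rfloor>)"
  define g where "g = (\<lambda>k::nat. if k = 0 then A else D * real N / real k)"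
  have N0: "real N > 0" using N by simp
  have fr: "real (j i) \<le> real N * frac (\<beta> i + \<alpha>)" "real N * frac (\<beta> i + \<alpha>) < real (j i) + 1" for i
    unfolding j_def using N0 by (auto simp: frac_ge_0)
  have jN: "j i < N" for i
  proof -
    have "real N * frac (\<beta> i + \<alpha>) < real N" using N0 by (simp add: frac_lt_1)
    then show ?thesis using fr(1)[of i] by linarith
  qed
  have inj: "inj_on j I"
  proof (rule inj_onI, rule ccontr)
    fix a b assume ab: "a \<in> I" "b \<in> I" "j a = j b" "a \<noteq> b"
    have "\<bar>real N * frac (\<beta> a + \<alpha>) - real N * frac (\<beta> b + \<alpha>)\<bar> < 1"
      using fr[of a] fr[of b] ab(3) by linarith
    then have "real N * \<bar>frac (\<beta> a + \<alpha>) - frac (\<beta> b + \<alpha>)\<bar> < 1"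
      using N0 by (simp add: abs_mult flip: right_diff_distrib)
    then have "\<bar>frac (\<beta> a + \<alpha>) - frac (\<beta> b + \<alpha>)\<bar> < 1 / real N" using N0 by (simp add: field_simps)
    moreover have "frac (\<beta> a + \<alpha>) - frac (\<beta> b + \<alpha>) = \<beta> a - \<beta> b - of_int (\<lfloor>\<beta> a + \<alpha>\<rfloor> - \<lfloor>\<beta> b + \<alpha>\<rfloor>)"
      by (simp add: frac_def)
    ultimately show False using sep[OF ab(1,2,4), of "\<lfloor>\<beta> a + \<alpha>\<rfloor> - \<lfloor>\<beta> b + \<alpha>\<rfloor>"] by simp
  qed
  have g0: "g k \<ge> 0" for k using A0 D(2) by (simp add: g_def)
  \<comment> \<open>The two summands measure the distance to 0 and to 1; adding them avoids
    recording which end is nearer.\<close>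
  have le: "h (\<beta> i + \<alpha>) \<le> g (j i) + g (N - 1 - j i)" for i
  proof (cases "j i = 0 \<or> j i = N - 1")
    case True
    then show ?thesis using A[of "\<beta> i + \<alpha>"] g0[of "j i"] g0[of "N - 1 - j i"] by (auto simp: g_def)
  next
    case False
    define f where "f = frac (\<beta> i + \<alpha>)"
    have f: "0 \<le> f" "f < 1" by (auto simp: f_def frac_lt_1)
    have k: "j i > 0" "N - 1 - j i > 0" using False jN[of i] by auto
    have m: "norm (1 - ee (\<beta> i + \<alpha>)) \<ge> min f (1 - f)"
      using norm_1_minus_ee_ge[OF f] by (simp add: f_def ee_frac)
    have f1: "f \<ge> real (j i) / real N" using fr(1)[of i] N0 by (simp add: f_def field_simps)
    have "real (N - 1 - j i) = real N - 1 - real (j i)" using k(2) by (simp add: of_nat_diff)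
    then have f2: "1 - f \<ge> real (N - 1 - j i) / real N" using fr(2)[of i] N0 by (simp add: f_def field_simps)
    have *: "h (\<beta> i + \<alpha>) \<le> D * real N / real k" if "k > 0" "norm (1 - ee (\<beta> i + \<alpha>)) \<ge> real k / real N" for k
    proof (cases "h (\<beta> i + \<alpha>) \<ge> 0")
      case True
      then have "h (\<beta> i + \<alpha>) * (real k / real N) \<le> h (\<beta> i + \<alpha>) * norm (1 - ee (\<beta> i + \<alpha>))"
        using that(2) by (intro mult_left_mono) auto
      also have "\<dots> \<le> D" by (rule D(1))
      finally show ?thesis using N0 that(1) by (simp add: field_simps)
    next
      case False
      moreover have "D * real N / real k \<ge> 0" using D(2) by simp
      ultimately show ?thesis by linarith
    qed
    show ?thesis
    proof (cases "f \<le> 1 - f")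
      case True
      then have "h (\<beta> i + \<alpha>) \<le> g (j i)" using *[OF k(1)] m f1 k by (simp add: g_def)
      then show ?thesis using g0[of "N - 1 - j i"] by linarith
    next
      case False
      then have "h (\<beta> i + \<alpha>) \<le> g (N - 1 - j i)" using *[OF k(2)] m f2 k by (simp add: g_def)
      then show ?thesis using g0[of "j i"] by linarith
    qed
  qed
  have "(\<Sum>i\<in>I. h (\<beta> i + \<alpha>)) \<le> (\<Sum>i\<in>I. g (j i) + g (N - 1 - j i))" by (intro sum_mono le)
  also have "\<dots> = (\<Sum>k\<in>j ` I. g k + g (N - 1 - k))" by (simp add: sum.reindex[OF inj])
  also have "\<dots> \<le> (\<Sum>k<N. g k + g (N - 1 - k))"
    using jN g0 by (intro sum_mono2) auto
  also have "\<dots> = 2 * (\<Sum>k<N. g k)"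
    using sum.nat_diff_reindex[of g N] by (simp add: sum.distrib)
  also have "(\<Sum>k<N. g k) = A + (\<Sum>k\<in>{1..<N}. D * real N / real k)"
  proof -
    have "{..<N} = insert 0 {1..<N}" using N by auto
    then show ?thesis by (simp add: g_def)
  qed
  also have "(\<Sum>k\<in>{1..<N}. D * real N / real k) \<le> (\<Sum>k\<in>{1..N}. D * real N / real k)"
    using D(2) by (intro sum_mono2) auto
  also have "\<dots> = D * real N * harm N" by (simp add: harm_def sum_distrib_left divide_inverse)
  also have "\<dots> \<le> D * real N * (1 + ln (real N))"
    using harm_le_ln[OF N] D(2) by (intro mult_left_mono) auto
  finally show ?thesis by (simp add: algebra_simps)
qed

text \<open>Abel summation: multiplying by 1 - z turns the sum into one over the increments of
  \<open>g\<close>, so only boundary values and total variation remain.\<close>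

lemma partial_summation:
  fixes g :: "nat \<Rightarrow> complex"
  assumes z: "norm z = 1"
  shows "norm ((1 - z) * (\<Sum>n=1..Suc R. g n * z ^ n)) \<le> norm (g 1) + (\<Sum>n=1..R. norm (g (Suc n) - g n)) + norm (g (Suc R))"
proof -
  have "(1 - z) * (\<Sum>n=1..Suc R. g n * z ^ n) = g 1 * z + (\<Sum>n=1..R. (g (Suc n) - g n) * z ^ Suc n) - g (Suc R) * z ^ Suc (Suc R)"
  proof (induction R)
    case 0
    show ?case by (simp add: algebra_simps)
  next
    case (Suc R)
    have S: "(\<Sum>n=1..Suc (Suc R). g n * z ^ n) = (\<Sum>n=1..Suc R. g n * z ^ n) + g (Suc (Suc R)) * z ^ Suc (Suc R)" by simp
    have T: "(\<Sum>n=1..Suc R. (g (Suc n) - g n) * z ^ Suc n) = (\<Sum>n=1..R. (g (Suc n) - g n) * z ^ Suc n) + (g (Suc (Suc R)) - g (Suc R)) * z ^ Suc (Suc R)" by simp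
    show ?case unfolding S T distrib_left Suc.IH by (simp add: algebra_simps)
  qed
  also have "norm \<dots> \<le> norm (g 1 * z) + norm (\<Sum>n=1..R. (g (Suc n) - g n) * z ^ Suc n) + norm (g (Suc R) * z ^ Suc (Suc R))"
    by (meson add_right_mono norm_triangle_ineq norm_triangle_ineq4 order_trans)
  also have "\<dots> \<le> norm (g 1) + (\<Sum>n=1..R. norm (g (Suc n) - g n)) + norm (g (Suc R))"
    by (intro add_mono order_trans[OF norm_sum] sum_mono) (auto simp: norm_mult norm_power z)
  finally show ?thesis .
qed

lemma integral_ee_int:
  "((\<lambda>\<alpha>. ee (of_int k * \<alpha>)) has_integral (if k = 0 then 1 else 0)) {0..1}"
proof (cases "k = 0")
  case True
  then show ?thesis using has_integral_const_real[of "1::complex" 0 1] by (simp add: ee_def)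
next
  case False
  let ?F = "\<lambda>\<alpha>. ee (of_int k * \<alpha>) / (2 * pi * of_int k * \<i>)"
  have "((\<lambda>\<alpha>. ee (of_int k * \<alpha>)) has_integral (?F 1 - ?F 0)) {0..1}"
  proof (rule fundamental_theorem_of_calculus)
    fix x :: real assume "x \<in> {0..1}"
    define c where "c = 2 * of_real pi * of_int k * \<i>"
    have c: "c \<noteq> 0" using False by (simp add: c_def)
    have e: "ee (of_int k * y) = exp (c * of_real y)" for y by (simp add: ee_def cis_conv_exp c_def mult_ac)
    have "((\<lambda>z. exp (c * z) / c) has_field_derivative exp (c * of_real x)) (at (of_real x))"
      using c by (auto intro!: derivative_eq_intros)
    then have "((\<lambda>y. exp (c * of_real y) / c) has_vector_derivative exp (c * of_real x)) (at x within {0..1})"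
      by (rule has_vector_derivative_real_field)
    then show "(?F has_vector_derivative ee (of_int k * x)) (at x within {0..1})"
      by (simp add: e c_def[symmetric])
  qed simp
  moreover have "?F 1 - ?F 0 = 0" using ee_of_int[of 0] by simp
  ultimately show ?thesis using False by simp
qed

definition trig :: "nat \<Rightarrow> (nat \<Rightarrow> complex) \<Rightarrow> real \<Rightarrow> complex" where
  "trig R b t = (\<Sum>n=1..R. b n * ee (real n * t))"

lemma fourier_transform_trig: "fourier_transform R f t = trig R f (- t)"
  unfolding fourier_transform_def trig_def X_def
  by (rule sum.cong) (simp_all add: ee_def cis_conv_exp mult_ac)

lemma continuous_on_trig: "continuous_on A (\<lambda>\<alpha>. trig R f (- \<alpha>))"
  and continuous_on_trig_shift: "continuous_on A (\<lambda>\<alpha>. trig R f (\<beta> + \<alpha>))"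
  unfolding trig_def ee_def by (intro continuous_intros)+

lemma trig_product_integral:
  "((\<lambda>\<alpha>. trig R f (- \<alpha>) * trig R b (\<beta> + \<alpha>)) has_integral (trig R (\<lambda>n. f n * b n) \<beta>)) {0..1}"
proof -
  have "((\<lambda>\<alpha>. \<Sum>n=1..R. \<Sum>m=1..R. (f n * b m * ee (real m * \<beta>)) * ee (of_int (int m - int n) * \<alpha>)) has_integral
      (\<Sum>n=1..R. \<Sum>m=1..R. (f n * b m * ee (real m * \<beta>)) * (if int m - int n = 0 then 1 else 0))) {0..1}"
    by (intro has_integral_sum has_integral_mult_right integral_ee_int) auto
  also have "(\<Sum>n=1..R. \<Sum>m=1..R. (f n * b m * ee (real m * \<beta>)) * (if int m - int n = 0 then 1 else 0))
     = (\<Sum>n=1..R. f n * b n * ee (real n * \<beta>))"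
    by (rule sum.cong) (simp_all add: if_distrib sum.delta cong: if_cong)
  also have "\<dots> = trig R (\<lambda>n. f n * b n) \<beta>" by (simp add: trig_def)
  also have "(\<lambda>\<alpha>. \<Sum>n=1..R. \<Sum>m=1..R. (f n * b m * ee (real m * \<beta>)) * ee (of_int (int m - int n) * \<alpha>)) =
     (\<lambda>\<alpha>. trig R f (- \<alpha>) * trig R b (\<beta> + \<alpha>))"
  proof
    fix \<alpha>
    have "ee (of_int (int m - int n) * \<alpha>) = ee (real n * (- \<alpha>)) * ee (real m * \<alpha>)" for n m :: nat
      unfolding ee_add[symmetric] by (simp add: algebra_simps)
    moreover have "ee (real m * (\<beta> + \<alpha>)) = ee (real m * \<beta>) * ee (real m * \<alpha>)" for m :: nat
      unfolding ee_add[symmetric] by (simp add: algebra_simps)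
    ultimately show "(\<Sum>n=1..R. \<Sum>m=1..R. (f n * b m * ee (real m * \<beta>)) * ee (of_int (int m - int n) * \<alpha>)) =
       trig R f (- \<alpha>) * trig R b (\<beta> + \<alpha>)"
      unfolding trig_def sum_product by (intro sum.cong refl) (simp add: mult_ac)
  qed
  finally show ?thesis .
qed

text \<open>Multiplying coefficients amounts to convolving on the circle. After the sum over the
  points is moved inside the integral, the L1 norm of one factor is paired with a bound for the
  summed kernel that is uniform in the shift.\<close>

lemma large_sieve_L1:
  fixes \<beta> :: "'i \<Rightarrow> real"
  assumes fin: "finite I" and B: "\<And>\<alpha>. (\<Sum>i\<in>I. norm (trig R b (\<beta> i + \<alpha>))) \<le> B"
  shows "(\<Sum>i\<in>I. norm (trig R (\<lambda>n. f n * b n) (\<beta> i))) \<le> B * integral {0..1} (\<lambda>\<alpha>. norm (trig R f (- \<alpha>)))"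
proof -
  have I1: "(\<lambda>\<alpha>. norm (trig R f (- \<alpha>)) * norm (trig R b (\<beta> i + \<alpha>))) integrable_on {0..1}" for i
    by (intro integrable_continuous_real continuous_intros continuous_on_trig continuous_on_trig_shift)
  have "(\<Sum>i\<in>I. norm (trig R (\<lambda>n. f n * b n) (\<beta> i))) \<le> (\<Sum>i\<in>I. integral {0..1} (\<lambda>\<alpha>. norm (trig R f (- \<alpha>)) * norm (trig R b (\<beta> i + \<alpha>))))"
  proof (rule sum_mono)
    fix i
    have "trig R (\<lambda>n. f n * b n) (\<beta> i) = integral {0..1} (\<lambda>\<alpha>. trig R f (- \<alpha>) * trig R b (\<beta> i + \<alpha>))"
      by (rule integral_unique[OF trig_product_integral, symmetric])
    also have "norm \<dots> \<le> integral {0..1} (\<lambda>\<alpha>. norm (trig R f (- \<alpha>)) * norm (trig R b (\<beta> i + \<alpha>)))"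
      by (rule integral_norm_bound_integral[OF has_integral_integrable[OF trig_product_integral] I1]) (simp add: norm_mult)
    finally show "norm (trig R (\<lambda>n. f n * b n) (\<beta> i)) \<le> integral {0..1} (\<lambda>\<alpha>. norm (trig R f (- \<alpha>)) * norm (trig R b (\<beta> i + \<alpha>)))" .
  qed
  also have "\<dots> = integral {0..1} (\<lambda>\<alpha>. \<Sum>i\<in>I. norm (trig R f (- \<alpha>)) * norm (trig R b (\<beta> i + \<alpha>)))"
    by (rule integral_sum[OF fin I1, symmetric])
  also have "\<dots> \<le> integral {0..1} (\<lambda>\<alpha>. B * norm (trig R f (- \<alpha>)))"
  proof (rule integral_le)
    show "(\<lambda>\<alpha>. \<Sum>i\<in>I. norm (trig R f (- \<alpha>)) * norm (trig R b (\<beta> i + \<alpha>))) integrable_on {0..1}"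
      by (intro integrable_sum fin I1)
    show "(\<lambda>\<alpha>. B * norm (trig R f (- \<alpha>))) integrable_on {0..1}"
      by (intro integrable_continuous_real continuous_intros continuous_on_trig)
    fix \<alpha>
    show "(\<Sum>i\<in>I. norm (trig R f (- \<alpha>)) * norm (trig R b (\<beta> i + \<alpha>))) \<le> B * norm (trig R f (- \<alpha>))"
      using mult_left_mono[OF B[of \<alpha>], of "norm (trig R f (- \<alpha>))"] by (simp add: sum_distrib_left mult.commute)
  qed
  also have "\<dots> = B * integral {0..1} (\<lambda>\<alpha>. norm (trig R f (- \<alpha>)))" by (rule integral_mult_right)
  finally show ?thesis .
qed

section \<open>A Chebyshev lower bound for the number of primes\<close>

text \<open>The numbers 1/(k (n choose k)) satisfy the difference rule of Leibniz's harmonic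
  triangle: the values at (n-1, k) and (n, k) differ by the value at (n, k+1). Integrality after
  multiplication by \<open>D\<close> thus spreads from k = 1.\<close>

lemma divisible_by_mult_binomial:
  fixes D N :: nat
  assumes D: "\<And>i. i \<in> {1..N} \<Longrightarrow> i dvd D"
  shows "1 \<le> k \<Longrightarrow> k \<le> n \<Longrightarrow> n \<le> N \<Longrightarrow> real D / (real k * real (n choose k)) \<in> \<int>"
proof (induction k arbitrary: n rule: nat_induct_at_least[of 1])
  case base
  then have "n dvd D" using D by auto
  then obtain q where q: "D = n * q" ..
  have "real D / (real 1 * real (n choose 1)) = real q" using base by (simp add: q)
  then show ?case by simp
next
  case (Suc k)
  then obtain m where m: "n = Suc m" by (cases n) auto
  have "real D / (real k * real (m choose k)) \<in> \<int>" "real D / (real k * real (n choose k)) \<in> \<int>"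
    using Suc.prems m Suc.hyps by (auto intro!: Suc.IH)
  then have I: "real D / (real k * real (m choose k)) - real D / (real k * real (n choose k)) \<in> \<int>"
    by (rule Ints_diff)
  have pos: "real (m choose k) > 0" "real (n choose k) > 0" "real (n choose Suc k) > 0"
    using Suc.prems m by (simp_all add: zero_less_binomial_iff del: binomial_Suc_Suc)
  define a where "a = real (m choose k)"
  define b where "b = real (n choose k)"
  define c where "c = real (n choose Suc k)"
  have c: "real (Suc k) * c = real n * a"
    unfolding c_def a_def m by (metis Suc_times_binomial_eq of_nat_mult mult.commute)
  have b: "(real n - real k) * b = real n * a"
  proof -
    have "(n - k) * (n choose k) = n * ((n - 1) choose k)"
      using Suc.prems by (intro binomial_absorb_comp)
    then have "real (n - k) * b = real n * a"
      by (metis a_def b_def diff_Suc_1 m of_nat_mult)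
    then show ?thesis using Suc.prems by (simp add: of_nat_diff)
  qed
  have nk: "real n - real k > 0" "real k > 0" "real n > 0" using Suc.prems Suc.hyps by auto
  have ab: "a > 0" "b > 0" "c > 0" using pos by (auto simp: a_def b_def c_def)
  have "1 / (real k * a) - 1 / (real k * b) = 1 / (real n * a)"
  proof -
    have "b = real n * a / (real n - real k)" using b nk by (simp add: field_simps)
    then have 1: "1 / (real k * b) = (real n - real k) / (real k * (real n * a))" using nk ab by (simp add: field_simps)
    have 2: "1 / (real k * a) = real n / (real k * (real n * a))" using nk ab by simp
    show ?thesis unfolding 1 2 diff_divide_distrib[symmetric] using nk ab by simp
  qed
  then have "real D / (real k * a) - real D / (real k * b) = real D / (real (Suc k) * c)"
    unfolding c by (metis (no_types, opaque_lifting) mult.right_neutral right_diff_distrib times_divide_eq_right)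
  then show ?case using I by (simp add: a_def b_def c_def)
qed

text \<open>\<open>D\<close> is the least common multiple of 1, ..., 2n. It is divisible by n (2n
  choose n), hence at least 4^n / 2, and it is a product of one prime power \<le> 2n for each prime
  \<le> 2n.\<close>

lemma prime_count_power_ge:
  assumes n: "n \<ge> 1"
  shows "4 ^ n / 2 \<le> real (2 * n) ^ card {p. prime p \<and> p \<le> 2 * n}"
proof -
  define N where "N = 2 * n"
  define P where "P = {p. prime p \<and> p \<le> N}"
  have finP: "finite P" by (rule finite_subset[of _ "{..N}"]) (auto simp: P_def)
  define e where "e = (\<lambda>p. Max {k. p ^ k \<le> N})"
  have fin: "finite {k. p ^ k \<le> N}" if "p \<in> P" for p
  proof (rule finite_subset[of _ "{..N}"])
    have "k < p ^ k" for k using that by (intro power_gt_expt) (auto simp: P_def prime_gt_Suc_0_nat)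
    then show "{k. p ^ k \<le> N} \<subseteq> {..N}" by (auto intro: less_imp_le order_trans)
  qed simp
  have ne: "0 \<in> {k. p ^ k \<le> N}" for p using n by (simp add: N_def)
  have eN: "p ^ e p \<le> N" if "p \<in> P" for p
    using Max_in[OF fin[OF that]] ne[of p] unfolding e_def by blast
  define D where "D = (\<Prod>p\<in>P. p ^ e p)"
  have dv: "i dvd D" if i: "i \<in> {1..N}" for i
  proof -
    have i0: "i \<noteq> 0" using i by auto
    have "i = (\<Prod>p\<in>prime_factors i. p ^ multiplicity p i)"
      using i0 by (simp add: prod_prime_factors)
    also have "\<dots> dvd D" unfolding D_def
    proof (rule prod_dvd_prod_subset2[OF finP])
      show sub: "prime_factors i \<subseteq> P"
      proof
        fix p assume "p \<in> prime_factors i"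
        then have "prime p" "p dvd i" by (auto simp: in_prime_factors_iff)
        then have "p \<le> i" using i0 by (auto intro: dvd_imp_le)
        then show "p \<in> P" using \<open>prime p\<close> i by (auto simp: P_def)
      qed
      fix p assume p: "p \<in> prime_factors i"
      have "p ^ multiplicity p i dvd i" by (rule multiplicity_dvd)
      then have "p ^ multiplicity p i \<le> N" using i i0 by (auto dest: dvd_imp_le)
      then have "multiplicity p i \<le> e p" unfolding e_def using p sub by (intro Max_ge fin) auto
      then show "p ^ multiplicity p i dvd p ^ e p" by (rule le_imp_power_dvd)
    qed
    finally show ?thesis .
  qed
  have D0: "D > 0" unfolding D_def by (rule prod_pos) (auto simp: P_def prime_gt_0_nat)
  have "real D / (real n * real (N choose n)) \<in> \<int>"
    by (rule divisible_by_mult_binomial[of N, OF dv]) (use n in \<open>auto simp: N_def\<close>)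
  moreover have C0: "real n * real (N choose n) > 0" using n by (auto simp: N_def)
  moreover have "real D / (real n * real (N choose n)) > 0" using D0 C0 by (intro divide_pos_pos) auto
  moreover have "1 \<le> r" if "r \<in> \<int>" "r > 0" for r :: real
    using that by (auto elim!: Ints_cases)
  ultimately have "1 \<le> real D / (real n * real (N choose n))" by blast
  then have "real n * real (N choose n) \<le> real D" using C0 by (simp add: field_simps)
  moreover have "4 ^ n / (2 * real n) \<le> real (2 * n choose n)"
    using n by (intro central_binomial_lower_bound) auto
  then have "4 ^ n / 2 \<le> real n * real (N choose n)" using n by (simp add: N_def field_simps)
  moreover have "real D \<le> real N ^ card P"
  proof -
    have "D \<le> (\<Prod>p\<in>P. N)" unfolding D_def by (rule prod_mono) (use eN in auto)
    then show ?thesis by (simp flip: of_nat_power)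
  qed
  ultimately show ?thesis by (simp add: N_def P_def)
qed

lemma prime_count_ge:
  assumes N: "N \<ge> 8"
  shows "real (card {p. prime p \<and> p \<le> N}) \<ge> real N / (4 * ln (real N))"
proof -
  define n where "n = N div 2"
  have n: "n \<ge> 1" "2 * n \<le> N" "real N \<le> 2 * real n + 1" using N by (auto simp: n_def)
  define c where "c = card {p. prime p \<and> p \<le> N}"
  have "card {p. prime p \<and> p \<le> 2 * n} \<le> c" unfolding c_def
    by (rule card_mono) (use n in \<open>auto intro: finite_subset[of _ "{..N}"]\<close>)
  then have "real (2 * n) ^ card {p. prime p \<and> p \<le> 2 * n} \<le> real N ^ c"
    using n by (intro order_trans[OF power_mono[of "real (2 * n)" "real N"] power_increasing]) auto
  then have "4 ^ n / 2 \<le> real N ^ c" using prime_count_power_ge[OF n(1)] by linarith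
  then have "ln (4 ^ n / 2) \<le> ln (real N ^ c)" using N by (subst ln_le_cancel_iff) auto
  then have "real n * ln 4 - ln 2 \<le> real c * ln (real N)" using N by (simp add: ln_div ln_realpow)
  moreover have "ln (4::real) = 2 * ln 2" using ln_realpow[of 2 2] by simp
  ultimately have A: "(2 * real n - 1) * ln 2 \<le> real c * ln (real N)" by (simp add: algebra_simps)
  \<comment> \<open>Here ln 2 \<ge> 1/2 because e < 4, and 2n - 1 \<ge> N - 2 \<ge> N/2.\<close>
  have "real N / 4 \<le> (2 * real n - 1) * ln 2"
  proof -
    have "1 \<le> ln (4::real)" using exp_le by (subst ln_ge_iff) auto
    then have l: "ln (2::real) \<ge> 1/2" using \<open>ln (4::real) = 2 * ln 2\<close> by simp
    have "(2 * real n - 1) * (1/2) \<le> (2 * real n - 1) * ln 2" using n l by (intro mult_left_mono) auto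
    moreover have "real N / 4 \<le> (2 * real n - 1) * (1/2)" using n N by simp
    ultimately show ?thesis by linarith
  qed
  with A have "real N / 4 \<le> real c * ln (real N)" by linarith
  moreover have "ln (real N) > 0" using N by simp
  ultimately show ?thesis unfolding c_def by (simp add: field_simps)
qed

section \<open>Ramanujan sums and the spacing of Farey fractions\<close>

lemma ee_eq_1_iff: "ee t = 1 \<longleftrightarrow> t \<in> \<int>"
proof
  assume "ee t = 1"
  then have "Re (ee t) = 1" by simp
  then have "cos (2 * pi * t) = 1" by (simp add: ee_def)
  then obtain n :: int where "2 * pi * t = of_int n * 2 * pi" using cos_one_2pi_int by auto
  then have "t = of_int n" by simp
  then show "t \<in> \<int>" by simp
qed (auto elim!: Ints_cases)

lemma sum_ee_residues:
  assumes q: "q \<ge> 1"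
  shows "(\<Sum>b<q. ee (real n * (real b / real q))) = (if q dvd n then of_nat q else 0)"
proof -
  define z where "z = ee (real n / real q)"
  have zb: "ee (real n * (real b / real q)) = z ^ b" for b
    unfolding z_def by (simp add: mult_ac flip: ee_of_nat_mult)
  have iff: "z = 1 \<longleftrightarrow> q dvd n"
  proof -
    have "real n / real q \<in> \<int> \<longleftrightarrow> q dvd n"
    proof
      assume "real n / real q \<in> \<int>"
      then obtain k :: int where "real n / real q = of_int k" by (auto elim: Ints_cases)
      then have "real n = of_int k * real q" using q by (simp add: field_simps)
      then have "int n = k * int q" by (metis of_int_eq_iff of_int_mult of_int_of_nat_eq)
      then show "q dvd n" by (metis dvd_triv_right int_dvd_int_iff)
    next
      assume "q dvd n"
      then obtain k where "n = q * k" ..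
      then have "real n / real q = real k" using q by simp
      then show "real n / real q \<in> \<int>" by simp
    qed
    then show ?thesis unfolding z_def ee_eq_1_iff .
  qed
  have zq: "z ^ q = 1"
  proof -
    have "z ^ q = ee (real q * (real n / real q))" unfolding z_def by (rule ee_of_nat_mult[symmetric])
    also have "real q * (real n / real q) = of_int (int n)" using q by simp
    finally show ?thesis by (simp only: ee_of_int)
  qed
  show ?thesis
  proof (cases "q dvd n")
    case True
    then show ?thesis unfolding zb using iff by simp
  next
    case False
    then have "z \<noteq> 1" using iff by simp
    then show ?thesis unfolding zb using zq False by (simp add: sum_gp_strict)
  qed
qed

lemma sum_trig_fractions:
  assumes "\<And>n. (\<Sum>b\<in>B. ee (real n * (real b / real q))) = c n"
  shows "(\<Sum>b\<in>B. trig R g (real b / real q)) = (\<Sum>n=1..R. g n * c n)"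
proof -
  have "(\<Sum>b\<in>B. trig R g (real b / real q)) = (\<Sum>n=1..R. \<Sum>b\<in>B. g n * ee (real n * (real b / real q)))"
    unfolding trig_def by (rule sum.swap)
  also have "\<dots> = (\<Sum>n=1..R. g n * c n)" by (simp only: sum_distrib_left[symmetric] assms)
  finally show ?thesis .
qed

text \<open>The factor on the right is the Ramanujan sum for a prime modulus: all residues minus the
  residue 0. The term -1 brings in the full sum of the coefficients.\<close>

lemma trig_sum_prime:
  assumes p: "prime p"
  shows "(\<Sum>b\<in>{1..<p}. trig R g (real b / real p)) = (\<Sum>n=1..R. g n * ((if p dvd n then of_nat p else 0) - 1))"
proof (rule sum_trig_fractions)
  fix n
  have p1: "p \<ge> 1" using prime_ge_1_nat[OF p] .
  have "{..<p} = insert 0 {1..<p}" using p1 by auto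
  then have "(\<Sum>b<p. ee (real n * (real b / real p))) = ee 0 + (\<Sum>b\<in>{1..<p}. ee (real n * (real b / real p)))" by simp
  moreover have "ee 0 = 1" using ee_of_int[of 0] by simp
  ultimately show "(\<Sum>b\<in>{1..<p}. ee (real n * (real b / real p))) = (if p dvd n then of_nat p else 0) - 1"
    using sum_ee_residues[OF p1, of n] by (simp add: algebra_simps)
qed

text \<open>The Ramanujan sum modulo p^2: all residues minus the multiples of p, which form a
  complete residue system modulo p after division by p. It vanishes at every n prime to p, so the
  full sum does not appear.\<close>

lemma trig_sum_prime_square:
  assumes p: "prime p"
  shows "(\<Sum>b\<in>{b\<in>{1..<p^2}. \<not> p dvd b}. trig R g (real b / real (p^2))) =
    (\<Sum>n=1..R. g n * ((if p^2 dvd n then of_nat (p^2) else 0) - (if p dvd n then of_nat p else 0)))"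
proof (rule sum_trig_fractions)
  fix n
  have p1: "p \<ge> 1" using prime_ge_1_nat[OF p] .
  have p2: "p^2 \<ge> 1" using p1 by simp
  let ?f = "\<lambda>b. ee (real n * (real b / real (p^2)))"
  have U: "{..<p^2} = {b\<in>{1..<p^2}. \<not> p dvd b} \<union> (\<lambda>c. p * c) ` {..<p}"
  proof (intro equalityI subsetI)
    fix b assume b: "b \<in> {..<p^2}"
    show "b \<in> {b\<in>{1..<p^2}. \<not> p dvd b} \<union> (\<lambda>c. p * c) ` {..<p}"
    proof (cases "p dvd b")
      case True
      then obtain c where c: "b = p * c" ..
      then have "p * c < p * p" using b by (simp add: power2_eq_square)
      then have "c < p" by simp
      then show ?thesis using c by auto
    next
      case False
      then have "b \<noteq> 0" by (metis dvd_0_right)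
      then show ?thesis using False b by auto
    qed
  next
    fix b assume "b \<in> {b\<in>{1..<p^2}. \<not> p dvd b} \<union> (\<lambda>c. p * c) ` {..<p}"
    then show "b \<in> {..<p^2}" using p1 by (auto simp: power2_eq_square)
  qed
  have "(\<Sum>b<p^2. ?f b) = (\<Sum>b\<in>{b\<in>{1..<p^2}. \<not> p dvd b}. ?f b) + (\<Sum>b\<in>(\<lambda>c. p * c) ` {..<p}. ?f b)"
    unfolding U by (rule sum.union_disjoint) auto
  also have "(\<Sum>b\<in>(\<lambda>c. p * c) ` {..<p}. ?f b) = (\<Sum>c<p. ?f (p * c))"
    by (rule sum.reindex_cong[OF _ refl refl]) (use p1 in \<open>auto simp: inj_on_def\<close>)
  also have "\<dots> = (\<Sum>c<p. ee (real n * (real c / real p)))"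
    using p1 by (intro sum.cong refl) (simp add: power2_eq_square)
  finally show "(\<Sum>b\<in>{b\<in>{1..<p^2}. \<not> p dvd b}. ?f b) = (if p^2 dvd n then of_nat (p^2) else 0) - (if p dvd n then of_nat p else 0)"
    unfolding sum_ee_residues[OF p2] sum_ee_residues[OF p1] by (simp add: algebra_simps)
qed

text \<open>The difference modulo 1 of distinct reduced fractions is a nonzero integer over a
  product of two denominators \<le> Q. Injectivity of \<open>q\<close> ensures that different index
  pairs give different fractions.\<close>

lemma farey_separated:
  fixes q :: "'a \<Rightarrow> nat"
  assumes q: "\<And>p. p \<in> P \<Longrightarrow> 1 \<le> q p \<and> q p \<le> Q" and inj: "inj_on q P"
    and B: "\<And>p b. p \<in> P \<Longrightarrow> b \<in> B p \<Longrightarrow> 1 \<le> b \<and> b \<le> q p \<and> coprime b (q p)"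
    and ij: "i \<in> Sigma P B" "j \<in> Sigma P B" "i \<noteq> j"
  shows "\<bar>real (snd i) / real (q (fst i)) - real (snd j) / real (q (fst j)) - of_int m\<bar> \<ge> 1 / real (Q^2)"
proof -
  obtain p b p' b' where i: "i = (p, b)" "p \<in> P" "b \<in> B p" and j: "j = (p', b')" "p' \<in> P" "b' \<in> B p'"
    using ij by auto
  define r where "r = q p" define r' where "r' = q p'"
  have r: "1 \<le> r" "r \<le> Q" "1 \<le> r'" "r' \<le> Q" using q i j by (auto simp: r_def r'_def)
  have b: "1 \<le> b" "b \<le> r" "coprime b r" "1 \<le> b'" "b' \<le> r'" "coprime b' r'"
    using B[OF i(2,3)] B[OF j(2,3)] by (auto simp: r_def r'_def)
  define k where "k = int b * int r' - int b' * int r - m * int r * int r'"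
  have e: "real b / real r - real b' / real r' - of_int m = of_int k / (real r * real r')"
    using r by (simp add: k_def field_simps)
  have "k \<noteq> 0"
  proof
    assume "k = 0"
    then have d: "real b / real r - real b' / real r' = of_int m" using e by simp
    have "0 < real b / real r" "real b / real r \<le> 1" "0 < real b' / real r'" "real b' / real r' \<le> 1" using b r by auto
    \<comment> \<open>Both fractions lie in (0,1], so a difference that is an integer can only be
      0.\<close>
    then have "\<bar>real_of_int m\<bar> < 1" unfolding d[symmetric] by linarith
    then have "m = 0" by linarith
    then have "int b * int r' = int b' * int r" using \<open>k = 0\<close> by (simp add: k_def)
    then have eq: "b * r' = b' * r" by (metis of_nat_eq_iff of_nat_mult)
    have "r dvd b * r'" unfolding eq by simp
    then have "r dvd r'" using b(3) by (simp add: coprime_commute coprime_dvd_mult_right_iff)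
    moreover have "r' dvd b' * r" unfolding eq[symmetric] by simp
    then have "r' dvd r" using b(6) by (simp add: coprime_commute coprime_dvd_mult_right_iff)
    ultimately have "r = r'" by (rule dvd_antisym)
    then have "p = p'" using inj i j by (auto simp: r_def r'_def inj_on_def)
    moreover have "b = b'" using eq r \<open>r = r'\<close> by simp
    ultimately show False using ij(3) i j by simp
  qed
  then have "1 \<le> \<bar>real_of_int k\<bar>" by linarith
  have rr: "0 < real r * real r'" "real r * real r' \<le> real Q * real Q" using r by (auto intro!: mult_mono)
  have "1 / real (Q^2) \<le> 1 / (real r * real r')"
    using rr by (intro divide_left_mono) (auto simp: power2_eq_square intro!: mult_pos_pos)
  also have "\<dots> \<le> \<bar>real_of_int k\<bar> / (real r * real r')"
    using \<open>1 \<le> \<bar>real_of_int k\<bar>\<close> rr by (intro divide_right_mono) auto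
  also have "\<dots> = \<bar>real b / real r - real b' / real r' - of_int m\<bar>" unfolding e using rr by (simp add: abs_divide)
  finally show ?thesis by (simp add: i j r_def r'_def)
qed

section \<open>The kernel at Farey fractions and the size of the truncated sums\<close>

context L4_zero begin

text \<open>The cofactor of \<mu> in the coefficients of S. Splitting \<mu> off lets
  \<open>large_sieve_L1\<close> put it alone into the L1 norm.\<close>

definition wt :: "real \<Rightarrow> nat \<Rightarrow> complex" where
  "wt x n = of_real (chi4 n) * Th (real n / x)"

text \<open>The constant 3 is two boundary values and a total variation, each at most 1; the
  variation telescopes through \<open>V\<close>.\<close>

lemma trig_Th_bounds:
  assumes x: "x > 0"
  shows "norm (trig R (\<lambda>n. Th (real n / x)) u) \<le> real R"
    and "norm (trig R (\<lambda>n. Th (real n / x)) u) * norm (1 - ee u) \<le> 3"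
proof -
  have "norm (trig R (\<lambda>n. Th (real n / x)) u) \<le> (\<Sum>n=1..R. 1)"
    unfolding trig_def
    by (intro order_trans[OF norm_sum] sum_mono) (use x in \<open>auto simp: norm_mult intro!: norm_Th_le_1\<close>)
  then show "norm (trig R (\<lambda>n. Th (real n / x)) u) \<le> real R" by simp
  show "norm (trig R (\<lambda>n. Th (real n / x)) u) * norm (1 - ee u) \<le> 3"
  proof (cases R)
    case 0
    then show ?thesis by (simp add: trig_def)
  next
    case (Suc r)
    define g where "g = (\<lambda>n. Th (real n / x))"
    have "trig R g u = (\<Sum>n=1..Suc r. g n * ee u ^ n)" by (simp only: trig_def Suc ee_of_nat_mult)
    then have "norm (trig R g u) * norm (1 - ee u) = norm ((1 - ee u) * (\<Sum>n=1..Suc r. g n * ee u ^ n))"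
      by (simp only: norm_mult mult.commute)
    also have "\<dots> \<le> norm (g 1) + (\<Sum>n=1..r. norm (g (Suc n) - g n)) + norm (g (Suc r))"
      by (rule partial_summation) simp
    also have "\<dots> \<le> 1 + (\<Sum>n=1..r. V (real n / x) - V (real (Suc n) / x)) + 1"
    proof (intro add_mono sum_mono)
      show "norm (g 1) \<le> 1" "norm (g (Suc r)) \<le> 1" unfolding g_def using x by (auto intro!: norm_Th_le_1)
      fix n assume n: "n \<in> {1..r}"
      have "norm (Th (real n / x) - Th (real (Suc n) / x)) \<le> V (real n / x) - V (real (Suc n) / x)"
        using n x by (intro norm_Th_diff_le divide_right_mono) auto
      then show "norm (g (Suc n) - g n) \<le> V (real n / x) - V (real (Suc n) / x)"
        by (simp only: g_def norm_minus_commute)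
    qed
    also have "(\<Sum>n=1..r. V (real n / x) - V (real (Suc n) / x)) = V (real 1 / x) - V (real (Suc r) / x)"
      by (induction r) auto
    also have "\<dots> \<le> 1" using V_bounds[of "real 1 / x"] V_bounds[of "real (Suc r) / x"] x by simp
    finally show ?thesis by (simp add: g_def)
  qed
qed

text \<open>The finite Fourier expansion of the character, checked on residues modulo 4. It trades
  the character, which would spoil partial summation, for shifts of the argument by 1/4 and
  -1/4.\<close>

lemma chi4_ee: "of_real (chi4 n) = (ee (real n * (1/4)) - ee (real n * (-1/4))) / (2 * \<i>)"
proof -
  have e1: "ee (1/4) = \<i>" by (simp add: ee_def complex_eq_iff)
  have "ee (-1/4) = - \<i>" by (simp add: ee_def complex_eq_iff cos_minus sin_minus)
  then have E: "ee (real n * (1/4)) = \<i> ^ n" "ee (real n * (-1/4)) = (- \<i>) ^ n"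
    using e1 ee_of_nat_mult[of n "1/4"] ee_of_nat_mult[of n "-1/4"] by simp_all
  define k where "k = n div 4"
  have n: "n = 4 * k + n mod 4" by (simp add: k_def)
  have i4: "\<i> ^ 4 = 1" "(- \<i>) ^ 4 = 1" by (simp_all add: power4_eq_xxxx)
  have "\<i> ^ n = \<i> ^ (n mod 4)" "(- \<i>) ^ n = (- \<i>) ^ (n mod 4)"
    by (subst (1) n, simp only: power_add power_mult i4 power_one mult_1)+
  moreover have "n mod 4 \<in> {0,1,2,3}" by auto
  ultimately show ?thesis unfolding E chi4_def
    by (auto simp: power2_eq_square power3_eq_cube)
qed

lemma trig_wt:
  "trig R (wt x) u = (trig R (\<lambda>n. Th (real n / x)) (u + 1/4) - trig R (\<lambda>n. Th (real n / x)) (u + (-1/4))) / (2 * \<i>)"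
proof -
  have "trig R (wt x) u = (\<Sum>n=1..R. (Th (real n / x) * ee (real n * (u + 1/4)) - Th (real n / x) * ee (real n * (u + (-1/4)))) / (2 * \<i>))"
    unfolding trig_def wt_def chi4_ee distrib_left ee_add
    by (rule sum.cong) (simp_all add: field_simps)
  then show ?thesis unfolding trig_def by (simp only: sum_divide_distrib[symmetric] sum_subtractf)
qed

text \<open>The shifts by 1/4 and -1/4 do not change the spacing of the points, so the separated-sum
  bound applies to both and passes to their half sum.\<close>

lemma sum_trig_wt_le:
  fixes \<beta> :: "'i \<Rightarrow> real"
  assumes x: "x > 0" and fin: "finite I" and N: "N \<ge> 1"
    and sep: "\<And>i j m. i \<in> I \<Longrightarrow> j \<in> I \<Longrightarrow> i \<noteq> j \<Longrightarrow> \<bar>\<beta> i - \<beta> j - of_int m\<bar> \<ge> 1 / real N"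
  shows "(\<Sum>i\<in>I. norm (trig R (wt x) (\<beta> i + \<alpha>))) \<le> 2 * real R + 6 * real N * (1 + ln (real N))"
proof -
  define h where "h = (\<lambda>u. norm (trig R (\<lambda>n. Th (real n / x)) u))"
  have S: "(\<Sum>i\<in>I. h (\<beta> i + \<gamma>)) \<le> 2 * real R + 2 * 3 * real N * (1 + ln (real N))" for \<gamma>
    by (rule sum_separated_le[OF fin N sep]) (use trig_Th_bounds[OF x] in \<open>auto simp: h_def\<close>)
  have "norm (trig R (wt x) (\<beta> i + \<alpha>)) \<le> (h (\<beta> i + (\<alpha> + 1/4)) + h (\<beta> i + (\<alpha> + (-1/4)))) / 2" for i
  proof -
    have "norm (trig R (wt x) (\<beta> i + \<alpha>)) = norm (trig R (\<lambda>n. Th (real n / x)) (\<beta> i + \<alpha> + 1/4) - trig R (\<lambda>n. Th (real n / x)) (\<beta> i + \<alpha> + (-1/4))) / 2"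
      unfolding trig_wt by (simp add: norm_divide norm_mult)
    also have "\<dots> \<le> (h (\<beta> i + \<alpha> + 1/4) + h (\<beta> i + \<alpha> + (-1/4))) / 2"
      unfolding h_def by (intro divide_right_mono norm_triangle_ineq4) auto
    finally show ?thesis by (simp only: add.assoc)
  qed
  then have "(\<Sum>i\<in>I. norm (trig R (wt x) (\<beta> i + \<alpha>))) \<le> (\<Sum>i\<in>I. (h (\<beta> i + (\<alpha> + 1/4)) + h (\<beta> i + (\<alpha> + (-1/4)))) / 2)"
    by (rule sum_mono)
  also have "\<dots> = ((\<Sum>i\<in>I. h (\<beta> i + (\<alpha> + 1/4))) + (\<Sum>i\<in>I. h (\<beta> i + (\<alpha> + (-1/4))))) / 2"
    by (simp only: sum_divide_distrib[symmetric] sum.distrib)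
  also have "\<dots> \<le> 2 * real R + 2 * 3 * real N * (1 + ln (real N))"
    using add_mono[OF S[of "\<alpha> + 1/4"] S[of "\<alpha> + (-1/4)"]] by (simp only: divide_le_eq_numeral1 mult_2_right)
  finally show ?thesis by simp
qed

lemma farey_sum_le:
  fixes q :: "'a \<Rightarrow> nat"
  assumes x: "x > 0" and fin: "finite P" "\<And>p. p \<in> P \<Longrightarrow> finite (B p)" and Q: "Q \<ge> 1"
    and q: "\<And>p. p \<in> P \<Longrightarrow> 1 \<le> q p \<and> q p \<le> Q" and inj: "inj_on q P"
    and B: "\<And>p b. p \<in> P \<Longrightarrow> b \<in> B p \<Longrightarrow> 1 \<le> b \<and> b \<le> q p \<and> coprime b (q p)"
  shows "(\<Sum>p\<in>P. norm (\<Sum>b\<in>B p. trig R (\<lambda>n. f n * wt x n) (real b / real (q p))))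
     \<le> (2 * real R + 6 * real (Q^2) * (1 + ln (real (Q^2)))) * integral {0..1} (\<lambda>\<alpha>. norm (trig R f (- \<alpha>)))"
proof -
  have "(\<Sum>p\<in>P. norm (\<Sum>b\<in>B p. trig R (\<lambda>n. f n * wt x n) (real b / real (q p))))
     \<le> (\<Sum>p\<in>P. \<Sum>b\<in>B p. norm (trig R (\<lambda>n. f n * wt x n) (real b / real (q p))))"
    by (intro sum_mono norm_sum)
  also have "\<dots> = (\<Sum>i\<in>Sigma P B. norm (trig R (\<lambda>n. f n * wt x n) (real (snd i) / real (q (fst i)))))"
    using fin by (subst sum.Sigma) (auto simp: case_prod_beta)
  also have "\<dots> \<le> (2 * real R + 6 * real (Q^2) * (1 + ln (real (Q^2)))) * integral {0..1} (\<lambda>\<alpha>. norm (trig R f (- \<alpha>)))"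
  proof (rule large_sieve_L1)
    show "finite (Sigma P B)" using fin by auto
    show "(\<Sum>i\<in>Sigma P B. norm (trig R (wt x) (real (snd i) / real (q (fst i)) + \<alpha>))) \<le> 2 * real R + 6 * real (Q^2) * (1 + ln (real (Q^2)))" for \<alpha>
    proof (rule sum_trig_wt_le[OF x])
      show "finite (Sigma P B)" using fin by auto
      show "Q^2 \<ge> 1" using Q by simp
      show "1 / real (Q^2) \<le> \<bar>real (snd i) / real (q (fst i)) - real (snd j) / real (q (fst j)) - of_int m\<bar>"
        if "i \<in> Sigma P B" "j \<in> Sigma P B" "i \<noteq> j" for i j m
        by (rule farey_separated[OF q inj B that])
    qed
  qed
  finally show ?thesis .
qed

text \<open>Beyond R each term is bounded through the exponential decay of \<open>Th\<close>, and
  the geometric series with ratio r = e^(-1/x) sums to at most 1 + x times its first term. The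
  assumption x \<le> R ensures that the argument of \<open>Th\<close> is at least 1 there.\<close>

lemma Th_truncation:
  assumes x: "x > 0" "x \<le> real R" and c: "\<And>n. \<bar>c n\<bar> \<le> 1" "c 0 = 0"
    and S: "(\<lambda>n. of_real (c n) * Th (real n / x)) sums S"
  shows "norm (S - (\<Sum>n=1..R. of_real (c n) * Th (real n / x))) \<le> exp 1 * K * (1 + x) * exp (- (real R / x))"
proof -
  define f where "f = (\<lambda>n. complex_of_real (c n) * Th (real n / x))"
  have tl: "(\<lambda>n. f (n + Suc R)) sums (S - (\<Sum>n<Suc R. f n))"
    using S unfolding f_def[symmetric] by (rule sums_split_initial_segment)
  have "{..<Suc R} = insert 0 {1..R}" by auto
  then have fs: "(\<Sum>n<Suc R. f n) = (\<Sum>n=1..R. f n)" by (simp add: f_def c(2))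
  define E where "E = exp 1 * K * exp (- (real R / x))"
  define r where "r = exp (- (1 / x))"
  have r: "0 < r" "r < 1" using x by (auto simp: r_def)
  have E0: "E \<ge> 0" using K_nonneg by (simp add: E_def)
  have nb: "norm (f (n + Suc R)) \<le> E * r ^ n" for n
  proof -
    have y: "real (n + Suc R) / x \<ge> 1" using x by (simp add: field_simps)
    have "norm (f (n + Suc R)) \<le> 1 * norm (Th (real (n + Suc R) / x))"
      unfolding f_def norm_mult using c(1)[of "n + Suc R"] by (intro mult_right_mono) auto
    also have "\<dots> \<le> exp 1 * K * exp (- (real (n + Suc R) / x))" using norm_Th_le_exp[OF y] by simp
    also have "\<dots> \<le> exp 1 * K * (exp (- (real R / x)) * r ^ n)"
    proof (rule mult_left_mono)
      have "- (real (n + Suc R) / x) \<le> - (real R / x) + real n * (- (1 / x))"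
        using x by (simp add: field_simps)
      then show "exp (- (real (n + Suc R) / x)) \<le> exp (- (real R / x)) * r ^ n"
        unfolding r_def exp_of_nat_mult[symmetric] exp_add[symmetric] by (simp only: exp_le_cancel_iff)
    qed (use K_nonneg in auto)
    finally show ?thesis by (simp only: E_def mult.assoc)
  qed
  have geo: "(\<lambda>n. E * r ^ n) sums (E * (1 / (1 - r)))" using r by (intro sums_mult geometric_sums) auto
  have "norm (S - (\<Sum>n<Suc R. f n)) \<le> E * (1 / (1 - r))"
  proof -
    have sn: "summable (\<lambda>n. norm (f (n + Suc R)))"
      by (rule summable_comparison_test'[OF sums_summable[OF geo]]) (use nb in simp)
    have "norm (S - (\<Sum>n<Suc R. f n)) = norm (\<Sum>n. f (n + Suc R))" using tl by (simp add: sums_iff)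
    also have "\<dots> \<le> (\<Sum>n. norm (f (n + Suc R)))" by (rule summable_norm[OF sn])
    also have "\<dots> \<le> (\<Sum>n. E * r ^ n)" by (rule suminf_le[OF nb sn sums_summable[OF geo]])
    also have "\<dots> = E * (1 / (1 - r))" using geo by (simp add: sums_iff)
    finally show ?thesis .
  qed
  also have "\<dots> \<le> E * (1 + x)"
  proof (rule mult_left_mono[OF _ E0])
    have "1 + 1 / x \<le> exp (1 / x)" by (rule exp_ge_add_one_self)
    then have "(1 + 1 / x) * r \<le> exp (1 / x) * r" using r by (intro mult_right_mono) auto
    also have "exp (1 / x) * r = 1" by (simp add: r_def flip: exp_add)
    finally have "(1 + 1 / x) * r \<le> 1" .
    then have "x * ((1 + 1 / x) * r) \<le> x * 1" using x by (intro mult_left_mono) auto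
    moreover have "x * ((1 + 1 / x) * r) = (x + 1) * r" using x by (simp add: field_simps)
    ultimately have "(x + 1) * r \<le> x" by simp
    then have "1 \<le> (1 + x) * (1 - r)" by (simp add: algebra_simps)
    then show "1 / (1 - r) \<le> 1 + x" using r by (simp add: divide_le_eq)
  qed
  finally have "norm (S - (\<Sum>n=1..R. f n)) \<le> E * (1 + x)" unfolding fs .
  then show ?thesis unfolding f_def E_def by (simp only: mult_ac)
qed

text \<open>Each of the two errors in \<open>Up_sums\<close> is to cost at most 1/8 of the main
  term. For the constant 2 this follows from \<open>c1\<close>, as \<sigma> \<ge> 1/2. The other
  error divided by (x/p)^\<sigma> is 8 C x^(1/4) p^(-(\<sigma>+1/2)), which \<open>c2\<close>
  controls.\<close>

lemma norm_Up_ge: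
  assumes x: "x > 0" and p: "prime p" "p \<ge> 3" "real p \<le> x"
    and C: "C > 0" "\<And>u. u > 0 \<Longrightarrow> exp (- u) \<le> C * u powr (- (\<sigma> + 1/4))"
    and c1: "2 \<le> norm (Gamma \<rho>) / 8 * (x / real p) powr (1/2)"
    and c2: "8 * C * x powr (1/4) \<le> norm (Gamma \<rho>) / 8 * real p powr (\<sigma> + 1/2)"
  shows "norm (Up p x) \<ge> 3/4 * norm (Gamma \<rho>) * (x / real p) powr \<sigma>"
proof -
  define G where "G = norm (Gamma \<rho>)"
  define M where "M = (x / real p) powr \<sigma>"
  have p0: "real p > 0" using p by simp
  have xp: "x / real p \<ge> 1" using p p0 by simp
  have "(x / real p) powr (1/2) \<le> M" unfolding M_def using xp sigma_half by (intro powr_mono) auto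
  then have "G / 8 * (x / real p) powr (1/2) \<le> G / 8 * M" by (intro mult_left_mono) (auto simp: G_def)
  then have a: "2 \<le> G / 8 * M" using c1 by (simp add: G_def)
  have "(x / (real p)^2) powr (\<sigma> + 1/4) = M * (x powr (1/4) * real p powr (- (\<sigma> + 1/2)))"
  proof -
    have "(real p)^2 = real p powr 2" using p0 by simp
    then have "(x / (real p)^2) powr (\<sigma> + 1/4) = x powr (\<sigma> + 1/4) / real p powr (2 * (\<sigma> + 1/4))"
      using x p0 by (simp only: powr_divide powr_powr)
    also have "\<dots> = (x powr \<sigma> * x powr (1/4)) / (real p powr \<sigma> * real p powr (\<sigma> + 1/2))"
      by (simp flip: powr_add)
    also have "\<dots> = M * (x powr (1/4) * real p powr (- (\<sigma> + 1/2)))"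
      unfolding M_def using x p0 by (simp only: powr_divide powr_minus_divide) (simp add: field_simps)
    finally show ?thesis .
  qed
  then have "8 * C * (x / (real p)^2) powr (\<sigma> + 1/4) = M * ((8 * C * x powr (1/4)) * real p powr (- (\<sigma> + 1/2)))" by simp
  also have "\<dots> \<le> M * ((G / 8 * real p powr (\<sigma> + 1/2)) * real p powr (- (\<sigma> + 1/2)))"
    using c2 unfolding G_def by (intro mult_left_mono mult_right_mono) (auto simp: M_def)
  also have "\<dots> = M * (G / 8)"
    using p0 by (simp add: powr_minus field_simps)
  finally have b: "8 * C * (x / (real p)^2) powr (\<sigma> + 1/4) \<le> G / 8 * M" by (simp add: mult.commute)
  have "norm (Up p x) \<ge> G * M - 2 - 8 * C * (x / (real p)^2) powr (\<sigma> + 1/4)"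
    using Up_sums(2)[OF x p(1,2) C] by (simp add: G_def M_def)
  then have "norm (Up p x) \<ge> G * M - G / 8 * M - G / 8 * M" using a b by linarith
  then show ?thesis by (simp add: G_def M_def algebra_simps)
qed

end

section \<open>Lower bounds for the norms\<close>

text \<open>Chebyshev's bound gives at least 2T primes up to y, and at most T of them are \<le> T. A
  lower limit for p is needed because the error terms are relatively small only for large p.\<close>

lemma primes_between_card:
  fixes y :: real
  assumes y: "y \<ge> 9"
  defines "T \<equiv> y / (16 * ln y)"
  shows "real (card {p. prime p \<and> T < real p \<and> real p \<le> y}) \<ge> T"
proof -
  define N where "N = nat \<lfloor>y\<rfloor>"
  have N: "real N \<le> y" "y < real N + 1" "N \<ge> 8" using y by (auto simp: N_def) linarith+
  have le: "real p \<le> y \<longleftrightarrow> p \<le> N" for p using y by (simp add: N_def le_nat_iff le_floor_iff)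
  have ly: "ln y > 0" using y by simp
  have T0: "T > 0" using y ly by (simp add: T_def)
  have "2 * T \<le> real (card {p. prime p \<and> p \<le> N})"
  proof -
    have lN: "0 < ln (real N)" "ln (real N) \<le> ln y" using N by auto
    have "2 * T = (y / 2) / (4 * ln y)" by (simp add: T_def)
    also have "\<dots> \<le> real N / (4 * ln (real N))" using N y lN by (intro frac_le) auto
    also have "\<dots> \<le> real (card {p. prime p \<and> p \<le> N})" by (rule prime_count_ge[OF N(3)])
    finally show ?thesis .
  qed
  also have "\<dots> \<le> real (card ({p. prime p \<and> T < real p \<and> real p \<le> y} \<union> {1..nat \<lfloor>T\<rfloor>}))"
  proof (intro of_nat_mono card_mono)
    have "finite {p. p \<le> N}" by simp
    then show "finite ({p. prime p \<and> T < real p \<and> real p \<le> y} \<union> {1..nat \<lfloor>T\<rfloor>})"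
      unfolding le by (auto intro: finite_subset[rotated])
    show "{p. prime p \<and> p \<le> N} \<subseteq> {p. prime p \<and> T < real p \<and> real p \<le> y} \<union> {1..nat \<lfloor>T\<rfloor>}"
      using T0 by (auto simp: le prime_ge_1_nat le_nat_iff le_floor_iff) (use prime_ge_1_nat in force)
  qed
  also have "\<dots> \<le> real (card {p. prime p \<and> T < real p \<and> real p \<le> y} + card {1..nat \<lfloor>T\<rfloor>})"
    by (intro of_nat_mono card_Un_le)
  also have "\<dots> \<le> real (card {p. prime p \<and> T < real p \<and> real p \<le> y}) + T" using T0 by simp
  finally show ?thesis by simp
qed

lemma amu_eq_0_if_square_dvd:
  assumes "prime p" "p^2 dvd n"
  shows "amu n = 0"
  using moebius_not_squarefree[OF prime_gt_1_nat[OF assms(1)] assms(2)] by (simp add: amu_def)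

definition mobius_L1 :: "nat \<Rightarrow> real" where
  "mobius_L1 R = integral {0..1} (\<lambda>\<alpha>. norm (trig R (\<lambda>n. of_int (moebius n)) (- \<alpha>)))"

lemma mobius_L1_nonneg: "mobius_L1 R \<ge> 0"
  unfolding mobius_L1_def
  by (intro integral_nonneg integrable_continuous_real continuous_intros continuous_on_trig) auto

lemma eventually_le_mult_at_top:
  assumes "filterlim f at_top at_top" "c > 0"
  shows "eventually (\<lambda>n::nat. (d::real) \<le> c * f (real n)) sequentially"
proof -
  have "eventually (\<lambda>r. d / c \<le> f r) at_top" using assms(1) by (simp add: filterlim_at_top)
  then have "eventually (\<lambda>n. d / c \<le> f (real n)) sequentially"
    by (rule eventually_compose_filterlim[OF _ filterlim_real_sequentially])
  then show ?thesis by eventually_elim (use assms(2) in \<open>simp add: field_simps\<close>)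
qed

context L4_zero begin

definition D :: "real \<Rightarrow> nat \<Rightarrow> complex" where
  "D x n = of_int (moebius n) * wt x n"

lemma D_eq: "D x n = of_real (amu n) * Th (real n / x)"
  by (simp add: D_def wt_def amu_def)

text \<open>The exponent \<open>k\<close> is the one in the denominators p^k. Since y^k \<le> sqrt
  R, the Farey order Q satisfies Q^2 \<le> R, which keeps the kernel bound at R log R.\<close>

lemma primes_sum_le:
  assumes x: "x > 0" and y: "y \<ge> 1" "y^k \<le> sqrt (real R)" and k: "k \<ge> 1"
    and P: "\<And>p. p \<in> P \<Longrightarrow> 1 \<le> p \<and> real p \<le> y"
    and B: "\<And>p b. p \<in> P \<Longrightarrow> b \<in> B p \<Longrightarrow> 1 \<le> b \<and> b \<le> p^k \<and> coprime b (p^k)"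
    and lo: "\<And>p. p \<in> P \<Longrightarrow> m \<le> norm (\<Sum>b\<in>B p. trig R (D x) (real b / real (p^k)))"
  shows "real (card P) * m \<le> (2 * real R + 6 * real R * (1 + ln (real R))) * mobius_L1 R"
proof -
  define N where "N = nat \<lfloor>y\<rfloor>"
  have N: "real N \<le> y" "1 \<le> N" using y by (auto simp: N_def le_nat_iff le_floor_iff)
  have PN: "p \<le> N" if "p \<in> P" for p using P[OF that] y by (simp add: N_def le_nat_iff le_floor_iff)
  have fin: "finite P" by (rule finite_subset[of _ "{..N}"]) (use PN in auto)
  have finB: "finite (B p)" if "p \<in> P" for p
    by (rule finite_subset[of _ "{..p^k}"]) (use B[OF that] in auto)
  define Q where "Q = N^k"
  have Q1: "Q \<ge> 1" using N by (simp add: Q_def)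
  have "real Q \<le> y^k" unfolding Q_def of_nat_power by (intro power_mono N) simp
  then have "real Q \<le> sqrt (real R)" using y by simp
  then have "(real Q)^2 \<le> (sqrt (real R))^2" by (rule power_mono) simp
  then have Q2: "real (Q^2) \<le> real R" by simp
  have "1 \<le> real (Q^2)" using Q1 by simp
  then have R1: "1 \<le> real R" using Q2 by linarith
  have "real (card P) * m = (\<Sum>p\<in>P. m)" by simp
  also have "\<dots> \<le> (\<Sum>p\<in>P. norm (\<Sum>b\<in>B p. trig R (D x) (real b / real (p^k))))" by (rule sum_mono[OF lo])
  also have "\<dots> \<le> (2 * real R + 6 * real (Q^2) * (1 + ln (real (Q^2)))) * mobius_L1 R"
    unfolding D_def mobius_L1_def
  proof (rule farey_sum_le[OF x fin finB Q1 _ _ B])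
    show "1 \<le> p^k \<and> p^k \<le> Q" if "p \<in> P" for p
      using P[OF that] PN[OF that] by (auto simp: Q_def intro: power_mono)
    show "inj_on (\<lambda>p. p^k) P" using k by (auto simp: inj_on_def power_eq_iff_eq_base)
  qed
  also have "\<dots> \<le> (2 * real R + 6 * real R * (1 + ln (real R))) * mobius_L1 R"
  proof -
    have "ln (real (Q^2)) \<le> ln (real R)" using Q2 \<open>1 \<le> real (Q^2)\<close> by (intro ln_mono) linarith+
    then show ?thesis using Q2 \<open>1 \<le> real (Q^2)\<close> R1
      by (intro mult_right_mono mobius_L1_nonneg add_left_mono mult_mono) simp_all
  qed
  finally show ?thesis .
qed

abbreviation G :: real where "G \<equiv> norm (Gamma \<rho>)"

text \<open>With \<open>S1\<close> the full and \<open>Sp\<close> the sum over multiples of p, the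
  Ramanujan sums give p Sp - S1 for denominator p and -p Sp for p^2. Truncation reduces 3/4 to 23/32
  = 3/4 - 1/32, since (x/p)^\<sigma> \<ge> 1.\<close>

lemma prime_trig_lower:
  assumes x: "x > 0" "x \<le> real R" and p: "prime p" "p \<ge> 3" "real p \<le> x"
    and U: "norm (Up p x) \<ge> 3/4 * G * (x / real p) powr \<sigma>"
    and e: "32 * (exp 1 * K * (1 + x) * exp (- (real R / x))) \<le> G"
    and C: "C > 0" "\<And>u. u > 0 \<Longrightarrow> exp (- u) \<le> C * u powr (- (\<sigma> + 1/4))"
  shows "norm (\<Sum>b\<in>{1..<p}. trig R (D x) (real b / real p)) \<ge>
      real p * (23/32 * G * (x / real p) powr \<sigma>) - (G * x powr \<sigma> + 2 + G / 32)"
    and "norm (\<Sum>b\<in>{b\<in>{1..<p^2}. \<not> p dvd b}. trig R (D x) (real b / real (p^2))) \<ge>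
      real p * (23/32 * G * (x / real p) powr \<sigma>)"
proof -
  define S1 where "S1 = (\<Sum>n=1..R. D x n)"
  define Sp where "Sp = (\<Sum>n=1..R. of_real (if p dvd n then amu n else 0) * Th (real n / x))"
  have p0: "real p > 0" using p by simp
  have "(x / real p) powr \<sigma> \<ge> (x / real p) powr 0" using p p0 sigma_half by (intro powr_mono) auto
  then have M1: "(x / real p) powr \<sigma> \<ge> 1" using x p0 by simp
  have "norm (U1 x - S1) \<le> exp 1 * K * (1 + x) * exp (- (real R / x))"
    unfolding S1_def D_eq by (rule Th_truncation[OF x abs_amu_le amu_0 U1_sums(1)[OF x(1)]])
  then have "norm (U1 x - S1) \<le> G / 32" using e by linarith
  then have "norm S1 \<le> norm (U1 x) + G / 32" using norm_triangle_ineq4[of "U1 x" "U1 x - S1"] by simp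
  then have s1: "norm S1 \<le> G * x powr \<sigma> + 2 + G / 32" using U1_sums(2)[OF x(1)] by linarith
  have "norm (Up p x - Sp) \<le> exp 1 * K * (1 + x) * exp (- (real R / x))"
    unfolding Sp_def by (rule Th_truncation[OF x _ _ Up_sums(1)[OF x(1) p(1,2) C]]) (auto intro: abs_amu_le)
  then have "norm (Up p x - Sp) \<le> G / 32" using e by linarith
  then have "norm Sp \<ge> norm (Up p x) - G / 32" using norm_triangle_ineq2[of "Up p x" "Up p x - Sp"] by simp
  moreover have "G / 32 * 1 \<le> G / 32 * (x / real p) powr \<sigma>" using M1 by (intro mult_left_mono) auto
  ultimately have sp: "norm Sp \<ge> 23/32 * G * (x / real p) powr \<sigma>" using U by linarith
  then have psp: "norm (of_nat p * Sp) \<ge> real p * (23/32 * G * (x / real p) powr \<sigma>)"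
    unfolding norm_mult norm_of_nat by (rule mult_left_mono) simp
  have "(\<Sum>b\<in>{1..<p}. trig R (D x) (real b / real p)) = of_nat p * Sp - S1"
    unfolding trig_sum_prime[OF p(1)] Sp_def S1_def D_eq sum_distrib_left sum_subtractf[symmetric]
    by (rule sum.cong) (auto simp: algebra_simps)
  then have "norm (\<Sum>b\<in>{1..<p}. trig R (D x) (real b / real p)) \<ge> norm (of_nat p * Sp) - norm S1"
    using norm_triangle_ineq2 by metis
  then show "norm (\<Sum>b\<in>{1..<p}. trig R (D x) (real b / real p)) \<ge>
      real p * (23/32 * G * (x / real p) powr \<sigma>) - (G * x powr \<sigma> + 2 + G / 32)"
    using psp s1 by linarith
  have "(\<Sum>b\<in>{b\<in>{1..<p^2}. \<not> p dvd b}. trig R (D x) (real b / real (p^2))) = - (of_nat p * Sp)"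
    unfolding trig_sum_prime_square[OF p(1)] Sp_def D_eq sum_distrib_left sum_negf[symmetric]
    by (rule sum.cong) (auto simp: algebra_simps amu_eq_0_if_square_dvd[OF p(1)])
  then show "norm (\<Sum>b\<in>{b\<in>{1..<p^2}. \<not> p dvd b}. trig R (D x) (real b / real (p^2))) \<ge>
      real p * (23/32 * G * (x / real p) powr \<sigma>)"
    using psp by (simp only: norm_minus_cancel)
qed

text \<open>For \<sigma> < 1 the main term p (x/p)^\<sigma> exceeds the unwanted x^\<sigma> by the
  factor p^(1-\<sigma>), which \<open>c3\<close> makes at least 8. As \<sigma> \<ge> 1/2, the main
  term is at least sqrt(p x).\<close>

lemma mobius_L1_lower_prime:
  assumes x: "x > 0" "x \<le> real R"
    and e: "32 * (exp 1 * K * (1 + x) * exp (- (real R / x))) \<le> G"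
    and C: "C > 0" "\<And>u. u > 0 \<Longrightarrow> exp (- u) \<le> C * u powr (- (\<sigma> + 1/4))"
    and y: "y \<ge> 9" "y \<le> sqrt (real R)" "y \<le> x" "T = y / (16 * ln y)" "T \<ge> 3"
    and c1: "16 \<le> G * (x / y) powr (1/2)" and c2: "64 * C * x powr (1/4) \<le> G * T"
    and c3: "8 \<le> T powr (1 - \<sigma>)" "\<sigma> \<le> 1"
  shows "T * (G / 2 * sqrt (T * x)) \<le> (2 * real R + 6 * real R * (1 + ln (real R))) * mobius_L1 R"
proof -
  define P where "P = {p. prime p \<and> T < real p \<and> real p \<le> y}"
  have "T \<le> real (card P)" using primes_between_card[OF y(1)] by (simp only: P_def y(4))
  then have "T * (G / 2 * sqrt (T * x)) \<le> real (card P) * (G / 2 * sqrt (T * x))"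
    using x y(5) by (intro mult_right_mono) auto
  also have "\<dots> \<le> (2 * real R + 6 * real R * (1 + ln (real R))) * mobius_L1 R"
  proof (rule primes_sum_le[OF x(1), where k = 1 and y = y and B = "\<lambda>p. {1..<p}"])
    show "1 \<le> p \<and> real p \<le> y" if "p \<in> P" for p using that prime_ge_1_nat by (auto simp: P_def)
    show "1 \<le> b \<and> b \<le> p^1 \<and> coprime b (p^1)" if "p \<in> P" "b \<in> {1..<p}" for p b
    proof -
      have "coprime p b" using that by (intro prime_imp_coprime) (auto simp: P_def dest: dvd_imp_le)
      then show ?thesis using that by (simp add: coprime_commute)
    qed
    fix p assume "p \<in> P"
    then have p: "prime p" "T < real p" "real p \<le> y" by (auto simp: P_def)
    have p3: "p \<ge> 3" using p y by linarith
    have px: "real p \<le> x" using p y by linarith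
    have p0: "real p > 0" using p3 by simp
    have x1: "x / real p \<ge> 1" using px p0 by simp
    define M where "M = (x / real p) powr \<sigma>"
    have "x / y \<le> x / real p" using p p0 x by (intro divide_left_mono) auto
    then have "(x / y) powr (1/2) \<le> (x / real p) powr (1/2)" using x y by (intro powr_mono2) auto
    then have "G * (x / y) powr (1/2) \<le> G * (x / real p) powr (1/2)" by (intro mult_left_mono) auto
    then have d1: "2 \<le> G / 8 * (x / real p) powr (1/2)" using c1 by simp
    have "real p powr 1 \<le> real p powr (\<sigma> + 1/2)" using p3 sigma_half by (intro powr_mono) auto
    then have "T \<le> real p powr (\<sigma> + 1/2)" using p p0 by simp
    then have "G * T \<le> G * real p powr (\<sigma> + 1/2)" by (intro mult_left_mono) auto
    then have d2: "8 * C * x powr (1/4) \<le> G / 8 * real p powr (\<sigma> + 1/2)" using c2 by simp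
    note U = norm_Up_ge[OF x(1) p(1) p3 px C d1 d2]
    have half: "(x / real p) powr (1/2) \<le> M" unfolding M_def using x1 sigma_half by (intro powr_mono) auto
    then have "G / 8 * (x / real p) powr (1/2) \<le> G / 8 * M" by (intro mult_left_mono) auto
    then have m2: "2 \<le> G / 8 * M" using d1 by linarith
    have "1 \<le> M" unfolding M_def using x1 sigma_half by (intro ge_one_powr_ge_zero) auto
    then have m1: "G * 1 \<le> G * M" by (intro mult_left_mono) auto
    have GM: "3 * (G * M) \<le> real p * (G * M)" using p3 by (intro mult_right_mono) (auto simp: M_def)
    have xs: "8 * (G * x powr \<sigma>) \<le> real p * (G * M)"
    proof -
      have "T powr (1 - \<sigma>) \<le> real p powr (1 - \<sigma>)" using p y(5) c3 by (intro powr_mono2) auto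
      then have "8 * x powr \<sigma> \<le> real p powr (1 - \<sigma>) * x powr \<sigma>" using c3 by (intro mult_right_mono) auto
      also have "\<dots> = real p * M" unfolding M_def using p0 x by (simp add: powr_diff powr_divide)
      finally have "G * (8 * x powr \<sigma>) \<le> G * (real p * M)" by (intro mult_left_mono) auto
      then show ?thesis by (simp only: mult_ac)
    qed
    have "sqrt (T * x) \<le> sqrt (real p * x)" using p x by simp
    also have "\<dots> = real p * (x / real p) powr (1/2)"
      using p0 x by (simp add: powr_half_sqrt real_sqrt_mult real_sqrt_divide field_simps)
    also have "\<dots> \<le> real p * M" using half by (intro mult_left_mono) auto
    finally have "G / 2 * sqrt (T * x) \<le> G / 2 * (real p * M)" by (intro mult_left_mono) auto
    also have "\<dots> = 1/2 * (real p * (G * M))" by simp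
    \<comment> \<open>In units of p G M the losses are 1/8 from \<open>xs\<close> and at most (1/8 +
      1/32)/3 from the two constants, as p \<ge> 3; the total 17/96 is below 23/32 - 1/2 =
      21/96.\<close>
    also have "\<dots> \<le> 23/32 * (real p * (G * M)) - (G * x powr \<sigma> + 2 + G / 32)"
      using xs m2 m1 GM by linarith
    also have "\<dots> = real p * (23/32 * G * (x / real p) powr \<sigma>) - (G * x powr \<sigma> + 2 + G / 32)"
      by (simp add: M_def)
    also have "\<dots> \<le> norm (\<Sum>b\<in>{1..<p}. trig R (D x) (real b / real p))"
      by (rule prime_trig_lower(1)[OF x p(1) p3 px U e C])
    finally show "G / 2 * sqrt (T * x) \<le> norm (\<Sum>b\<in>{1..<p}. trig R (D x) (real b / real (p^1)))"
      by (simp only: power_one_right)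
  qed (use y in auto)
  finally show ?thesis .
qed

text \<open>
  For \<open>\<sigma> \<ge> 1\<close> the contribution $x^\sigma$ of the full sum to the sum over fractions with prime denominator
  is not dominated by $p(x/p)^\sigma$. Denominators $p^2$ avoid it, since $\mu$ vanishes on the multiples of $p^2$.
\<close>

lemma mobius_L1_lower_prime_square:
  assumes x: "x > 0" "x \<le> real R"
    and e: "32 * (exp 1 * K * (1 + x) * exp (- (real R / x))) \<le> G"
    and C: "C > 0" "\<And>u. u > 0 \<Longrightarrow> exp (- u) \<le> C * u powr (- (\<sigma> + 1/4))"
    and y: "y \<ge> 9" "y^2 \<le> sqrt (real R)" "y \<le> x" "T = y / (16 * ln y)" "T \<ge> 3"
    and c1: "16 \<le> G * (x / y) powr (1/2)" and c2: "64 * C * x powr (1/4) \<le> G * T powr (3/2)"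
    and c3: "\<sigma> \<ge> 1"
  shows "T * (G / 2 * x) \<le> (2 * real R + 6 * real R * (1 + ln (real R))) * mobius_L1 R"
proof -
  define P where "P = {p. prime p \<and> T < real p \<and> real p \<le> y}"
  have "T * (G / 2 * x) \<le> real (card P) * (G / 2 * x)"
    using primes_between_card[OF y(1)] x y(5) unfolding P_def y(4) by (intro mult_right_mono) auto
  also have "\<dots> \<le> (2 * real R + 6 * real R * (1 + ln (real R))) * mobius_L1 R"
  proof (rule primes_sum_le[OF x(1), where k = 2 and y = y and B = "\<lambda>p. {b\<in>{1..<p^2}. \<not> p dvd b}"])
    show "1 \<le> p \<and> real p \<le> y" if "p \<in> P" for p using that prime_ge_1_nat by (auto simp: P_def)
    show "1 \<le> b \<and> b \<le> p^2 \<and> coprime b (p^2)" if "p \<in> P" "b \<in> {b\<in>{1..<p^2}. \<not> p dvd b}" for p b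
    proof -
      have "coprime p b" using that by (intro prime_imp_coprime) (auto simp: P_def)
      then show ?thesis using that by (simp add: coprime_commute)
    qed
    fix p assume "p \<in> P"
    then have p: "prime p" "T < real p" "real p \<le> y" by (auto simp: P_def)
    have p3: "p \<ge> 3" using p y by linarith
    have px: "real p \<le> x" using p y by linarith
    have p0: "real p > 0" using p3 by simp
    have x1: "x / real p \<ge> 1" using px p0 by simp
    have "x / y \<le> x / real p" using p p0 x by (intro divide_left_mono) auto
    then have "(x / y) powr (1/2) \<le> (x / real p) powr (1/2)" using x y by (intro powr_mono2) auto
    then have "G * (x / y) powr (1/2) \<le> G * (x / real p) powr (1/2)" by (intro mult_left_mono) auto
    then have d1: "2 \<le> G / 8 * (x / real p) powr (1/2)" using c1 by simp
    \<comment> \<open>The power 3/2 is indispensable in this range: T, about R^(1/4) / log R, does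
      not dominate x^(1/4), but T^(3/2) does.\<close>
    have "T powr (3/2) \<le> real p powr (3/2)" using p y by (intro powr_mono2) auto
    also have "\<dots> \<le> real p powr (\<sigma> + 1/2)" using p3 c3 by (intro powr_mono) auto
    finally have "G * T powr (3/2) \<le> G * real p powr (\<sigma> + 1/2)" by (intro mult_left_mono) auto
    then have d2: "8 * C * x powr (1/4) \<le> G / 8 * real p powr (\<sigma> + 1/2)" using c2 by simp
    note U = norm_Up_ge[OF x(1) p(1) p3 px C d1 d2]
    \<comment> \<open>The gain over the prime denominators: \<sigma> \<ge> 1 makes each contribution
      of order x, which compensates for the smaller number of primes.\<close>
    have "(x / real p) powr 1 \<le> (x / real p) powr \<sigma>" using x1 c3 by (intro powr_mono) auto
    then have "x \<le> real p * (x / real p) powr \<sigma>" using p0 x by (simp add: field_simps)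
    then have "G / 2 * x \<le> 23/32 * G * (real p * (x / real p) powr \<sigma>)" using x by (intro mult_mono) auto
    also have "\<dots> = real p * (23/32 * G * (x / real p) powr \<sigma>)" by simp
    also have "\<dots> \<le> norm (\<Sum>b\<in>{b\<in>{1..<p^2}. \<not> p dvd b}. trig R (D x) (real b / real (p^2)))"
      by (rule prime_trig_lower(2)[OF x p(1) p3 px U e C])
    finally show "G / 2 * x \<le> norm (\<Sum>b\<in>{b\<in>{1..<p^2}. \<not> p dvd b}. trig R (D x) (real b / real (p^2)))" .
  qed (use y in auto)
  finally show ?thesis .
qed

lemma G_pos: "G > 0"
  using Re_rho by (auto simp: Gamma_eq_zero_iff elim!: nonpos_Ints_cases)

lemma eventually_mobius_L1_ge:
  assumes eps: "\<epsilon> > 0"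
  shows "eventually (\<lambda>R. mobius_L1 R \<ge> real R powr (1/4 - \<epsilon>)) sequentially"
proof -
  obtain C where C: "C > 0" "\<And>u. u > 0 \<Longrightarrow> exp (- u) \<le> C * u powr (- (\<sigma> + 1/4))"
    using exp_minus_le_powr[of "\<sigma> + 1/4"] sigma_half by auto
  \<comment> \<open>With this choice e^(-R/x) = R^(-4), so the truncation error tends to 0 although
    x is smaller than R by a logarithm only.\<close>
  define X where "X = (\<lambda>r::real. r / (4 * ln r))"
  have ex: "eventually (\<lambda>R. 32 * (exp 1 * K * (1 + X (real R)) * exp (- (real R / X (real R)))) \<le> G) sequentially"
  proof -
    have "filterlim (\<lambda>r::real. 1 / ((1 + r / (4 * ln r)) * exp (- (r / (r / (4 * ln r)))))) at_top at_top" by real_asymp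
    then have "eventually (\<lambda>R. 32 * (exp 1 * K) \<le> G * (1 / ((1 + X (real R)) * exp (- (real R / X (real R)))))) sequentially"
      unfolding X_def by (rule eventually_le_mult_at_top[OF _ G_pos])
    moreover have "eventually (\<lambda>R. X (real R) > 0) sequentially" unfolding X_def by real_asymp
    ultimately show ?thesis
    proof eventually_elim
      case (elim R)
      define w where "w = (1 + X (real R)) * exp (- (real R / X (real R)))"
      have "w > 0" using elim(2) by (auto simp: w_def intro!: mult_pos_pos)
      then have "32 * (exp 1 * K) * w \<le> G" using elim(1) unfolding w_def[symmetric] by (simp add: field_simps)
      then show ?case by (simp only: w_def mult_ac)
    qed
  qed
  have ex0: "eventually (\<lambda>R. X (real R) > 0 \<and> X (real R) \<le> real R) sequentially"
    unfolding X_def by (intro eventually_conj; real_asymp)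
  show ?thesis
  proof (cases "\<sigma> < 1")
    case True
    \<comment> \<open>The largest range of primes p compatible with Farey order sqrt R.\<close>
    define Y where "Y = (\<lambda>r::real. r powr (1/2))"
    define T where "T = (\<lambda>r. Y r / (16 * ln (Y r)))"
    have y: "eventually (\<lambda>R. Y (real R) \<ge> 9 \<and> Y (real R) \<le> X (real R) \<and> T (real R) \<ge> 3) sequentially"
      unfolding T_def X_def Y_def by (intro eventually_conj; real_asymp)
    have "filterlim (\<lambda>r::real. (r / (4 * ln r) / r powr (1/2)) powr (1/2)) at_top at_top" by real_asymp
    then have c1: "eventually (\<lambda>R. 16 \<le> G * (X (real R) / Y (real R)) powr (1/2)) sequentially"
      unfolding X_def Y_def by (rule eventually_le_mult_at_top[OF _ G_pos])
    have "filterlim (\<lambda>r::real. (r powr (1/2) / (16 * ln (r powr (1/2)))) / (r / (4 * ln r)) powr (1/4)) at_top at_top" by real_asymp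
    then have c2: "eventually (\<lambda>R. 64 * C \<le> G * (T (real R) / X (real R) powr (1/4))) sequentially"
      unfolding X_def Y_def T_def by (rule eventually_le_mult_at_top[OF _ G_pos])
    have "filterlim T at_top at_top" unfolding T_def Y_def by real_asymp
    moreover have "filterlim (\<lambda>t. t powr (1 - \<sigma>)) at_top at_top" using True by real_asymp
    ultimately have "filterlim (\<lambda>r. T r powr (1 - \<sigma>)) at_top at_top" by (rule filterlim_compose[rotated])
    then have c3: "eventually (\<lambda>R. 8 \<le> 1 * T (real R) powr (1 - \<sigma>)) sequentially"
      by (rule eventually_le_mult_at_top) simp
    \<comment> \<open>Up to logarithms the numerator is R^(1/2) R^(3/4) and the denominator
      R^(1/4-\<epsilon>) R, so R^\<epsilon> is left to absorb the logarithms.\<close>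
    have "filterlim (\<lambda>r::real. (r powr (1/2) / (16 * ln (r powr (1/2)))) * sqrt ((r powr (1/2) / (16 * ln (r powr (1/2)))) * (r / (4 * ln r)))
        / (r powr (1/4 - \<epsilon>) * (2 * r + 6 * r * (1 + ln r)))) at_top at_top"
      using eps by real_asymp
    then have fin: "eventually (\<lambda>R. 2 \<le> G * (T (real R) * sqrt (T (real R) * X (real R))
        / (real R powr (1/4 - \<epsilon>) * (2 * real R + 6 * real R * (1 + ln (real R)))))) sequentially"
      unfolding X_def Y_def T_def by (rule eventually_le_mult_at_top[OF _ G_pos])
    have "eventually (\<lambda>R::nat. R \<ge> 1) sequentially" by (rule eventually_ge_at_top)
    then show ?thesis using ex ex0 y c1 c2 c3 fin
    proof eventually_elim
      case (elim R)
      define Z where "Z = 2 * real R + 6 * real R * (1 + ln (real R))"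
      have Z: "Z > 0" using elim(1) by (auto simp: Z_def intro!: add_pos_nonneg)
      define u where "u = real R powr (1/4 - \<epsilon>)"
      have u: "u > 0" using elim(1) by (simp add: u_def)
      have xp: "X (real R) powr (1/4) > 0" using elim(3) by simp
      have c2: "64 * C * X (real R) powr (1/4) \<le> G * T (real R)" using elim(6) xp by (simp add: field_simps)
      have yy: "Y (real R) \<le> sqrt (real R)" by (simp add: Y_def powr_half_sqrt)
      have "T (real R) * (G / 2 * sqrt (T (real R) * X (real R))) \<le> Z * mobius_L1 R"
        unfolding Z_def
        by (rule mobius_L1_lower_prime[where C = C and y = "Y (real R)"])
          (use elim C c2 True yy in \<open>auto simp: T_def\<close>)
      moreover have "2 * (u * Z) \<le> G * (T (real R) * sqrt (T (real R) * X (real R)))"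
        using elim(8) u Z unfolding Z_def[symmetric] u_def[symmetric] by (simp add: field_simps)
      ultimately have "u * Z \<le> mobius_L1 R * Z" by (simp add: algebra_simps)
      then show ?case using Z by (simp add: u_def)
    qed
  next
    case False
    \<comment> \<open>Here p^2 must stay below sqrt R.\<close>
    define Y where "Y = (\<lambda>r::real. r powr (1/4))"
    define T where "T = (\<lambda>r. Y r / (16 * ln (Y r)))"
    have y: "eventually (\<lambda>R. Y (real R) \<ge> 9 \<and> Y (real R) \<le> X (real R) \<and> T (real R) \<ge> 3) sequentially"
      unfolding T_def X_def Y_def by (intro eventually_conj; real_asymp)
    have "filterlim (\<lambda>r::real. (r / (4 * ln r) / r powr (1/4)) powr (1/2)) at_top at_top" by real_asymp
    then have c1: "eventually (\<lambda>R. 16 \<le> G * (X (real R) / Y (real R)) powr (1/2)) sequentially"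
      unfolding X_def Y_def by (rule eventually_le_mult_at_top[OF _ G_pos])
    have "filterlim (\<lambda>r::real. (r powr (1/4) / (16 * ln (r powr (1/4)))) powr (3/2) / (r / (4 * ln r)) powr (1/4)) at_top at_top" by real_asymp
    then have c2: "eventually (\<lambda>R. 64 * C \<le> G * (T (real R) powr (3/2) / X (real R) powr (1/4))) sequentially"
      unfolding X_def Y_def T_def by (rule eventually_le_mult_at_top[OF _ G_pos])
    have "filterlim (\<lambda>r::real. (r powr (1/4) / (16 * ln (r powr (1/4)))) * (r / (4 * ln r))
        / (r powr (1/4 - \<epsilon>) * (2 * r + 6 * r * (1 + ln r)))) at_top at_top"
      using eps by real_asymp
    then have fin: "eventually (\<lambda>R. 2 \<le> G * (T (real R) * X (real R)
        / (real R powr (1/4 - \<epsilon>) * (2 * real R + 6 * real R * (1 + ln (real R)))))) sequentially"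
      unfolding X_def Y_def T_def by (rule eventually_le_mult_at_top[OF _ G_pos])
    have "eventually (\<lambda>R::nat. R \<ge> 1) sequentially" by (rule eventually_ge_at_top)
    then show ?thesis using ex ex0 y c1 c2 fin
    proof eventually_elim
      case (elim R)
      define Z where "Z = 2 * real R + 6 * real R * (1 + ln (real R))"
      have Z: "Z > 0" using elim(1) by (auto simp: Z_def intro!: add_pos_nonneg)
      define u where "u = real R powr (1/4 - \<epsilon>)"
      have u: "u > 0" using elim(1) by (simp add: u_def)
      have xp: "X (real R) powr (1/4) > 0" using elim(3) by simp
      have c2: "64 * C * X (real R) powr (1/4) \<le> G * T (real R) powr (3/2)" using elim(6) xp by (simp add: field_simps)
      have y2: "(Y (real R))^2 = sqrt (real R)"
      proof -
        have "(Y (real R))^2 = Y (real R) * Y (real R)" by (rule power2_eq_square)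
        also have "\<dots> = real R powr (1/2)" by (simp add: Y_def flip: powr_add)
        finally show ?thesis by (simp add: powr_half_sqrt)
      qed
      have "T (real R) * (G / 2 * X (real R)) \<le> Z * mobius_L1 R"
        unfolding Z_def
        by (rule mobius_L1_lower_prime_square[where C = C and y = "Y (real R)"])
          (use elim C c2 False y2 in \<open>auto simp: T_def\<close>)
      moreover have "2 * (u * Z) \<le> G * (T (real R) * X (real R))"
        using elim(7) u Z unfolding Z_def[symmetric] u_def[symmetric] by (simp add: field_simps)
      ultimately have "u * Z \<le> mobius_L1 R * Z" by (simp add: algebra_simps)
      then show ?case using Z by (simp add: u_def)
    qed
  qed
qed

end

section \<open>The norms in the Fourier ratio\<close>

lemma fourier_transform_mu:
  "fourier_transform R (\<lambda>n. of_int (mu_R R n)) \<alpha> = trig R (\<lambda>n. of_int (moebius n)) (- \<alpha>)"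
  unfolding fourier_transform_trig trig_def
  by (rule sum.cong) (auto simp: mu_R_def X'_def X_def)

lemma Lp_norm_1_eq:
  assumes "continuous_on {0..1} f"
  shows "Lp_norm 1 f = integral {0..1} (\<lambda>x. norm (f x))"
proof -
  have "(LINT x:{0..1}|lebesgue. norm (f x)) = integral {0..1} (\<lambda>x. norm (f x))"
    by (intro set_lebesgue_integral_eq_integral(2) absolutely_integrable_continuous_real continuous_intros assms)
  then show ?thesis by (simp add: Lp_norm_def integral_nonneg integrable_continuous_real continuous_on_norm assms)
qed

lemma Lp_norm_2_eq:
  assumes "continuous_on {0..1} f"
  shows "Lp_norm 2 f = sqrt (integral {0..1} (\<lambda>x. (norm (f x))^2))"
proof -
  have "norm (f x) powr 2 = (norm (f x))^2" for x by (cases "f x = 0") auto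
  moreover have "(LINT x:{0..1}|lebesgue. (norm (f x))^2) = integral {0..1} (\<lambda>x. (norm (f x))^2)"
    by (intro set_lebesgue_integral_eq_integral(2) absolutely_integrable_continuous_real continuous_intros assms)
  moreover have "integral {0..1} (\<lambda>x. (norm (f x))^2) \<ge> 0"
    by (intro integral_nonneg integrable_continuous_real continuous_intros assms) simp
  ultimately show ?thesis by (simp add: Lp_norm_def powr_half_sqrt)
qed

lemma trig_parseval:
  "integral {0..1} (\<lambda>\<alpha>. (norm (trig R f (- \<alpha>)))^2) = (\<Sum>n=1..R. (norm (f n))^2)"
proof -
  have e0: "ee 0 = 1" using ee_of_int[of 0] by simp
  have "trig R f (- \<alpha>) * trig R (\<lambda>n. cnj (f n)) (0 + \<alpha>) = of_real ((norm (trig R f (- \<alpha>)))^2)" for \<alpha>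
  proof -
    have "trig R (\<lambda>n. cnj (f n)) (0 + \<alpha>) = cnj (trig R f (- \<alpha>))"
      by (simp add: trig_def ee_def cis_cnj)
    then show ?thesis by (simp only: complex_norm_square)
  qed
  then have "((\<lambda>\<alpha>. complex_of_real ((norm (trig R f (- \<alpha>)))^2)) has_integral (trig R (\<lambda>n. f n * cnj (f n)) 0)) {0..1}"
    using trig_product_integral[of R f "\<lambda>n. cnj (f n)" 0] by simp
  moreover have "trig R (\<lambda>n. f n * cnj (f n)) 0 = of_real (\<Sum>n=1..R. (norm (f n))^2)"
    by (simp only: of_real_sum complex_norm_square) (simp add: trig_def e0)
  ultimately have "((\<lambda>\<alpha>. complex_of_real ((norm (trig R f (- \<alpha>)))^2)) has_integral of_real (\<Sum>n=1..R. (norm (f n))^2)) {0..1}" by simp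
  from has_integral_linear[OF this bounded_linear_Re]
  have "((\<lambda>\<alpha>. (norm (trig R f (- \<alpha>)))^2) has_integral (\<Sum>n=1..R. (norm (f n))^2)) {0..1}"
    by (simp only: o_def Re_complex_of_real)
  then show ?thesis by (rule integral_unique)
qed

text \<open>By Parseval the squared L2 norm is the number of squarefree integers up to R, of which
  only the trivial upper bound R is used.\<close>

lemma FR_mu_ge:
  assumes R: "R \<ge> 1"
  shows "FR R (\<lambda>n. of_int (mu_R R n)) \<ge> mobius_L1 R / sqrt (real R)"
proof -
  define N2 where "N2 = (\<Sum>n=1..R. (norm (complex_of_int (moebius n)))^2)"
  have "N2 \<le> (\<Sum>n=1..R. 1)" unfolding N2_def
    by (intro sum_mono) (auto simp: moebius_def minus_one_power_iff)
  then have N2: "N2 \<le> real R" by simp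
  \<comment> \<open>The term n = 1 keeps the denominator away from 0, where division would return
    0.\<close>
  have "(norm (complex_of_int (moebius 1)))^2 \<le> N2" unfolding N2_def using R by (intro member_le_sum) auto
  then have N1: "1 \<le> N2" by (simp add: moebius_def)
  have "FR R (\<lambda>n. of_int (mu_R R n)) = mobius_L1 R / sqrt N2"
    unfolding FR_def fourier_transform_mu Lp_norm_1_eq[OF continuous_on_trig] Lp_norm_2_eq[OF continuous_on_trig]
      mobius_L1_def N2_def trig_parseval ..
  also have "\<dots> \<ge> mobius_L1 R / sqrt (real R)"
    using N1 N2 mobius_L1_nonneg by (intro divide_left_mono) (auto intro!: mult_pos_pos)
  finally show ?thesis .
qed

theorem theorem1p2:
  fixes \<epsilon> :: real
  assumes "\<epsilon> > 0"
  shows "\<exists>C::real. C > 0 \<and> (\<exists>R0::nat. R0 \<ge> 1 \<and>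
           (\<forall>R::nat. R \<ge> R0 \<longrightarrow>
              FR R (\<lambda>n. of_int (mu_R R n)) \<ge> C * real R powr (- 1 / 4 - \<epsilon>)))"
proof -
  obtain \<rho> where "Re \<rho> \<ge> 1/2" "L4 \<rho> = 0" using exists_L4_zero by blast
  then interpret L4_zero \<rho> by unfold_locales
  obtain R0 where R0: "\<And>R. R \<ge> R0 \<Longrightarrow> mobius_L1 R \<ge> real R powr (1/4 - \<epsilon>)"
    using eventually_mobius_L1_ge[OF assms] unfolding eventually_sequentially by blast
  \<comment> \<open>The constant may be taken to be 1: the implied constants are already absorbed in
    R^\<epsilon>, at the price of a larger threshold.\<close>
  have "FR R (\<lambda>n. of_int (mu_R R n)) \<ge> 1 * real R powr (- 1 / 4 - \<epsilon>)" if "R \<ge> max 1 R0" for R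
  proof -
    have "real R powr (- 1 / 4 - \<epsilon>) = real R powr (1/4 - \<epsilon>) / real R powr (1/2)"
      by (simp flip: powr_diff)
    also have "\<dots> = real R powr (1/4 - \<epsilon>) / sqrt (real R)" by (simp add: powr_half_sqrt)
    also have "\<dots> \<le> mobius_L1 R / sqrt (real R)" using R0 that by (intro divide_right_mono) auto
    also have "\<dots> \<le> FR R (\<lambda>n. of_int (mu_R R n))" using that by (intro FR_mu_ge) simp
    finally show ?thesis by simp
  qed
  then show ?thesis by (intro exI[of _ 1] conjI exI[of _ "max 1 R0"]) auto
qed

end
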